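(* Let $m\ge2$ and $r\in\{1,2,\ldots,m-1\}$ be integers. Then $$ \begin{aligned} \gamma_2\!\left(\frac rm\right)=\;&\gamma_2+\frac23\sum_{l=1}^{m-1}\cos\frac{2\pi rl}{m}\cdot\zeta'''\!\left(0,\frac lm\right)-2(\gamma+\ln2\pi m)\sum_{l=1}^{m-1}\cos\frac{2\pi rl}{m}\cdot\zeta''\!\left(0,\frac lm\right)\\ &+\pi\sum_{l=1}^{m-1}\sin\frac{2\pi rl}{m}\cdot\zeta''\!\left(0,\frac lm\right)-2\pi(\gamma+\ln2\pi m)\sum_{l=1}^{m-1}\sin\frac{2\pi rl}{m}\cdot\ln\Gamma\!\left(\frac lm\right)\\ &+\left[\frac{\pi^2}{12}-(\gamma+\ln2\pi m)^2\right]\sum_{l=1}^{m-1}\cos\frac{2\pi rl}{m}\cdot\ln\sin\frac{\pi l}{m}+\gamma^2\ln2-2\gamma_1\ln m\\ &+\left[\frac{\pi^2}{12}+(\gamma+\ln2\pi m)^2\right]\cdot\frac\pi2\cot\frac{\pi r}{m}+\gamma\left(\ln^2m+2\ln^22+2\ln2\cdot\ln\pi m\right)\\ &-\frac{\pi^2}{12}\ln2+\left(\ln^22+\ln^2m+\ln^2\pi+2\ln\pi\cdot\ln m+2\ln2\cdot\ln\pi m\right)\ln2+\frac13\ln^3m. \end{aligned} $$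
   Context: $\zeta(s,v)$ is the Hurwitz zeta function, $\zeta(s,v)=\sum_{n\ge0}(n+v)^{-s}$ for $\operatorname{Re}s>1$, continued meromorphically in $s$. The generalized Stieltjes constants $\gamma_n(v)$ are defined by the Laurent expansion at $s=1$: $\zeta(s,v)=\frac1{s-1}+\sum_{n\ge0}\frac{(-1)^n(s-1)^n}{n!}\gamma_n(v)$; the Stieltjes constants are $\gamma_n=\gamma_n(1)$, and $\gamma=\gamma_0$ is Euler's constant. $\zeta''(0,v)$ and $\zeta'''(0,v)$ denote the second and third derivatives of $\zeta(s,v)$ with respect to $s$ at $s=0$. $\ln2\pi m=\ln(2\pi m)$, $\ln\pi m=\ln(\pi m)$, $\ln^kx=(\ln x)^k$. *)

theory Defs
  imports "HOL-Complex_Analysis.Complex_Analysis"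
begin

(* "nicely" makes the meromorphic continuation a unique total function: it takes the value 0
   at its poles and is continuous elsewhere. The value at the pole s = 1 is never relevant.
   The powers are principal ones; the intended range of the parameter is v > 0. *)
definition is_hurwitz_continuation :: "real \<Rightarrow> (complex \<Rightarrow> complex) \<Rightarrow> bool" where
  "is_hurwitz_continuation v f \<longleftrightarrow>
     f nicely_meromorphic_on UNIV \<and>
     (\<forall>s. Re s > 1 \<longrightarrow> (\<lambda>n::nat. complex_of_real (real n + v) powr (- s)) sums f s)"

definition hurwitz_zeta :: "complex \<Rightarrow> real \<Rightarrow> complex" where
  "hurwitz_zeta s v = (THE f. is_hurwitz_continuation v f) s"

(* Since zeta(s,v) - 1/(s-1) is the sum of (-1)^n (s-1)^n / n! * gamma_n(v), the constant
   gamma_n(v) is (-1)^n n! times the n-th Laurent coefficient of zeta(s,v) at s = 1. *)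
definition gen_stieltjes :: "nat \<Rightarrow> real \<Rightarrow> complex" where
  "gen_stieltjes n v =
     (-1) ^ n * fact n * fls_nth (laurent_expansion (\<lambda>s. hurwitz_zeta s v) 1) (int n)"

abbreviation stieltjes :: "nat \<Rightarrow> complex" where
  "stieltjes n \<equiv> gen_stieltjes n 1"

definition hurwitz_zeta_deriv0 :: "nat \<Rightarrow> real \<Rightarrow> complex" where
  "hurwitz_zeta_deriv0 n v = (deriv ^^ n) (\<lambda>s. hurwitz_zeta s v) 0"

end

(* With a = r/m and z = exp(2 pi i a), the integral of t^s z e^(-t) / (1 - z e^(-t))^2 over t > 0 continues
   Gamma(s+1) Li_s(z) to Re s > -1. Inserting the partial fractions of 1/sin^2 and integrating termwise for
   -1 < s < 0 expresses Li_s(z) by zeta(1-s,a) and zeta(1-s,1-a); inverting this 2x2 system gives Rademacher's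
   functional equation, which at the same time continues zeta(s,r/m) to the whole plane. Near s = 0 it reads
     zeta(1-s,r/m) = m^(-s) zeta(1-s)
       + 2 Gamma(s) (2 pi m)^(-s) (cos(pi s/2) C(s) + sin(pi s/2) S(s)),
   where C and S are the sums over 0 < l < m of cos(2 pi r l/m) zeta(s,l/m) and sin(2 pi r l/m) zeta(s,l/m).
   Since C(0) = 0, the coefficients of s^2 only involve Gamma up to second order; the low coefficients of C and S
   come from Lerch's formula zeta'(0,v) = ln Gamma(v) - ln(2 pi)/2 and the reflection formula for Gamma. *)
theory Submission
  imports Defs "HOL-Real_Asymp.Real_Asymp"
begin

text \<open>\<open>hurwitz_zeta\<close> is a definite description over functions on the whole plane,
  so a continuation to the whole plane has to be exhibited before any of its values is accessible.
  The trapezoidal series used here reaches only Re s > -1; the functional equation, which stays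
  within parameters of denominator m, supplies the rest, and that is why the continuation is built
  for rational parameters. To keep poles out of the identities, the functions handled are (s-1)
  zeta(s,v) and Gamma(1+s) = s Gamma(s). Each identity is proved on a real interval where series or
  integrals converge and is spread by the identity theorem. For z = 1 the kernel is singular at t =
  0, so r = m is reached by a detour through the parameter 1/2. The term l = m of the full sum is
  what becomes m^(-s) zeta(1-s); over the remaining l the cosines sum to -1 and, weighted with l/m,
  to -1/2, which together with zeta(0,v) = 1/2 - v gives C(0) = 0. The factor s - 1 raises indices
  by one: gamma_2 sits in the third Taylor coefficient.\<close>

section \<open>Parameter integrals\<close>

text \<open>Cauchy's inequality turns the local majorant h of the integrand into the majorant 3 h /
  r of its difference quotients, so dominated convergence allows differentiation under the
  integral.\<close>

lemma holomorphic_on_lebesgue_integral: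
  fixes f :: "complex \<Rightarrow> 'a \<Rightarrow> complex"
  assumes S: "open S"
    and meas: "\<And>z. z \<in> S \<Longrightarrow> f z \<in> borel_measurable M"
    and hol: "\<And>x. x \<in> space M \<Longrightarrow> (\<lambda>z. f z x) holomorphic_on S"
    and bound: "\<And>z. z \<in> S \<Longrightarrow> \<exists>r>0. \<exists>h. ball z r \<subseteq> S \<and> integrable M h \<and>
                  (\<forall>w\<in>ball z r. \<forall>x\<in>space M. norm (f w x) \<le> h x)"
  shows "(\<lambda>z. LINT x|M. f z x) holomorphic_on S"
proof -
  have "((\<lambda>z. LINT x|M. f z x) has_field_derivative (LINT x|M. deriv (\<lambda>z. f z x) z)) (at z)"
    if z: "z \<in> S" for z
  proof -
    obtain r h where r: "r > 0" "ball z r \<subseteq> S" and h: "integrable M h"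
      and fh: "\<And>w x. w \<in> ball z r \<Longrightarrow> x \<in> space M \<Longrightarrow> norm (f w x) \<le> h x"
      using bound[OF z] by blast
    have int: "integrable M (f w)" if "w \<in> ball z r" for w
      using meas[of w] fh[OF that] r(2) that
      by (intro Bochner_Integration.integrable_bound[OF h]) (auto intro!: AE_I2 order_trans[OF _ abs_ge_self])
    have der_le: "norm (deriv (\<lambda>z. f z x) w) \<le> h x / (r/3)"
      if w: "w \<in> ball z (r/2)" and x: "x \<in> space M" for w x
    proof -
      \<comment> \<open>Since r/2 + r/3 < r, the disc to which Cauchy's inequality is applied stays
        where \<open>h\<close> bounds the integrand.\<close>
      have sub: "cball w (r/3) \<subseteq> ball z r"
        using w r(1) by (intro cball_subset_ball_iff[THEN iffD2]) (auto simp: dist_commute)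
      have "norm ((deriv ^^ 1) (\<lambda>z. f z x) w) \<le> fact 1 * h x / (r/3) ^ 1"
      proof (rule Cauchy_inequality)
        show "(\<lambda>z. f z x) holomorphic_on ball w (r/3)"
          using hol[OF x] sub r(2) by (meson ball_subset_cball holomorphic_on_subset subset_trans)
        show "continuous_on (cball w (r/3)) (\<lambda>z. f z x)"
          using hol[OF x] sub r(2) by (meson holomorphic_on_imp_continuous_on holomorphic_on_subset subset_trans)
        show "norm (f y x) \<le> h x" if "norm (w - y) = r/3" for y
          using that sub x by (intro fh) (auto simp: dist_norm subset_iff)
      qed (use r in auto)
      thus ?thesis by simp
    qed
    have quot_le: "norm ((f w x - f z x) / (w - z)) \<le> h x / (r/3)"
      if w: "w \<in> ball z (r/2)" and x: "x \<in> space M" for w x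
    proof (cases "w = z")
      case True
      have "norm (f z x) \<le> h x" using fh[of z x] r x by auto
      hence "h x \<ge> 0" using norm_ge_zero order_trans by blast
      thus ?thesis using True r by simp
    next
      case False
      have "norm (f w x - f z x) \<le> h x / (r/3) * norm (w - z)"
      proof (rule field_differentiable_bound[of "ball z (r/2)" "\<lambda>z. f z x" "deriv (\<lambda>z. f z x)"])
        fix y assume y: "y \<in> ball z (r/2)"
        hence "y \<in> S" using r by (auto simp: subset_iff)
        hence "((\<lambda>z. f z x) has_field_derivative deriv (\<lambda>z. f z x) y) (at y)"
          using hol[OF x] S holomorphic_derivI by blast
        thus "((\<lambda>z. f z x) has_field_derivative deriv (\<lambda>z. f z x) y) (at y within ball z (r/2))"
          by (rule has_field_derivative_at_within)
      qed (use der_le x w r in auto)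
      thus ?thesis using False by (simp add: norm_divide field_simps)
    qed
    show ?thesis
      unfolding has_field_derivative_iff tendsto_at_iff_sequentially
    proof (intro allI impI)
      fix X assume X: "\<forall>i. X i \<in> UNIV - {z}" "X \<longlonglongrightarrow> z"
      have "eventually (\<lambda>n. X n \<in> ball z (r/2)) sequentially"
        using X(2) r by (intro topological_tendstoD) auto
      then obtain N where N: "\<And>n. n \<ge> N \<Longrightarrow> X n \<in> ball z (r/2)"
        by (auto simp: eventually_sequentially)
      \<comment> \<open>Dropping N terms puts every point of the sequence, not just almost all, into
        the disc where the majorant holds.\<close>
      define Y where "Y = (\<lambda>n. X (n + N))"
      have Y: "Y n \<in> ball z (r/2)" "Y n \<in> ball z r" "Y n \<noteq> z" for n
        using N[of "n + N"] X(1) r by (auto simp: Y_def)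
      have Ylim: "Y \<longlonglongrightarrow> z" using X(2) unfolding Y_def by (rule LIMSEQ_ignore_initial_segment)
      have lim: "(\<lambda>n. (f (Y n) x - f z x) / (Y n - z)) \<longlonglongrightarrow> deriv (\<lambda>z. f z x) z"
        if x: "x \<in> space M" for x
      proof -
        have "((\<lambda>z. f z x) has_field_derivative deriv (\<lambda>z. f z x) z) (at z)"
          using hol[OF x] S z holomorphic_derivI by blast
        hence "((\<lambda>w. (f w x - f z x) / (w - z)) \<longlongrightarrow> deriv (\<lambda>z. f z x) z) (at z)"
          by (simp add: has_field_derivative_iff)
        thus ?thesis
          by (rule filterlim_compose) (use Ylim Y in \<open>auto simp: filterlim_at\<close>)
      qed
      have measq: "(\<lambda>x. (f (Y n) x - f z x) / (Y n - z)) \<in> borel_measurable M" for n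
        using meas[of "Y n"] meas[of z] z Y(2)[of n] r(2) by (auto simp: subset_iff)
      have "(\<lambda>n. LINT x|M. (f (Y n) x - f z x) / (Y n - z)) \<longlonglongrightarrow> (LINT x|M. deriv (\<lambda>z. f z x) z)"
      proof (rule integral_dominated_convergence[where w = "\<lambda>x. h x / (r/3)"])
        show "(\<lambda>x. deriv (\<lambda>z. f z x) z) \<in> borel_measurable M"
          using lim by (rule borel_measurable_LIMSEQ_metric[OF measq])
        show "integrable M (\<lambda>x. h x / (r / 3))" using h by simp
      qed (use measq lim quot_le Y in auto)
      also have "(\<lambda>n. LINT x|M. (f (Y n) x - f z x) / (Y n - z)) =
          (\<lambda>n. ((LINT x|M. f (Y n) x) - (LINT x|M. f z x)) / (Y n - z))"
        using int[OF Y(2)] int[of z] r by (subst integral_divide_zero, subst Bochner_Integration.integral_diff) auto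
      finally have "(\<lambda>n. ((LINT x|M. f (X (n+N)) x) - (LINT x|M. f z x)) / (X (n+N) - z)) \<longlonglongrightarrow> (LINT x|M. deriv (\<lambda>z. f z x) z)"
        unfolding Y_def .
      from LIMSEQ_offset[OF this]
      show "((\<lambda>y. ((LINT x|M. f y x) - (LINT x|M. f z x)) / (y - z)) \<circ> X) \<longlonglongrightarrow> (LINT x|M. deriv (\<lambda>z. f z x) z)"
        by (simp add: o_def)
    qed
  qed
  thus ?thesis
    by (subst holomorphic_on_open[OF S]) blast
qed

section \<open>Partial fractions and Mellin integrals\<close>

lemma sin_pi_times_nonzero:
  fixes z :: complex
  assumes z: "z \<notin> \<int>"
  shows "sin (of_real pi * z) \<noteq> 0"
proof
  assume "sin (of_real pi * z) = 0"
  then obtain n :: int where "of_real pi * z = of_real n * of_real pi"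
    by (auto simp: sin_eq_0)
  hence "z = of_int n" by simp
  with z show False by simp
qed

text \<open>Logarithmic differentiation of Gamma z Gamma (1-z) = pi / sin (pi z): both sides are
  differentiated and the common nonzero factor is cancelled.\<close>

lemma Digamma_reflection:
  fixes z :: complex
  assumes z: "z \<notin> \<int>"
  shows "Digamma z - Digamma (1 - z) = - of_real pi * cot (of_real pi * z)"
proof -
  have z': "z \<notin> \<int>\<^sub>\<le>\<^sub>0" "1 - z \<notin> \<int>\<^sub>\<le>\<^sub>0"
    using z nonpos_Ints_subset_Ints Ints_diff[of 1 "1 - z"] by auto
  note nz = sin_pi_times_nonzero[OF z]
  have "((\<lambda>z::complex. Gamma z * Gamma (1 - z)) has_field_derivative
          Gamma z * Digamma z * Gamma (1 - z) - Gamma z * (Gamma (1 - z) * Digamma (1 - z))) (at z)"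
    using z' by (auto intro!: derivative_eq_intros simp: algebra_simps)
  moreover have "((\<lambda>z::complex. Gamma z * Gamma (1 - z)) has_field_derivative
          - (of_real pi * (of_real pi * cos (of_real pi * z))) / sin (of_real pi * z) ^ 2) (at z)"
    unfolding Gamma_reflection_complex using nz
    by (auto intro!: derivative_eq_intros simp: power2_eq_square algebra_simps)
  ultimately have eq: "Gamma z * Gamma (1 - z) * (Digamma z - Digamma (1 - z)) =
      - (of_real pi * (of_real pi * cos (of_real pi * z))) / sin (of_real pi * z) ^ 2"
    by (auto dest: DERIV_unique simp: algebra_simps)
  have "(of_real pi / sin (of_real pi * z)) * (Digamma z - Digamma (1 - z)) =
        (of_real pi / sin (of_real pi * z)) * (- of_real pi * cot (of_real pi * z))"
    using eq unfolding Gamma_reflection_complex by (simp add: cot_def power2_eq_square)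
  moreover have "of_real pi / sin (of_real pi * z) \<noteq> 0" using nz by simp
  ultimately show ?thesis using mult_left_cancel by blast
qed

text \<open>Derivative of \<open>Digamma_reflection\<close>, which holds in a whole neighbourhood of
  z because the complement of the integers is open.\<close>

lemma Polygamma_1_reflection:
  fixes z :: complex
  assumes z: "z \<notin> \<int>"
  shows "Polygamma 1 z + Polygamma 1 (1 - z) = (of_real pi / sin (of_real pi * z))\<^sup>2"
proof -
  have z': "z \<notin> \<int>\<^sub>\<le>\<^sub>0" "1 - z \<notin> \<int>\<^sub>\<le>\<^sub>0"
    using z nonpos_Ints_subset_Ints Ints_diff[of 1 "1 - z"] by auto
  note nz = sin_pi_times_nonzero[OF z]
  have D1: "((\<lambda>z::complex. Digamma z - Digamma (1 - z)) has_field_derivative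
          Polygamma 1 z + Polygamma 1 (1 - z)) (at z)"
    using z' by (auto intro!: derivative_eq_intros simp: algebra_simps)
  have D2: "((\<lambda>z::complex. - of_real pi * (cos (of_real pi * z) / sin (of_real pi * z))) has_field_derivative
          (of_real pi / sin (of_real pi * z))\<^sup>2) (at z)"
  proof -
    have "cos (of_real pi * z) * cos (of_real pi * z) = 1 - sin (of_real pi * z) * sin (of_real pi * z)"
      using sin_cos_squared_add[of "of_real pi * z"] by (simp add: power2_eq_square algebra_simps)
    hence eq: "(of_real pi / sin (of_real pi * z))\<^sup>2 = - of_real pi *
        ((- (of_real pi * sin (of_real pi * z)) * sin (of_real pi * z) - cos (of_real pi * z) * (of_real pi * cos (of_real pi * z)))
          / (sin (of_real pi * z) * sin (of_real pi * z)))"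
      using nz by (simp add: power2_eq_square divide_simps) algebra
    show ?thesis
      unfolding eq using nz
      by (auto intro!: derivative_eq_intros simp: algebra_simps) (simp add: divide_simps)
  qed
  have "eventually (\<lambda>z::complex. z \<in> - \<int>) (nhds z)"
    using z by (intro eventually_nhds_in_open) auto
  hence ev: "eventually (\<lambda>z::complex. Digamma z - Digamma (1 - z) =
           - of_real pi * (cos (of_real pi * z) / sin (of_real pi * z))) (nhds z)"
    by eventually_elim (auto simp: Digamma_reflection cot_def)
  show ?thesis
    using D1 D2 DERIV_cong_ev[OF refl ev refl] by (intro DERIV_unique[OF D1]) auto
qed

text \<open>The series of 1/(z+k)^2 over all integers k, folded at 0: trigamma at z collects k >= 0,
  trigamma at 1 - z collects k < 0.\<close>

lemma sums_inverse_sin_squared: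
  fixes z :: complex
  assumes z: "z \<notin> \<int>"
  shows "(\<lambda>n. 1 / (z + of_nat n)\<^sup>2 + 1 / (1 - z + of_nat n)\<^sup>2) sums (of_real pi / sin (of_real pi * z))\<^sup>2"
proof -
  have nz: "z \<noteq> 0" "1 - z \<noteq> 0" using z by auto
  have "(\<lambda>n. inverse ((z + of_nat n)\<^sup>2) + inverse ((1 - z + of_nat n)\<^sup>2)) sums (Polygamma 1 z + Polygamma 1 (1 - z))"
    using sums_add[OF Polygamma_LIMSEQ[OF nz(1), of 1] Polygamma_LIMSEQ[OF nz(2), of 1]]
    by (simp add: numeral_2_eq_2)
  thus ?thesis unfolding Polygamma_1_reflection[OF z] by (simp add: divide_inverse)
qed

text \<open>With the open half-line as the whole space, pointwise bounds are asked for t > 0 only,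
  where the powers of t are genuine; at t = 0 \<open>powr\<close> takes the default value 0.\<close>

abbreviation pos_lborel :: "real measure" where
  "pos_lborel \<equiv> restrict_space lborel {0<..}"

lemma sigma_finite_pos_lborel: "sigma_finite_measure pos_lborel"
  by (rule sigma_finite_measure_restrict_space) (auto intro: lborel.sigma_finite_measure_axioms)

lemma measurable_pos_lborel: "f \<in> borel_measurable borel \<Longrightarrow> f \<in> borel_measurable pos_lborel"
  by (intro measurable_restrict_space1) auto

section \<open>Gamma and Beta type integrals on the half-line\<close>

lemma nn_integral_powr_exp:
  fixes a c :: real
  assumes a: "a > 0" and c: "c > 0"
  shows "(\<integral>\<^sup>+x. ennreal (x powr (a - 1) * exp (- (c * x))) \<partial>pos_lborel) = ennreal (Gamma a / c powr a)"
proof -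
  have "ennreal (Gamma a) = (\<integral>\<^sup>+t. ennreal (indicator {0..} t * t powr (a - 1) / exp t) \<partial>lborel)"
    by (rule Gamma_conv_nn_integral_real[OF a])
  also have "\<dots> = ennreal c * (\<integral>\<^sup>+t. ennreal (indicator {0..} (c*t) * (c*t) powr (a - 1) / exp (c*t)) \<partial>lborel)"
    using c by (subst nn_integral_real_affine[where c = c and t = 0]) auto
  also have "(\<integral>\<^sup>+t. ennreal (indicator {0..} (c*t) * (c*t) powr (a - 1) / exp (c*t)) \<partial>lborel) =
             (\<integral>\<^sup>+t. ennreal (c powr (a - 1)) * (ennreal (t powr (a - 1) * exp (- (c * t))) * indicator {0<..} t) \<partial>lborel)"
  proof (rule nn_integral_cong_AE)
    \<comment> \<open>Euler's integral includes t = 0, the half-line here does not; a single point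
      is null.\<close>
    have "AE t in lborel. t \<noteq> (0::real)" by (rule AE_lborel_singleton)
    thus "AE t in lborel. ennreal (indicator {0..} (c*t) * (c*t) powr (a - 1) / exp (c*t)) =
       ennreal (c powr (a - 1)) * (ennreal (t powr (a - 1) * exp (- (c * t))) * indicator {0<..} t)"
    proof eventually_elim
      case (elim t)
      thus ?case using c
        by (cases "t > 0") (auto simp: indicator_def powr_mult exp_minus field_simps zero_le_mult_iff simp flip: ennreal_mult)
    qed
  qed
  also have "\<dots> = ennreal (c powr (a - 1)) * (\<integral>\<^sup>+x. ennreal (x powr (a - 1) * exp (- (c * x))) \<partial>pos_lborel)"
    by (subst nn_integral_cmult, measurable, subst nn_integral_restrict_space) auto
  finally have eq: "ennreal (Gamma a) = ennreal (c powr a) * (\<integral>\<^sup>+x. ennreal (x powr (a - 1) * exp (- (c * x))) \<partial>pos_lborel)"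
    using c by (simp add: mult.assoc[symmetric] ennreal_mult[symmetric] powr_mult_base)
  have "ennreal (Gamma a / c powr a) = ennreal (1 / c powr a) * ennreal (Gamma a)"
    using c a by (simp flip: ennreal_mult)
  also have "\<dots> = ennreal (1 / c powr a) * ennreal (c powr a) * (\<integral>\<^sup>+x. ennreal (x powr (a - 1) * exp (- (c * x))) \<partial>pos_lborel)"
    unfolding eq by (simp add: mult.assoc)
  also have "ennreal (1 / c powr a) * ennreal (c powr a) = 1"
    using c by (subst ennreal_mult [symmetric]) auto
  finally show ?thesis by simp
qed

lemma
  fixes a c :: real
  assumes a: "a > 0" and c: "c > 0"
  shows integrable_powr_exp: "integrable pos_lborel (\<lambda>x. x powr (a - 1) * exp (- (c * x)))"
    and integral_powr_exp: "(LINT x|pos_lborel. x powr (a - 1) * exp (- (c * x))) = Gamma a / c powr a"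
proof -
  have "(\<lambda>x. x powr (a - 1) * exp (- (c * x))) \<in> borel_measurable pos_lborel"
    by (rule measurable_pos_lborel) measurable
  moreover have "Gamma a / c powr a \<ge> 0" using a by (simp add: less_imp_le)
  ultimately have "integrable pos_lborel (\<lambda>x. x powr (a - 1) * exp (- (c * x))) \<and>
      (LINT x|pos_lborel. x powr (a - 1) * exp (- (c * x))) = Gamma a / c powr a"
    using nn_integral_powr_exp[OF a c] by (subst (asm) nn_integral_eq_integrable) auto
  thus "integrable pos_lborel (\<lambda>x. x powr (a - 1) * exp (- (c * x)))"
    "(LINT x|pos_lborel. x powr (a - 1) * exp (- (c * x))) = Gamma a / c powr a" by auto
qed

text \<open>Writing 1/(t+W)^2 as the integral of x exp(-(t+W) x) and exchanging the order by Tonelli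
  leaves two Gamma integrals. The limits on s are convergence at 0 and at infinity; finiteness of
  the nonnegative integral yields integrability as well.\<close>

lemma nn_integral_powr_div_square:
  fixes s W :: real
  assumes s: "-1 < s" "s < 1" and W: "W > 0"
  shows "(\<integral>\<^sup>+t. ennreal (t powr s / (t + W)\<^sup>2) \<partial>pos_lborel) = ennreal (Gamma (1 + s) * Gamma (1 - s) * W powr (s - 1))"
proof -
  interpret P: pair_sigma_finite pos_lborel pos_lborel
    unfolding pair_sigma_finite_def using sigma_finite_pos_lborel by simp
  have [measurable]: "(\<lambda>x. x) \<in> borel_measurable pos_lborel"
    by (rule measurable_pos_lborel) measurable
  have "(\<integral>\<^sup>+t. ennreal (t powr s / (t + W)\<^sup>2) \<partial>pos_lborel) =
        (\<integral>\<^sup>+t. (\<integral>\<^sup>+x. ennreal (t powr s * (x * exp (- ((t + W) * x)))) \<partial>pos_lborel) \<partial>pos_lborel)"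
  proof (rule nn_integral_cong)
    fix t :: real assume "t \<in> space pos_lborel"
    hence t: "t > 0" by (simp add: space_restrict_space)
    have "(\<integral>\<^sup>+x. ennreal (x powr (2 - 1) * exp (- ((t + W) * x))) \<partial>pos_lborel) = ennreal (Gamma 2 / (t + W) powr 2)"
      using t W by (intro nn_integral_powr_exp) auto
    hence G: "(\<integral>\<^sup>+x. ennreal (x * exp (- ((t + W) * x))) \<partial>pos_lborel) = ennreal (1 / (t + W)\<^sup>2)"
      using t W by (subst (asm) nn_integral_cong[where v = "\<lambda>x. ennreal (x * exp (- ((t + W) * x)))"])
        (auto simp: space_restrict_space Gamma_numeral powr_numeral)
    have "(\<integral>\<^sup>+x. ennreal (t powr s * (x * exp (- ((t + W) * x)))) \<partial>pos_lborel) =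
          (\<integral>\<^sup>+x. ennreal (t powr s) * ennreal (x * exp (- ((t + W) * x))) \<partial>pos_lborel)"
      by (intro nn_integral_cong) (auto simp: space_restrict_space ennreal_mult)
    also have "\<dots> = ennreal (t powr s) * ennreal (1 / (t + W)\<^sup>2)"
      by (subst nn_integral_cmult) (auto simp: G)
    finally show "ennreal (t powr s / (t + W)\<^sup>2) = (\<integral>\<^sup>+x. ennreal (t powr s * (x * exp (- ((t + W) * x)))) \<partial>pos_lborel)"
      by (simp flip: ennreal_mult)
  qed
  also have "\<dots> = (\<integral>\<^sup>+x. (\<integral>\<^sup>+t. ennreal (t powr s * (x * exp (- ((t + W) * x)))) \<partial>pos_lborel) \<partial>pos_lborel)"
    by (rule P.Fubini') measurable
  also have "\<dots> = (\<integral>\<^sup>+x. ennreal (Gamma (1 + s)) * ennreal (x powr ((1 - s) - 1) * exp (- (W * x))) \<partial>pos_lborel)"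
  proof (rule nn_integral_cong)
    fix x :: real assume "x \<in> space pos_lborel"
    hence x: "x > 0" by (simp add: space_restrict_space)
    have "(\<integral>\<^sup>+t. ennreal (t powr s * (x * exp (- ((t + W) * x)))) \<partial>pos_lborel) =
          (\<integral>\<^sup>+t. ennreal (x * exp (- (W * x))) * ennreal (t powr ((1 + s) - 1) * exp (- (x * t))) \<partial>pos_lborel)"
      using x by (intro nn_integral_cong) (auto simp: ennreal_mult[symmetric] algebra_simps exp_add exp_diff exp_minus divide_inverse)
    also have "\<dots> = ennreal (x * exp (- (W * x))) * ennreal (Gamma (1 + s) / x powr (1 + s))"
      using nn_integral_powr_exp[of "1 + s" x] s x
      by (subst nn_integral_cmult) auto
    also have "\<dots> = ennreal (Gamma (1 + s)) * ennreal (x powr ((1 - s) - 1) * exp (- (W * x)))"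
      using x s by (auto simp: ennreal_mult[symmetric] powr_add powr_minus field_simps)
    finally show "(\<integral>\<^sup>+t. ennreal (t powr s * (x * exp (- ((t + W) * x)))) \<partial>pos_lborel) = \<dots>" .
  qed
  also have "\<dots> = ennreal (Gamma (1 + s)) * ennreal (Gamma (1 - s) / W powr (1 - s))"
    using s W nn_integral_powr_exp[of "1 - s" W] by (subst nn_integral_cmult) auto
  also have "\<dots> = ennreal (Gamma (1 + s) * Gamma (1 - s) * W powr (s - 1))"
    using s W by (simp add: powr_diff divide_simps flip: ennreal_mult)
  finally show ?thesis .
qed

lemma
  fixes s W :: real
  assumes s: "-1 < s" "s < 1" and W: "W > 0"
  shows integrable_powr_div_square: "integrable pos_lborel (\<lambda>t. t powr s / (t + W)\<^sup>2)"
    and integral_powr_div_square_real: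
      "(LINT t|pos_lborel. t powr s / (t + W)\<^sup>2) = Gamma (1 + s) * Gamma (1 - s) * W powr (s - 1)"
proof -
  have "(\<lambda>t. t powr s / (t + W)\<^sup>2) \<in> borel_measurable pos_lborel"
    by (rule measurable_pos_lborel) measurable
  moreover have "Gamma (1 + s) * Gamma (1 - s) * W powr (s - 1) \<ge> 0" using s by (simp add: less_imp_le)
  ultimately have "integrable pos_lborel (\<lambda>t. t powr s / (t + W)\<^sup>2) \<and>
      (LINT t|pos_lborel. t powr s / (t + W)\<^sup>2) = Gamma (1 + s) * Gamma (1 - s) * W powr (s - 1)"
    using nn_integral_powr_div_square[OF s W] by (subst (asm) nn_integral_eq_integrable) auto
  thus "integrable pos_lborel (\<lambda>t. t powr s / (t + W)\<^sup>2)"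
    "(LINT t|pos_lborel. t powr s / (t + W)\<^sup>2) = Gamma (1 + s) * Gamma (1 - s) * W powr (s - 1)" by auto
qed

text \<open>Every -t keeps distance 2 r from W0, hence |t + W| >= r for W within r of W0; the
  triangle inequality handles large t. This bounds 1/|t+W|^2 by a constant times 1/(t+1)^2,
  uniformly for W near W0.\<close>

lemma norm_add_real_ge:
  fixes W W0 :: complex
  assumes r: "r > 0" and W0: "ball W0 (2 * r) \<inter> \<real>\<^sub>\<le>\<^sub>0 = {}" and W: "W \<in> ball W0 r" and t: "t \<ge> 0"
  shows "t + 1 \<le> (1 + (norm W0 + r + 1) / r) * norm (of_real t + W)"
proof -
  have "- of_real t \<notin> ball W0 (2 * r)" using W0 t by auto
  hence "2 * r \<le> norm (W0 + of_real t)" by (auto simp: dist_norm)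
  also have "\<dots> = norm ((W0 - W) + (of_real t + W))" by simp
  also have "\<dots> \<le> norm (W0 - W) + norm (of_real t + W)" by (rule norm_triangle_ineq)
  also have "norm (W0 - W) < r" using W by (auto simp: dist_norm)
  finally have ge: "r \<le> norm (of_real t + W)" by simp
  have "t = norm ((of_real t + W) - (W - W0) - W0)" using t by simp
  also have "\<dots> \<le> norm (of_real t + W) + norm (W - W0) + norm W0"
    by (meson add_mono norm_triangle_ineq4 order_refl order_trans)
  also have "norm (W - W0) < r" using W by (auto simp: dist_norm norm_minus_commute)
  finally have "t + 1 \<le> norm (of_real t + W) + (norm W0 + r + 1) / r * r" using r by simp
  also have "\<dots> \<le> norm (of_real t + W) + (norm W0 + r + 1) / r * norm (of_real t + W)"
    using ge r by (intro add_left_mono mult_left_mono) auto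
  finally show ?thesis by (simp add: algebra_simps)
qed

lemma islimpt_complex_of_real: "x islimpt A \<Longrightarrow> complex_of_real x islimpt complex_of_real ` A"
  by (rule islimpt_isCont_image) (auto simp: eventually_at_filter intro: isCont_of_real)

text \<open>Identity theorem starting from positive real W. Each of the half-planes given by 1 + i
  and 1 - i contains the positive axis and one half of the imaginary axis and misses the branch cut
  of the principal power; together they reach every iy with y nonzero.\<close>

lemma integral_powr_div_square_halfplane:
  fixes s :: real and e W :: complex
  assumes s: "-1 < s" "s < 1" and e: "e = 1 + \<i> \<or> e = 1 - \<i>" and W: "inner e W > 0"
  shows "(LINT t|pos_lborel. of_real (t powr s) / (of_real t + W)\<^sup>2) =
           of_real (Gamma (1 + s) * Gamma (1 - s)) * W powr of_real (s - 1)"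
proof -
  define S where "S = {W. inner e W > 0}"
  have S: "open S" "convex S" unfolding S_def by (auto simp: open_halfspace_gt convex_halfspace_gt)
  have disj: "S \<inter> \<real>\<^sub>\<le>\<^sub>0 = {}"
    using e by (auto simp: S_def complex_nonpos_Reals_iff inner_complex_def)
  define F where "F = (\<lambda>W. (LINT t|pos_lborel. of_real (t powr s) / (of_real t + W)\<^sup>2) -
           of_real (Gamma (1 + s) * Gamma (1 - s)) * W powr of_real (s - 1) :: complex)"
  have nz: "of_real t + w \<noteq> 0" if "w \<in> S" "t > 0" for t w
  proof
    assume "of_real t + w = 0"
    hence "w = of_real (- t)" by (simp add: add_eq_0_iff)
    hence "w \<in> \<real>\<^sub>\<le>\<^sub>0" using that(2) by (simp add: complex_nonpos_Reals_iff)
    thus False using disj that by auto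
  qed
  have "(\<lambda>W. (LINT t|pos_lborel. complex_of_real (t powr s) / (of_real t + W)\<^sup>2)) holomorphic_on S"
  proof (rule holomorphic_on_lebesgue_integral[OF S(1)])
    fix z assume z: "z \<in> S"
    then obtain r0 where r0: "r0 > 0" "ball z r0 \<subseteq> S" using S open_contains_ball by blast
    define r where "r = r0 / 2"
    have r: "r > 0" "ball z (2 * r) \<subseteq> S" "ball z r \<subseteq> S"
      using r0 by (auto simp: r_def subset_iff)
    define C where "C = 1 + (norm z + r + 1) / r"
    show "\<exists>r>0. \<exists>h. ball z r \<subseteq> S \<and> integrable pos_lborel h \<and>
              (\<forall>w\<in>ball z r. \<forall>t\<in>space pos_lborel. norm (of_real (t powr s) / (of_real t + w)\<^sup>2) \<le> h t)"
    proof (intro exI conjI ballI)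
      show "integrable pos_lborel (\<lambda>t. C\<^sup>2 * (t powr s / (t + 1)\<^sup>2))"
        using integrable_powr_div_square[OF s, of 1] by (intro integrable_mult_right) simp
      fix w t assume w: "w \<in> ball z r" and "t \<in> space pos_lborel"
      hence t: "t > 0" by (simp add: space_restrict_space)
      have "t + 1 \<le> C * norm (of_real t + w)"
        unfolding C_def using disj r w t by (intro norm_add_real_ge) auto
      hence "(t + 1)\<^sup>2 \<le> C\<^sup>2 * (norm (of_real t + w))\<^sup>2"
        using t by (metis add_nonneg_nonneg less_imp_le power_mono power_mult_distrib zero_le_one)
      moreover have "norm (of_real t + w) > 0" using nz[of w t] w r t by auto
      ultimately have "1 / (norm (of_real t + w))\<^sup>2 \<le> C\<^sup>2 / (t + 1)\<^sup>2"
        using t by (simp add: divide_simps mult.commute)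
      hence "t powr s * (1 / (norm (of_real t + w))\<^sup>2) \<le> t powr s * (C\<^sup>2 / (t + 1)\<^sup>2)"
        by (intro mult_left_mono) auto
      thus "norm (of_real (t powr s) / (of_real t + w)\<^sup>2) \<le> C\<^sup>2 * (t powr s / (t + 1)\<^sup>2)"
        by (simp add: norm_divide norm_power mult_ac)
    qed (use r in auto)
  next
    fix z show "(\<lambda>t. complex_of_real (t powr s) / (complex_of_real t + z)\<^sup>2) \<in> borel_measurable pos_lborel"
      by (rule measurable_pos_lborel) measurable
  next
    fix t assume "t \<in> space pos_lborel"
    hence t: "t > 0" by (simp add: space_restrict_space)
    show "(\<lambda>w. complex_of_real (t powr s) / (complex_of_real t + w)\<^sup>2) holomorphic_on S"
      using nz t by (intro holomorphic_intros) auto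
  qed
  hence hol: "F holomorphic_on S"
    unfolding F_def using disj by (intro holomorphic_intros) auto
  have "F W = 0"
  proof (rule analytic_continuation[OF hol S(1) _ _ _ _ _, where U = "complex_of_real ` {0<..}" and \<xi> = 1])
    show "connected S" using S convex_connected by blast
    show "complex_of_real ` {0<..} \<subseteq> S" "1 \<in> S" using e by (auto simp: S_def inner_complex_def)
    have "(1::real) islimpt {0<..}" by (intro open_imp_islimpt) auto
    hence "complex_of_real 1 islimpt complex_of_real ` {0<..}"
      by (rule islimpt_complex_of_real)
    thus "1 islimpt complex_of_real ` {0<..}" by simp
    show "W \<in> S" using W by (simp add: S_def)
  next
    fix w assume "w \<in> complex_of_real ` {0<..}"
    then obtain x where x: "w = of_real x" "x > 0" by auto
    have "(LINT t|pos_lborel. complex_of_real (t powr s) / (of_real t + w)\<^sup>2) =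
          (LINT t|pos_lborel. complex_of_real (t powr s / (t + x)\<^sup>2))"
      using x by simp
    also have "\<dots> = of_real (Gamma (1 + s) * Gamma (1 - s) * x powr (s - 1))"
      using integral_powr_div_square_real[OF s x(2)] by (subst integral_complex_of_real) simp
    finally show "F w = 0" using x powr_of_real[of x "s - 1"] by (simp add: F_def)
  qed
  thus ?thesis by (simp add: F_def)
qed

lemma integral_powr_div_square:
  fixes s y :: real
  assumes s: "-1 < s" "s < 1" and y: "y \<noteq> 0"
  shows "(LINT t|pos_lborel. of_real (t powr s) / (of_real t + \<i> * of_real y)\<^sup>2) =
           of_real (Gamma (1 + s) * Gamma (1 - s)) * (\<i> * of_real y) powr of_real (s - 1)"
proof (cases "y > 0")
  case True
  show ?thesis
    by (rule integral_powr_div_square_halfplane[OF s, of "1 + \<i>"]) (use True in \<open>auto simp: inner_complex_def\<close>)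
next
  case False
  show ?thesis
    by (rule integral_powr_div_square_halfplane[OF s, of "1 - \<i>"]) (use False y in \<open>auto simp: inner_complex_def\<close>)
qed

section \<open>The Mellin transform continuing the polylogarithm\<close>

text \<open>The kernel is the sum of \<open>n * z ^ n * exp (- n * t)\<close>; the extra factor \<open>n\<close> makes both the Mellin transform
  for \<open>Re s > -1\<close> and the partial fraction series absolutely convergent.\<close>

definition polylog_kernel :: "complex \<Rightarrow> real \<Rightarrow> complex" where
  "polylog_kernel z t = z * of_real (exp (- t)) / (1 - z * of_real (exp (- t)))\<^sup>2"

definition polylog_mellin :: "complex \<Rightarrow> complex \<Rightarrow> complex" where
  "polylog_mellin z s = (LINT t|pos_lborel. of_real t powr s * polylog_kernel z t)"

lemma polylog_kernel_measurable: "polylog_kernel z \<in> borel_measurable borel"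
  unfolding polylog_kernel_def [abs_def] by measurable

text \<open>Uses \<open>norm (1 - z) \<le> 2 * norm (1 - q * z)\<close> for \<open>0 < q \<le> 1\<close>, as \<open>1 - q \<le> norm (1 - q * z)\<close>.\<close>

lemma norm_polylog_kernel_le:
  assumes z: "norm z = 1" "z \<noteq> 1" and t: "t \<ge> 0"
  shows "norm (polylog_kernel z t) \<le> 4 / (norm (1 - z))\<^sup>2 * exp (- t)"
proof -
  define q where "q = exp (- t)"
  have q: "0 < q" "q \<le> 1" using t by (auto simp: q_def)
  have 1: "1 - q \<le> norm (1 - z * of_real q)"
  proof -
    have "1 - norm (z * of_real q) \<le> norm (1 - z * of_real q)"
      using norm_triangle_ineq2[of 1 "z * of_real q"] by simp
    thus ?thesis using q z by (simp add: norm_mult)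
  qed
  have "norm (1 - z) = norm ((1 - z * of_real q) - z * of_real (1 - q))" by (simp add: algebra_simps)
  also have "\<dots> \<le> norm (1 - z * of_real q) + norm (z * of_real (1 - q))" by (rule norm_triangle_ineq4)
  also have "norm (z * complex_of_real (1 - q)) = 1 - q" using q z by (simp only: norm_mult norm_of_real) simp
  also note 1
  finally have "norm (1 - z) \<le> 2 * norm (1 - z * of_real q)" by simp
  hence "(norm (1 - z))\<^sup>2 \<le> 4 * (norm (1 - z * of_real q))\<^sup>2"
    using power_mono[of "norm (1 - z)" "2 * norm (1 - z * of_real q)" 2] by (simp add: power_mult_distrib)
  moreover from this have "norm (1 - z * of_real q) > 0" using z by (cases "1 - z * of_real q = 0") auto
  moreover have "norm (1 - z) > 0" using z by auto
  ultimately have "1 / (norm (1 - z * of_real q))\<^sup>2 \<le> 4 / (norm (1 - z))\<^sup>2"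
    by (simp add: divide_simps mult.commute)
  hence "q * (1 / (norm (1 - z * of_real q))\<^sup>2) \<le> q * (4 / (norm (1 - z))\<^sup>2)"
    using q by (intro mult_left_mono) auto
  thus ?thesis unfolding polylog_kernel_def q_def[symmetric] using q z
    by (simp add: norm_mult norm_divide norm_power mult_ac)
qed

text \<open>The power decreases in the exponent for x <= 1 and increases for x >= 1, so the two end
  exponents together dominate the range between them. This supplies majorants uniform over a disc of
  exponents.\<close>

lemma powr_le_add_powr:
  fixes x :: real
  assumes x: "x > 0" and p: "a \<le> p" "p \<le> b"
  shows "x powr p \<le> x powr a + x powr b"
proof (cases "x \<le> 1")
  case True
  thus ?thesis using powr_mono'[of a p x] x p by (simp add: add_increasing2)
next
  case False
  thus ?thesis using powr_mono[of p b x] x p by (simp add: add_increasing)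
qed

lemma holomorphic_polylog_mellin:
  assumes z: "norm z = 1" "z \<noteq> 1"
  shows "polylog_mellin z holomorphic_on {s. Re s > -1}"
  unfolding polylog_mellin_def
proof (rule holomorphic_on_lebesgue_integral)
  fix s0 :: complex assume s0: "s0 \<in> {s. Re s > -1}"
  \<comment> \<open>Half the distance to the boundary line: the least exponent \<open>a\<close> in
    the disc still exceeds -1, so the majorant is integrable at 0.\<close>
  define r where "r = (Re s0 + 1) / 2"
  define a b where "a = Re s0 - r" and "b = Re s0 + r"
  have r: "r > 0" "a > -1" "b > -1" using s0 by (auto simp: r_def a_def b_def field_simps)
  define C where "C = 4 / (norm (1 - z))\<^sup>2"
  show "\<exists>r>0. \<exists>h. ball s0 r \<subseteq> {s. Re s > -1} \<and> integrable pos_lborel h \<and>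
          (\<forall>w\<in>ball s0 r. \<forall>t\<in>space pos_lborel. norm (of_real t powr w * polylog_kernel z t) \<le> h t)"
  proof (intro exI conjI ballI subsetI)
    show "r > 0" by fact
    show "integrable pos_lborel (\<lambda>t. C * (t powr a * exp (- t) + t powr b * exp (- t)))"
      using integrable_powr_exp[of "a + 1" 1] integrable_powr_exp[of "b + 1" 1] r
      by (intro integrable_mult_right Bochner_Integration.integrable_add) auto
    fix w assume w: "w \<in> ball s0 r"
    have "\<bar>Re (s0 - w)\<bar> < r" using w abs_Re_le_cmod[of "s0 - w"] by (auto simp: dist_norm)
    hence Re: "a \<le> Re w" "Re w \<le> b" by (auto simp: a_def b_def)
    thus "w \<in> {s. Re s > -1}" using r by simp
    fix t assume "t \<in> space pos_lborel"
    hence t: "t > 0" by (simp add: space_restrict_space)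
    have "t powr Re w \<le> t powr a + t powr b"
      using t Re by (rule powr_le_add_powr)
    moreover have "norm (complex_of_real t powr w) = t powr Re w" using t by (simp add: norm_powr_real_powr)
    moreover have "norm (polylog_kernel z t) \<le> C * exp (- t)"
      unfolding C_def using norm_polylog_kernel_le[OF z] t by simp
    ultimately have "norm (of_real t powr w) * norm (polylog_kernel z t) \<le> (t powr a + t powr b) * (C * exp (- t))"
      by (intro mult_mono) auto
    thus "norm (of_real t powr w * polylog_kernel z t) \<le> C * (t powr a * exp (- t) + t powr b * exp (- t))"
      by (simp add: norm_mult algebra_simps)
  qed
next
  show "open {s. Re s > -1}" by (rule open_halfspace_Re_gt)
next
  fix s show "(\<lambda>t. complex_of_real t powr s * polylog_kernel z t) \<in> borel_measurable pos_lborel"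
    using polylog_kernel_measurable[of z] by (intro measurable_pos_lborel borel_measurable_times) (auto simp: powr_def)
next
  fix t assume "t \<in> space pos_lborel"
  thus "(\<lambda>s. complex_of_real t powr s * polylog_kernel z t) holomorphic_on {s. - 1 < Re s}"
    by (intro holomorphic_intros) (auto simp: space_restrict_space)
qed

lemma summable_shifted_powr:
  fixes v \<sigma> :: real
  assumes v: "v > 0" and \<sigma>: "\<sigma> > 1"
  shows "summable (\<lambda>n. (real n + v) powr (- \<sigma>))"
proof -
  have "summable (\<lambda>n. real n powr (- \<sigma>))" using \<sigma> by (simp add: summable_real_powr_iff)
  \<comment> \<open>At n = 0 a comparison would fail, because \<open>0 powr p\<close> is 0; it is
    made after a shift by one.\<close>
  hence "summable (\<lambda>n. real (Suc n) powr (- \<sigma>))" by (subst summable_Suc_iff)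
  hence "summable (\<lambda>n. (real (Suc n) + v) powr (- \<sigma>))"
    by (rule summable_comparison_test') (use v \<sigma> in \<open>auto intro!: powr_mono2'\<close>)
  thus ?thesis by (subst (asm) summable_Suc_iff)
qed

text \<open>Termwise integration of the power series of the kernel; the term of index n gives n
  Gamma(s+1) / n^(s+1). On the unit circle the absolute integrals sum to Gamma(s+1) zeta(s), hence s
  > 1.\<close>

lemma polylog_mellin_sums:
  fixes s :: real
  assumes z: "norm z = 1" "z \<noteq> 1" and s: "s > 1"
  shows "(\<lambda>n. of_real (Gamma (s + 1)) * (z ^ Suc n * of_real (real (Suc n) powr (- s)))) sums polylog_mellin z (of_real s)"
proof -
  define f where "f = (\<lambda>n t. of_nat (Suc n) * z ^ Suc n * complex_of_real (t powr s * exp (- (real (Suc n) * t))))"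
  have sum: "(\<lambda>n. f n t) sums (of_real t powr of_real s * polylog_kernel z t)" if t: "t > 0" for t
  proof -
    define q where "q = z * of_real (exp (- t))"
    have q: "norm q < 1" using z t by (simp add: q_def norm_mult)
    have "(\<lambda>n. of_real (t powr s) * q * (of_nat (Suc n) * q ^ n)) sums (of_real (t powr s) * q * (1 / (1 - q)\<^sup>2))"
      by (intro sums_mult geometric_deriv_sums q)
    also have "(\<lambda>n. of_real (t powr s) * q * (of_nat (Suc n) * q ^ n)) = (\<lambda>n. f n t)"
    proof
      fix n
      have "exp (- (real (Suc n) * t)) = exp (- t) ^ Suc n"
        by (subst exp_of_nat_mult [symmetric]) simp
      hence e: "complex_of_real (exp (- (real (Suc n) * t))) = of_real (exp (- t)) ^ Suc n" by simp
      show "of_real (t powr s) * q * (of_nat (Suc n) * q ^ n) = f n t"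
        unfolding f_def of_real_mult e q_def by (simp add: power_mult_distrib mult_ac)
    qed
    also have "of_real (t powr s) * q * (1 / (1 - q)\<^sup>2) = of_real t powr of_real s * polylog_kernel z t"
      using t by (simp add: polylog_kernel_def q_def powr_of_real)
    finally show ?thesis .
  qed
  have int: "integrable pos_lborel (\<lambda>t. t powr s * exp (- (real (Suc n) * t)))" for n
    using integrable_powr_exp[of "s + 1" "real (Suc n)"] s by simp
  have intv: "(LINT t|pos_lborel. t powr s * exp (- (real (Suc n) * t))) = Gamma (s + 1) / real (Suc n) powr (s + 1)" for n
    using integral_powr_exp[of "s + 1" "real (Suc n)"] s by simp
  have "(\<lambda>n. LINT t|pos_lborel. f n t) sums (LINT t|pos_lborel. (\<Sum>n. f n t))"
  proof (rule sums_integral)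
    show "integrable pos_lborel (f n)" for n
      unfolding f_def using int[of n] by (intro integrable_mult_right integrable_of_real)
    show "AE t in pos_lborel. summable (\<lambda>n. norm (f n t))"
    proof (rule AE_I2)
      fix t assume "t \<in> space pos_lborel"
      hence t: "t > 0" by (simp add: space_restrict_space)
      define q where "q = exp (- t)"
      have "summable (\<lambda>n. t powr s * q * (of_nat (Suc n) * q ^ n))"
        using geometric_deriv_sums[of q] t by (intro summable_mult) (auto simp: sums_iff q_def)
      also have "(\<lambda>n. t powr s * q * (of_nat (Suc n) * q ^ n)) = (\<lambda>n. norm (f n t))"
      proof
        fix n
        have e: "exp (- (real (Suc n) * t)) = exp (- t) ^ Suc n"
          by (subst exp_of_nat_mult [symmetric]) simp
        show "t powr s * q * (of_nat (Suc n) * q ^ n) = norm (f n t)"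
          unfolding f_def e q_def norm_mult norm_power norm_of_real z by (simp del: of_nat_Suc)
      qed
      finally show "summable (\<lambda>n. norm (f n t))" .
    qed
    have "(\<lambda>n. LINT t|pos_lborel. norm (f n t)) = (\<lambda>n. Gamma (s + 1) * real (Suc n) powr (- s))"
    proof
      fix n
      have "(LINT t|pos_lborel. norm (f n t)) = (LINT t|pos_lborel. real (Suc n) * (t powr s * exp (- (real (Suc n) * t))))"
        by (simp add: f_def norm_mult norm_power z del: of_nat_Suc)
      also have "\<dots> = real (Suc n) * (Gamma (s + 1) / real (Suc n) powr (s + 1))"
        by (subst integral_mult_right_zero) (simp only: intv)
      also have "\<dots> = Gamma (s + 1) * real (Suc n) powr (- s)"
        by (simp add: powr_add powr_minus divide_simps del: of_nat_Suc)
      finally show "(LINT t|pos_lborel. norm (f n t)) = Gamma (s + 1) * real (Suc n) powr (- s)" .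
    qed
    thus "summable (\<lambda>n. LINT t|pos_lborel. norm (f n t))"
      using summable_shifted_powr[of 1 s] s by (simp add: summable_mult add.commute)
  qed
  also have "(\<lambda>n. LINT t|pos_lborel. f n t) = (\<lambda>n. of_real (Gamma (s + 1)) * (z ^ Suc n * of_real (real (Suc n) powr (- s))))"
  proof
    fix n
    have "(LINT t|pos_lborel. f n t) = of_nat (Suc n) * z ^ Suc n * of_real (Gamma (s + 1) / real (Suc n) powr (s + 1))"
      unfolding f_def by (subst integral_mult_right_zero, subst integral_complex_of_real) (simp only: intv)
    also have "of_real (Gamma (s + 1) / real (Suc n) powr (s + 1)) =
               complex_of_real (Gamma (s + 1)) * of_real (real (Suc n) powr (- s)) / of_nat (Suc n)"
      by (simp add: powr_add powr_minus divide_simps del: of_nat_Suc)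
    finally show "(LINT t|pos_lborel. f n t) = of_real (Gamma (s + 1)) * (z ^ Suc n * of_real (real (Suc n) powr (- s)))"
      by (simp add: mult_ac del: of_nat_Suc)
  qed
  also have "(LINT t|pos_lborel. (\<Sum>n. f n t)) = polylog_mellin z (of_real s)"
    unfolding polylog_mellin_def using sum
    by (intro Bochner_Integration.integral_cong) (auto simp: space_restrict_space sums_iff)
  finally show ?thesis .
qed

text \<open>With x = a + i t/(2 pi) and E = exp(i pi x), the product z exp(-t) is E^2, so the kernel
  equals 1/(E - 1/E)^2 = -1/(4 sin^2(pi x)). The partial fractions of 1/sin^2 become poles in t at 2
  pi i (n + a) and -2 pi i (n + 1 - a).\<close>

lemma polylog_kernel_sums:
  fixes a t :: real
  assumes t: "t > 0"
  shows "(\<lambda>n. 1 / (of_real t + \<i> * of_real (- (2 * pi * (real n + a))))\<^sup>2 +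
              1 / (of_real t + \<i> * of_real (2 * pi * (real n + (1 - a))))\<^sup>2)
           sums polylog_kernel (exp (2 * of_real pi * \<i> * of_real a)) t"
proof -
  define x where "x = of_real a + \<i> * of_real t / (2 * of_real pi)"
  have "Im x \<noteq> 0" using t by (simp add: x_def)
  hence x: "x \<notin> \<int>" by (auto elim!: Ints_cases)
  have nz: "x + of_nat n \<noteq> 0" "1 - x + of_nat n \<noteq> 0" for n
    using \<open>Im x \<noteq> 0\<close> by (auto simp: complex_eq_iff)
  have "(\<lambda>n. - 1 / (2 * of_real pi)\<^sup>2 * (1 / (x + of_nat n)\<^sup>2 + 1 / (1 - x + of_nat n)\<^sup>2))
          sums (- 1 / (2 * of_real pi)\<^sup>2 * (of_real pi / sin (of_real pi * x))\<^sup>2)"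
    by (intro sums_mult sums_inverse_sin_squared x)
  also have "(\<lambda>n. - 1 / (2 * of_real pi)\<^sup>2 * (1 / (x + of_nat n)\<^sup>2 + 1 / (1 - x + of_nat n)\<^sup>2)) =
     (\<lambda>n. 1 / (of_real t + \<i> * of_real (- (2 * pi * (real n + a))))\<^sup>2 +
              1 / (of_real t + \<i> * of_real (2 * pi * (real n + (1 - a))))\<^sup>2)"
  proof
    fix n
    have e1: "of_real t + \<i> * of_real (- (2 * pi * (real n + a))) = - \<i> * (2 * of_real pi) * (x + of_nat n)"
      by (simp add: x_def field_simps)
    have e2: "of_real t + \<i> * of_real (2 * pi * (real n + (1 - a))) = \<i> * (2 * of_real pi) * (1 - x + of_nat n)"
      by (simp add: x_def field_simps)
    show "- 1 / (2 * of_real pi)\<^sup>2 * (1 / (x + of_nat n)\<^sup>2 + 1 / (1 - x + of_nat n)\<^sup>2) =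
       1 / (of_real t + \<i> * of_real (- (2 * pi * (real n + a))))\<^sup>2 +
              1 / (of_real t + \<i> * of_real (2 * pi * (real n + (1 - a))))\<^sup>2"
      unfolding e1 e2 power_mult_distrib by (simp add: divide_simps nz) 
  qed
  also have "- 1 / (2 * of_real pi)\<^sup>2 * (of_real pi / sin (of_real pi * x))\<^sup>2 =
             polylog_kernel (exp (2 * of_real pi * \<i> * of_real a)) t"
  proof -
    define E where "E = exp (\<i> * (of_real pi * x))"
    have E: "E \<noteq> 0" by (simp add: E_def)
    have "exp (2 * of_real pi * \<i> * of_real a) * of_real (exp (- t)) = exp (2 * of_real pi * \<i> * of_real a + of_real (- t))"
      by (simp only: exp_add exp_of_real)
    also have "2 * of_real pi * \<i> * of_real a + of_real (- t) = 2 * (\<i> * (of_real pi * x))"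
      by (simp add: x_def field_simps)
    also have "exp \<dots> = E\<^sup>2" by (simp add: E_def exp_double)
    finally have z: "exp (2 * of_real pi * \<i> * of_real a) * of_real (exp (- t)) = E\<^sup>2" .
    have s: "sin (of_real pi * x) = (E - 1 / E) / (2 * \<i>)"
      unfolding E_def sin_exp_eq exp_minus inverse_eq_divide ..
    have "sin (of_real pi * x) \<noteq> 0"
      using x by (rule sin_pi_times_nonzero)
    moreover have EE: "E - 1 / E = (E\<^sup>2 - 1) / E" using E by (simp add: power2_eq_square diff_divide_distrib)
    ultimately have nz: "E\<^sup>2 - 1 \<noteq> 0" unfolding s by auto
    have "- 1 / (2 * of_real pi)\<^sup>2 * (of_real pi / sin (of_real pi * x))\<^sup>2 = - 1 / (4 * (sin (of_real pi * x))\<^sup>2)"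
      by (simp add: power_mult_distrib power_divide)
    also have "\<dots> = 1 / (E - 1 / E)\<^sup>2" unfolding s by (simp add: power_mult_distrib power_divide)
    also have "\<dots> = E\<^sup>2 / (1 - E\<^sup>2)\<^sup>2"
      unfolding EE power_divide by (simp add: power2_commute)
    finally show ?thesis unfolding polylog_kernel_def z .
  qed
  finally show ?thesis .
qed

text \<open>The principal logarithm of iy is ln y + i pi/2, that of -iy is ln y - i pi/2. These two
  phases are the source of the trigonometric factors in the functional equation.\<close>

lemma ii_times_powr:
  fixes y p :: real
  assumes y: "y > 0"
  shows "(\<i> * of_real y) powr of_real p = of_real (y powr p) * exp (\<i> * of_real (pi / 2 * p))"
    and "(\<i> * of_real (- y)) powr of_real p = of_real (y powr p) * exp (- (\<i> * of_real (pi / 2 * p)))"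
proof -
  have e: "of_real (y powr p) = exp (of_real p * complex_of_real (ln y))"
    using y by (simp add: powr_def flip: exp_of_real)
  have "\<i> * of_real y = of_real y * (\<i>)" by simp
  hence L: "Ln (\<i> * of_real y) = of_real (ln y) + \<i> * of_real (pi / 2)"
    using y by (simp only:, subst Ln_times_of_real) (auto simp: Ln_of_real)
  have "(\<i> * of_real y) powr of_real p = exp (of_real p * Ln (\<i> * of_real y))"
    using y by (simp add: powr_def)
  also have "of_real p * Ln (\<i> * of_real y) = of_real p * complex_of_real (ln y) + (\<i> * of_real (pi / 2 * p))"
    unfolding L by (simp add: algebra_simps)
  finally show "(\<i> * of_real y) powr of_real p = of_real (y powr p) * exp ((\<i> * of_real (pi / 2 * p)))"
    unfolding e exp_add .
  have "\<i> * of_real (- y) = of_real y * (- \<i>)" by simp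
  hence L: "Ln (\<i> * of_real (- y)) = of_real (ln y) - \<i> * of_real (pi / 2)"
    using y by (simp only:, subst Ln_times_of_real) (auto simp: Ln_of_real)
  have "(\<i> * of_real (- y)) powr of_real p = exp (of_real p * Ln (\<i> * of_real (- y)))"
    using y by (simp add: powr_def)
  also have "of_real p * Ln (\<i> * of_real (- y)) = of_real p * complex_of_real (ln y) + - (\<i> * of_real (pi / 2 * p))"
    unfolding L by (simp add: algebra_simps)
  finally show "(\<i> * of_real (- y)) powr of_real p = of_real (y powr p) * exp (- (\<i> * of_real (pi / 2 * p)))"
    unfolding e exp_add .
qed

text \<open>Two bounds for two purposes: the first integrates against t powr s in closed form, the
  second is independent of t and gives summability over n at fixed t.\<close>

lemma norm_inverse_square_le:
  fixes t y :: real
  assumes t: "t > 0" and y: "y \<noteq> 0"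
  shows "norm (1 / (of_real t + \<i> * of_real y)\<^sup>2) \<le> 2 / (t + \<bar>y\<bar>)\<^sup>2"
    and "norm (1 / (of_real t + \<i> * of_real y)\<^sup>2) \<le> 1 / y\<^sup>2"
proof -
  have n: "norm ((of_real t + \<i> * of_real y)\<^sup>2) = t\<^sup>2 + y\<^sup>2"
    by (simp add: norm_power cmod_power2)
  have pos: "t\<^sup>2 + y\<^sup>2 > 0" using t by (simp add: add_pos_nonneg)
  have "(t + \<bar>y\<bar>)\<^sup>2 \<le> 2 * (t\<^sup>2 + y\<^sup>2)"
    using zero_le_power2[of "t - \<bar>y\<bar>"] by (simp add: power2_eq_square algebra_simps)
  moreover have "(t + \<bar>y\<bar>)\<^sup>2 > 0" using t by (simp add: add_pos_nonneg)
  ultimately show "norm (1 / (of_real t + \<i> * of_real y)\<^sup>2) \<le> 2 / (t + \<bar>y\<bar>)\<^sup>2"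
    using pos by (simp only: norm_divide norm_one n) (simp add: divide_simps mult.commute)
  show "norm (1 / (of_real t + \<i> * of_real y)\<^sup>2) \<le> 1 / y\<^sup>2"
    using pos y by (simp only: norm_divide norm_one n) (simp add: divide_simps)
qed

lemma
  fixes s y :: real
  assumes s: "-1 < s" "s < 1" and y: "y \<noteq> 0"
  shows integrable_powr_div_square_complex:
      "integrable pos_lborel (\<lambda>t. of_real (t powr s) / (of_real t + \<i> * of_real y)\<^sup>2 :: complex)" (is ?thesis1)
    and integral_norm_powr_div_square_le:
      "(LINT t|pos_lborel. norm (of_real (t powr s) / (of_real t + \<i> * of_real y)\<^sup>2 :: complex)) \<le>
          2 * (Gamma (1 + s) * Gamma (1 - s) * \<bar>y\<bar> powr (s - 1))" (is ?thesis2)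
proof -
  have int: "integrable pos_lborel (\<lambda>t. 2 * (t powr s / (t + \<bar>y\<bar>)\<^sup>2))"
    using integrable_powr_div_square[OF s, of "\<bar>y\<bar>"] y by (intro integrable_mult_right) auto
  have le: "norm (of_real (t powr s) / (of_real t + \<i> * of_real y)\<^sup>2 :: complex) \<le> 2 * (t powr s / (t + \<bar>y\<bar>)\<^sup>2)"
    if "t > 0" for t
    using mult_left_mono[OF norm_inverse_square_le(1)[OF that y], of "t powr s"]
    by (simp add: norm_divide mult.commute)
  show int': ?thesis1
  proof (rule Bochner_Integration.integrable_bound[OF int])
    show "(\<lambda>t. of_real (t powr s) / (of_real t + \<i> * of_real y)\<^sup>2 :: complex) \<in> borel_measurable pos_lborel"
      by (rule measurable_pos_lborel) measurable
  qed (auto intro!: AE_I2 order_trans[OF le] simp: space_restrict_space)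
  have "(LINT t|pos_lborel. norm (of_real (t powr s) / (of_real t + \<i> * of_real y)\<^sup>2 :: complex)) \<le>
        (LINT t|pos_lborel. 2 * (t powr s / (t + \<bar>y\<bar>)\<^sup>2))"
    using int int' le by (intro integral_mono integrable_norm) (auto simp: space_restrict_space)
  also have "\<dots> = 2 * (Gamma (1 + s) * Gamma (1 - s) * \<bar>y\<bar> powr (s - 1))"
    using integral_powr_div_square_real[OF s, of "\<bar>y\<bar>"] y by (subst integral_mult_right_zero) auto
  finally show ?thesis2 .
qed

lemma summable_shifted_powr':
  fixes v s c :: real
  assumes v: "v > 0" and s: "s < 0" and c: "c > 0"
  shows "summable (\<lambda>n. (c * (real n + v)) powr (s - 1))"
  using summable_shifted_powr[OF v, of "1 - s"] s c v by (simp add: powr_mult summable_mult)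

text \<open>Termwise integration of the partial fractions: \<open>-1 < s\<close> makes each term
  integrable at 0, and \<open>s < 0\<close> makes the integrated terms, of order y powr (s - 1),
  summable over n.\<close>

lemma polylog_mellin_reflection:
  fixes a s :: real
  assumes a: "0 < a" "a < 1" and s: "-1 < s" "s < 0"
  shows "polylog_mellin (exp (2 * of_real pi * \<i> * of_real a)) (of_real s) =
           of_real (Gamma (1 + s) * Gamma (1 - s) * (2 * pi) powr (s - 1)) *
             (exp (- (\<i> * of_real (pi / 2 * (s - 1)))) * of_real (\<Sum>n. (real n + a) powr (s - 1)) +
              exp (\<i> * of_real (pi / 2 * (s - 1))) * of_real (\<Sum>n. (real n + (1 - a)) powr (s - 1)))"
proof -
  define y1 y2 where "y1 = (\<lambda>n. 2 * pi * (real n + a))" and "y2 = (\<lambda>n. 2 * pi * (real n + (1 - a)))"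
  have y: "y1 n > 0" "y2 n > 0" for n using a by (auto simp: y1_def y2_def add_nonneg_pos)
  define G where "G = Gamma (1 + s) * Gamma (1 - s)"
  define f1 f2 :: "nat \<Rightarrow> real \<Rightarrow> complex" where
    "f1 = (\<lambda>n t. of_real (t powr s) / (of_real t + \<i> * of_real (- y1 n))\<^sup>2)" and
    "f2 = (\<lambda>n t. of_real (t powr s) / (of_real t + \<i> * of_real (y2 n))\<^sup>2)"
  have int: "integrable pos_lborel (f1 n)" "integrable pos_lborel (f2 n)" for n
    unfolding f1_def f2_def using s y[of n] by (auto intro!: integrable_powr_div_square_complex simp del: of_real_minus)
  \<comment> \<open>Used with two exponents: p = s for the integrated terms, p = -1 (inverse
    squares) for the pointwise sum at fixed t.\<close>
  have summ: "summable (\<lambda>n. y1 n powr (p - 1))" "summable (\<lambda>n. y2 n powr (p - 1))" if "p < 0" for p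
    unfolding y1_def y2_def using a that by (auto intro!: summable_shifted_powr')
  have sum: "(\<lambda>n. f1 n t + f2 n t) sums
     (of_real t powr of_real s * polylog_kernel (exp (2 * of_real pi * \<i> * of_real a)) t)" if t: "t > 0" for t
    using sums_mult[OF polylog_kernel_sums[OF t, of a], of "of_real (t powr s)"] t
    by (simp add: f1_def f2_def y1_def y2_def distrib_left powr_of_real)
  have "(\<lambda>n. LINT t|pos_lborel. f1 n t + f2 n t) sums (LINT t|pos_lborel. (\<Sum>n. f1 n t + f2 n t))"
  proof (rule sums_integral)
    show "integrable pos_lborel (\<lambda>t. f1 n t + f2 n t)" for n using int by auto
    show "AE t in pos_lborel. summable (\<lambda>n. norm (f1 n t + f2 n t))"
    proof (rule AE_I2)
      fix t assume "t \<in> space pos_lborel"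
      hence t: "t > 0" by (simp add: space_restrict_space)
      have "summable (\<lambda>n. t powr s * (y1 n powr (-1 - 1) + y2 n powr (-1 - 1)))"
        by (intro summable_mult summable_add summ) auto
      thus "summable (\<lambda>n. norm (f1 n t + f2 n t))"
      proof (rule summable_comparison_test')
        fix n :: nat
        have "norm (f1 n t) \<le> t powr s * (1 / (- y1 n)\<^sup>2)" "norm (f2 n t) \<le> t powr s * (1 / (y2 n)\<^sup>2)"
          using mult_left_mono[OF norm_inverse_square_le(2)[OF t, of "- y1 n"], of "t powr s"]
            mult_left_mono[OF norm_inverse_square_le(2)[OF t, of "y2 n"], of "t powr s"] y[of n]
          by (auto simp: f1_def f2_def norm_divide)
        moreover have "y1 n powr (-1 - 1) = 1 / (- y1 n)\<^sup>2" "y2 n powr (-1 - 1) = 1 / (y2 n)\<^sup>2"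
          using y[of n] by (simp_all add: powr_minus powr_numeral divide_inverse)
        ultimately show "norm (norm (f1 n t + f2 n t)) \<le> t powr s * (y1 n powr (-1 - 1) + y2 n powr (-1 - 1))"
          using norm_triangle_ineq[of "f1 n t" "f2 n t"] by (simp add: distrib_left)
      qed
    qed
    have "summable (\<lambda>n. 2 * (G * y1 n powr (s - 1)) + 2 * (G * y2 n powr (s - 1)))"
      using s by (intro summable_mult summable_add summ) auto
    thus "summable (\<lambda>n. LINT t|pos_lborel. norm (f1 n t + f2 n t))"
    proof (rule summable_comparison_test')
      fix n :: nat
      have "(LINT t|pos_lborel. norm (f1 n t + f2 n t)) \<le> (LINT t|pos_lborel. norm (f1 n t) + norm (f2 n t))"
        using int by (intro integral_mono Bochner_Integration.integrable_add integrable_norm norm_triangle_ineq) auto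
      also have "\<dots> = (LINT t|pos_lborel. norm (f1 n t)) + (LINT t|pos_lborel. norm (f2 n t))"
        using int by (intro Bochner_Integration.integral_add integrable_norm) auto
      also have "\<dots> \<le> 2 * (G * y1 n powr (s - 1)) + 2 * (G * y2 n powr (s - 1))"
        using integral_norm_powr_div_square_le[of s "- y1 n"] integral_norm_powr_div_square_le[of s "y2 n"] y[of n] s
        unfolding f1_def f2_def G_def by (intro add_mono) auto
      finally show "norm (LINT t|pos_lborel. norm (f1 n t + f2 n t)) \<le> 2 * (G * y1 n powr (s - 1)) + 2 * (G * y2 n powr (s - 1))"
        by simp
    qed
  qed
  also have "(LINT t|pos_lborel. (\<Sum>n. f1 n t + f2 n t)) = polylog_mellin (exp (2 * of_real pi * \<i> * of_real a)) (of_real s)"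
    unfolding polylog_mellin_def using sum
    by (intro Bochner_Integration.integral_cong) (auto simp: space_restrict_space sums_iff)
  finally have 1: "(\<lambda>n. LINT t|pos_lborel. f1 n t + f2 n t) sums polylog_mellin (exp (2 * of_real pi * \<i> * of_real a)) (of_real s)" .
  define c where "c = G * (2 * pi) powr (s - 1)"
  have "(LINT t|pos_lborel. f1 n t + f2 n t) =
     of_real c * (exp (- (\<i> * of_real (pi / 2 * (s - 1)))) * of_real ((real n + a) powr (s - 1)) +
              exp (\<i> * of_real (pi / 2 * (s - 1))) * of_real ((real n + (1 - a)) powr (s - 1)))" for n
  proof -
    have "(LINT t|pos_lborel. f1 n t) = of_real G * (of_real (y1 n powr (s - 1)) * exp (- (\<i> * of_real (pi / 2 * (s - 1)))))"
      unfolding f1_def using s y[of n] integral_powr_div_square[of s "- y1 n"] ii_times_powr(2)[of "y1 n" "s - 1"]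
      by (simp add: G_def)
    moreover have "(LINT t|pos_lborel. f2 n t) = of_real G * (of_real (y2 n powr (s - 1)) * exp (\<i> * of_real (pi / 2 * (s - 1))))"
      unfolding f2_def using s y[of n] integral_powr_div_square[of s "y2 n"] ii_times_powr(1)[of "y2 n" "s - 1"]
      by (simp add: G_def)
    moreover have "y1 n powr (s - 1) = (2 * pi) powr (s - 1) * (real n + a) powr (s - 1)"
                  "y2 n powr (s - 1) = (2 * pi) powr (s - 1) * (real n + (1 - a)) powr (s - 1)"
      using a by (auto simp: y1_def y2_def powr_mult)
    ultimately show ?thesis using int[of n] by (simp add: c_def algebra_simps)
  qed
  moreover have "(\<lambda>n. of_real c * (exp (- (\<i> * of_real (pi / 2 * (s - 1)))) * of_real ((real n + a) powr (s - 1)) +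
              exp (\<i> * of_real (pi / 2 * (s - 1))) * of_real ((real n + (1 - a)) powr (s - 1)))) sums
       (of_real c * (exp (- (\<i> * of_real (pi / 2 * (s - 1)))) * of_real (\<Sum>n. (real n + a) powr (s - 1)) +
              exp (\<i> * of_real (pi / 2 * (s - 1))) * of_real (\<Sum>n. (real n + (1 - a)) powr (s - 1))))"
    using summable_shifted_powr[of a "1 - s"] summable_shifted_powr[of "1 - a" "1 - s"] a s
    by (intro sums_mult sums_add sums_of_real summable_sums) auto
  ultimately show ?thesis
    using 1 unfolding c_def G_def by (simp add: sums_iff)
qed

section \<open>Continuation of the Hurwitz zeta function to the half-plane Re s > -1\<close>

text \<open>The error of the trapezoidal rule for \<open>y powr (- s)\<close> on the interval from \<open>x\<close> to \<open>x + 1\<close>, in Peano kernel form.\<close>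

definition trapezoid_term :: "real \<Rightarrow> complex \<Rightarrow> complex" where
  "trapezoid_term x s = s * (s + 1) / 2 *
     integral (cbox 0 1) (\<lambda>u::real. of_real (u * (1 - u)) * of_real (x + u) powr (- s - 2))"

lemma trapezoid_term_integrable:
  assumes x: "x > 0"
  shows "(\<lambda>u::real. of_real (u * (1 - u)) * complex_of_real (x + u) powr (- s - 2)) integrable_on cbox 0 1"
  using x by (intro integrable_continuous continuous_intros) (auto simp: complex_nonpos_Reals_iff simp del: of_real_add)

lemma holomorphic_trapezoid_term:
  assumes x: "x > 0"
  shows "trapezoid_term x holomorphic_on UNIV"
proof -
  have "(\<lambda>s. integral (cbox 0 1) (\<lambda>u::real. of_real (u * (1 - u)) * of_real (x + u) powr (- s - 2))) holomorphic_on (UNIV :: complex set)"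
  proof (rule leibniz_rule_holomorphic[where fx = "\<lambda>s u. - (of_real (u * (1 - u)) * (Ln (of_real (x + u)) * of_real (x + u) powr (- s - 2)))"])
    show "((\<lambda>s. of_real (t * (1 - t)) * complex_of_real (x + t) powr (- s - 2)) has_field_derivative
            - (of_real (t * (1 - t)) * (Ln (of_real (x + t)) * of_real (x + t) powr (- s - 2)))) (at s within UNIV)"
      if "t \<in> cbox 0 1" for s t
    proof -
      have "complex_of_real (x + t) \<noteq> 0" using that x by (simp only: of_real_eq_0_iff) auto
      thus ?thesis by (auto intro!: derivative_eq_intros has_field_derivative_powr_right[THEN DERIV_chain2])
    qed
    show "continuous_on (UNIV \<times> cbox 0 1)
      (\<lambda>(s, u). - (of_real (u * (1 - u)) * (Ln (of_real (x + u)) * complex_of_real (x + u) powr (- s - 2))))"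
      unfolding case_prod_unfold using x
      by (intro continuous_intros) (auto simp: complex_nonpos_Reals_iff simp del: of_real_add)
  qed (use trapezoid_term_integrable[OF x] in auto)
  thus ?thesis
    unfolding trapezoid_term_def [abs_def] by (intro holomorphic_intros) auto
qed

text \<open>On the unit interval the weight is at most 1 and, for Re s > -2, the power is largest at
  the left end. The decay x^(-Re s - 2) is what makes the sum over x = n + v converge for Re s >
  -1.\<close>

lemma norm_trapezoid_term_le:
  assumes x: "x > 0" and s: "Re s > -2"
  shows "norm (trapezoid_term x s) \<le> norm (s * (s + 1) / 2) * x powr (- Re s - 2)"
proof -
  have "norm (integral (cbox 0 1) (\<lambda>u::real. of_real (u * (1 - u)) * complex_of_real (x + u) powr (- s - 2))) \<le>
        integral (cbox 0 1) (\<lambda>u::real. x powr (- Re s - 2))"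
  proof (rule integral_norm_bound_integral)
    fix u :: real assume u: "u \<in> cbox 0 1"
    have "norm (complex_of_real (x + u) powr (- s - 2)) = (x + u) powr (- Re s - 2)"
      using x u by (subst norm_powr_real_powr) auto
    also have "\<dots> \<le> x powr (- Re s - 2)" using x u s by (intro powr_mono2') auto
    finally have "norm (complex_of_real (x + u) powr (- s - 2)) \<le> x powr (- Re s - 2)" .
    moreover have "\<bar>u * (1 - u)\<bar> \<le> 1" using u by (auto simp: abs_mult intro!: mult_le_one)
    ultimately show "norm (of_real (u * (1 - u)) * complex_of_real (x + u) powr (- s - 2)) \<le> x powr (- Re s - 2)"
      using mult_mono[of "\<bar>u * (1 - u)\<bar>" 1] by (simp only: norm_mult norm_of_real) fastforce
  qed (use trapezoid_term_integrable[OF x] in auto)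
  hence "norm (s * (s + 1) / 2) * norm (integral (cbox 0 1) (\<lambda>u::real. of_real (u * (1 - u)) * complex_of_real (x + u) powr (- s - 2)))
         \<le> norm (s * (s + 1) / 2) * x powr (- Re s - 2)"
    by (intro mult_left_mono) auto
  thus ?thesis unfolding trapezoid_term_def norm_mult by simp
qed

text \<open>In this form the integral part telescopes over x = n + v, which converts a sum of errors
  into a partial sum of (n+v)^(-s) and boundary terms. The value s = 1 is excluded because w^(-s) is
  integrated to w^(1-s)/(1-s).\<close>

lemma trapezoid_term_eq:
  assumes x: "x > 0" and s: "s \<noteq> 1"
  shows "trapezoid_term x s = (of_real x powr (-s) + of_real (x + 1) powr (-s)) / 2
           - (of_real (x + 1) powr (1 - s) - of_real x powr (1 - s)) / (1 - s)"
proof -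
  \<comment> \<open>Antiderivative from two integrations by parts: u(1-u)/2, minus its derivative,
    and its second derivative -1 multiply the successive antiderivatives of s(s+1) w^(-s-2), where w
    = x + u.\<close>
  define G where "G = (\<lambda>z. z * (1 - z) / 2 * (- s) * (of_real x + z) powr (- s - 1)
      - (1 - 2 * z) / 2 * (of_real x + z) powr (- s) - (of_real x + z) powr (1 - s) / (1 - s))"
  have "((\<lambda>u::real. s * (s + 1) / 2 * (of_real (u * (1 - u)) * of_real (x + u) powr (- s - 2)))
          has_integral (G (of_real 1) - G (of_real 0))) {0..1}"
  proof (rule fundamental_theorem_of_calculus)
    fix u :: real assume u: "u \<in> {0..1}"
    define w where "w = complex_of_real x + of_real u"
    have w: "w \<notin> \<real>\<^sub>\<le>\<^sub>0" "w \<noteq> 0" using u x by (auto simp: w_def complex_nonpos_Reals_iff complex_eq_iff)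
    have D: "((\<lambda>z. (of_real x + z) powr p) has_field_derivative p * w powr (p - 1)) (at (of_real u))" for p
      using w unfolding w_def
      by (auto intro!: derivative_eq_intros has_field_derivative_powr[THEN DERIV_chain2])
    have "w powr (1 + (- s - 2)) = w * w powr (- s - 2)" "w powr (1 + (- s - 1)) = w * w powr (- s - 1)"
      using w by (simp_all only: powr_add powr_to_1)
    moreover have "1 + (- s - 2) = - s - 1" "1 + (- s - 1) = - s" by simp_all
    ultimately have p: "w powr (- s - 1) = w * w powr (- s - 2)" "w powr (- s) = w * (w * w powr (- s - 2))"
      by simp_all
    have D1: "((\<lambda>z. z * (1 - z) / 2 * (- s)) has_field_derivative (1 - 2 * of_real u) / 2 * (- s)) (at (of_real u))"
      by (auto intro!: derivative_eq_intros simp: field_simps)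
    have D2: "((\<lambda>z. (1 - 2 * z) / 2) has_field_derivative - 1) (at (complex_of_real u))"
      by (auto intro!: derivative_eq_intros)
    have eq: "(1 - 2 * of_real u) / 2 * (- s) * (of_real x + of_real u) powr (- s - 1)
         + (- s - 1) * w powr (- s - 1 - 1) * (of_real u * (1 - of_real u) / 2 * (- s))
         - (- 1 * (of_real x + of_real u) powr (- s) + - s * w powr (- s - 1) * ((1 - 2 * of_real u) / 2))
         - (1 - s) * w powr (1 - s - 1) / (1 - s) =
         s * (s + 1) / 2 * (of_real (u * (1 - u)) * w powr (- s - 2))"
      using s unfolding w_def[symmetric] by (simp add: p field_simps)
    have "(G has_field_derivative s * (s + 1) / 2 * (of_real (u * (1 - u)) * w powr (- s - 2))) (at (of_real u))"
      unfolding G_def eq [symmetric]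
      by (rule DERIV_diff[OF DERIV_diff[OF DERIV_mult[OF D1 D] DERIV_mult[OF D2 D]] DERIV_cdivide[OF D]])
    thus "((\<lambda>u. G (of_real u)) has_vector_derivative s * (s + 1) / 2 * (of_real (u * (1 - u)) * of_real (x + u) powr (- s - 2)))
            (at u within {0..1})"
      unfolding w_def using has_vector_derivative_real_field by fastforce
  qed auto
  hence "integral {0..1} (\<lambda>u::real. s * (s + 1) / 2 * (of_real (u * (1 - u)) * of_real (x + u) powr (- s - 2))) = G (of_real 1) - G (of_real 0)"
    by (rule integral_unique)
  hence "trapezoid_term x s = G 1 - G 0"
    unfolding trapezoid_term_def integral_mult_right by simp
  also have "\<dots> = (of_real x powr (-s) + of_real (x + 1) powr (-s)) / 2
           - (of_real (x + 1) powr (1 - s) - of_real x powr (1 - s)) / (1 - s)"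
    unfolding G_def by (simp add: diff_divide_distrib add_divide_distrib)
  finally show ?thesis .
qed

lemma trapezoid_term_deriv_0:
  assumes x: "x > 0"
  shows "deriv (trapezoid_term x) 0 = of_real (- (ln x + ln (x + 1)) / 2 + (x + 1) * ln (x + 1) - x * ln x - 1)"
proof -
  have "((\<lambda>s. (of_real x powr (-s) + of_real y powr (-s)) / 2
           - (of_real y powr (1 - s) - of_real x powr (1 - s)) / (1 - s)) has_field_derivative
         of_real (- (ln x + ln y) / 2 + y * ln y - x * ln x - (y - x))) (at (0::complex))" if "y > 0" for y
    using x that by (auto intro!: derivative_eq_intros has_field_derivative_powr_right[THEN DERIV_chain2]
       simp: Ln_of_real algebra_simps diff_divide_distrib add_divide_distrib)
  from this[of "x + 1"] have D: "((\<lambda>s. (of_real x powr (-s) + of_real (x + 1) powr (-s)) / 2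
           - (of_real (x + 1) powr (1 - s) - of_real x powr (1 - s)) / (1 - s)) has_field_derivative
         of_real (- (ln x + ln (x + 1)) / 2 + (x + 1) * ln (x + 1) - x * ln x - 1)) (at (0::complex))"
    using x by simp
  have "eventually (\<lambda>s. s \<in> - {1}) (nhds (0::complex))"
    by (intro eventually_nhds_in_open) auto
  hence "eventually (\<lambda>s. trapezoid_term x s = (of_real x powr (-s) + of_real (x + 1) powr (-s)) / 2
           - (of_real (x + 1) powr (1 - s) - of_real x powr (1 - s)) / (1 - s)) (nhds 0)"
    by eventually_elim (use trapezoid_term_eq[OF x] in auto)
  from deriv_cong_ev[OF this refl] show ?thesis
    using DERIV_imp_deriv[OF D] by simp
qed

text \<open>On a small disc both the polynomial factor and the power have a common bound, so the sum
  is holomorphic and may be differentiated termwise. The series of derivatives is recorded because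
  it yields zeta'(0,v).\<close>

lemma trapezoid_series:
  assumes v: "v > 0"
  obtains E where
    "\<And>s. Re s > -1 \<Longrightarrow> (\<lambda>n. trapezoid_term (real n + v) s) sums E s"
    "\<And>s. Re s > -1 \<Longrightarrow> ((\<lambda>n. deriv (trapezoid_term (real n + v)) s) sums deriv E s)"
    "E holomorphic_on {s. Re s > -1}"
proof -
  have op: "open {s. Re s > -1}" by (rule open_halfspace_Re_gt)
  have "\<exists>g g'. \<forall>s\<in>{s. Re s > -1}. (\<lambda>n. trapezoid_term (real n + v) s) sums g s \<and>
     (\<lambda>n. deriv (trapezoid_term (real n + v)) s) sums g' s \<and> (g has_field_derivative g' s) (at s)"
  proof (rule series_and_derivative_comparison_local[OF op])
    fix n s
    show "(trapezoid_term (real n + v) has_field_derivative deriv (trapezoid_term (real n + v)) s) (at s)"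
      by (rule holomorphic_derivI[OF holomorphic_trapezoid_term]) (use v in \<open>auto simp: add_nonneg_pos\<close>)
  next
    fix z assume z: "z \<in> {s. Re s > -1}"
    define r where "r = (Re z + 1) / 2"
    define a b where "a = Re z - r" and "b = Re z + r"
    define R where "R = norm z + r"
    have r: "r > 0" "a > -1" "b > -1" using z by (auto simp: r_def a_def b_def field_simps)
    define h where "h = (\<lambda>n. R * (R + 1) / 2 * ((real n + v) powr (- (b + 2)) + (real n + v) powr (- (a + 2))))"
    have "summable h" unfolding h_def
      using r by (intro summable_mult summable_add summable_shifted_powr v) auto
    moreover have "norm (trapezoid_term (real n + v) w) \<le> h n" if w: "w \<in> ball z r" for n w
    proof -
      have "\<bar>Re (z - w)\<bar> < r" using w abs_Re_le_cmod[of "z - w"] by (auto simp: dist_norm)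
      hence Re: "a \<le> Re w" "Re w \<le> b" by (auto simp: a_def b_def)
      have R: "norm w \<le> R" using w norm_triangle_ineq[of z "w - z"]
        by (auto simp: R_def dist_norm norm_minus_commute)
      have R0: "0 \<le> R" using R norm_ge_zero order_trans by blast
      hence "norm (w * (w + 1) / 2) \<le> R * (R + 1) / 2"
        using R norm_triangle_ineq[of w 1] by (auto simp: norm_mult norm_divide intro!: mult_mono divide_right_mono)
      moreover have "(real n + v) powr (- Re w - 2) \<le> (real n + v) powr (- (b + 2)) + (real n + v) powr (- (a + 2))"
        using Re v by (intro powr_le_add_powr) auto
      ultimately have "norm (w * (w + 1) / 2) * (real n + v) powr (- Re w - 2) \<le> h n"
        unfolding h_def using R0 by (intro mult_mono) auto
      moreover have "norm (trapezoid_term (real n + v) w) \<le> norm (w * (w + 1) / 2) * (real n + v) powr (- Re w - 2)"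
        using v Re r by (intro norm_trapezoid_term_le) auto
      ultimately show ?thesis by linarith
    qed
    ultimately show "\<exists>d h. 0 < d \<and> summable h \<and> (\<forall>\<^sub>F n in sequentially. \<forall>y\<in>ball z d \<inter> {s. Re s > -1}.
              norm (trapezoid_term (real n + v) y) \<le> h n)"
      using r(1) by (intro exI[of _ r] exI[of _ h]) auto
  qed
  then obtain g g' where g: "\<And>s. Re s > -1 \<Longrightarrow> (\<lambda>n. trapezoid_term (real n + v) s) sums g s"
     "\<And>s. Re s > -1 \<Longrightarrow> (\<lambda>n. deriv (trapezoid_term (real n + v)) s) sums g' s"
     "\<And>s. Re s > -1 \<Longrightarrow> (g has_field_derivative g' s) (at s)" by auto
  show ?thesis
  proof
    show "g holomorphic_on {s. Re s > -1}" using g(3) op by (subst holomorphic_on_open) auto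
  qed (use g DERIV_imp_deriv[OF g(3)] in auto)
qed

text \<open>Represents \<open>(s - 1) * zeta(s, v)\<close> for \<open>Re s > -1\<close>; the factor removes the pole at 1.\<close>

definition hurwitz_reg :: "real \<Rightarrow> complex \<Rightarrow> complex" where
  "hurwitz_reg v s = of_real v powr (1 - s) + (s - 1) * (of_real v powr (-s) / 2 + (\<Sum>n. trapezoid_term (real n + v) s))"

lemma holomorphic_hurwitz_reg:
  assumes v: "v > 0"
  shows "hurwitz_reg v holomorphic_on {s. Re s > -1}"
proof -
  obtain E where E: "\<And>s. Re s > -1 \<Longrightarrow> (\<lambda>n. trapezoid_term (real n + v) s) sums E s"
    "E holomorphic_on {s. Re s > -1}" using trapezoid_series[OF v] by metis
  have "(\<lambda>s. \<Sum>n. trapezoid_term (real n + v) s) holomorphic_on {s. Re s > -1}"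
    using E by (subst holomorphic_cong[OF refl, of _ _ E]) (auto simp: sums_iff)
  thus ?thesis unfolding hurwitz_reg_def [abs_def] using v by (intro holomorphic_intros) auto
qed

section \<open>Values at 1 and 0, the Dirichlet series, and the derivative at 0\<close>

lemma hurwitz_reg_1: "v > 0 \<Longrightarrow> hurwitz_reg v 1 = 1"
  by (simp add: hurwitz_reg_def)

text \<open>The factor s annihilates every trapezoid term, so the two elementary terms remain;
  divided by s - 1 = -1 this is zeta(0,v) = 1/2 - v.\<close>

lemma hurwitz_reg_0: "v > 0 \<Longrightarrow> hurwitz_reg v 0 = of_real (v - 1 / 2)"
  by (simp add: hurwitz_reg_def trapezoid_term_def)

text \<open>First-order Euler-Maclaurin summation: adding up the trapezoid errors gives the partial
  sum of the series and boundary terms, and those at N vanish in the limit when Re s > 1.\<close>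

lemma hurwitz_sums:
  assumes v: "v > 0" and s: "Re s > 1"
  shows "(\<lambda>n. of_real (real n + v) powr (- s)) sums (hurwitz_reg v s / (s - 1))"
proof -
  have s1: "s \<noteq> 1" using s by auto
  obtain E where E: "(\<lambda>n. trapezoid_term (real n + v) s) sums E s"
    using trapezoid_series[OF v] s by (metis less_trans neg_less_iff_less one_less_numeral_iff zero_less_one less_numeral_extra(1) neg_0_less_iff_less neg_less_0_iff_less)
  have part: "(\<Sum>n<N. of_real (real n + v) powr (- s)) =
     (\<Sum>n<N. trapezoid_term (real n + v) s) + of_real v powr (-s) / 2 - of_real (real N + v) powr (-s) / 2
      + (of_real (real N + v) powr (1 - s) - of_real v powr (1 - s)) / (1 - s)" for N
  proof (induction N)
    case (Suc N)
    have "trapezoid_term (real N + v) s = (of_real (real N + v) powr (-s) + of_real (real (Suc N) + v) powr (-s)) / 2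
           - (of_real (real (Suc N) + v) powr (1 - s) - of_real (real N + v) powr (1 - s)) / (1 - s)"
      using trapezoid_term_eq[of "real N + v" s] v s1 by (simp add: add_ac add_nonneg_pos)
    thus ?case unfolding sum.lessThan_Suc Suc.IH by (simp add: diff_divide_distrib add_divide_distrib)
  qed auto
  have lim: "(\<lambda>N. complex_of_real (real N + v) powr p) \<longlonglongrightarrow> 0" if p: "Re p < 0" for p
  proof -
    have "(\<lambda>N. (real N + v) powr Re p) \<longlonglongrightarrow> 0"
      by (intro tendsto_neg_powr p) real_asymp
    also have "(\<lambda>N. (real N + v) powr Re p) = (\<lambda>N. norm (complex_of_real (real N + v) powr p))"
      using v by (intro ext, subst norm_powr_real_powr) auto
    finally show ?thesis by (rule tendsto_norm_zero_cancel)
  qed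
  have "(\<lambda>N. (\<Sum>n<N. trapezoid_term (real n + v) s) + of_real v powr (-s) / 2 - of_real (real N + v) powr (-s) / 2
      + (of_real (real N + v) powr (1 - s) - of_real v powr (1 - s)) / (1 - s)) \<longlonglongrightarrow>
      E s + of_real v powr (-s) / 2 - 0 / 2 + (0 - of_real v powr (1 - s)) / (1 - s)"
    using E s s1 unfolding sums_def by (intro tendsto_intros lim) auto
  also have "E s + of_real v powr (-s) / 2 - 0 / 2 + (0 - of_real v powr (1 - s)) / (1 - s) = hurwitz_reg v s / (s - 1)"
    using E s1 unfolding hurwitz_reg_def by (simp add: sums_iff divide_simps) (simp add: algebra_simps)
  finally show ?thesis unfolding sums_def part .
qed

text \<open>Comparing with \<open>ln_Gamma_series\<close> at v and at 1 and subtracting cancels ln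
  N! and leaves elementary asymptotics. The price is an unknown constant, the derivative for v = 1;
  \<open>lerch_deriv_0\<close> determines it.\<close>

lemma hurwitz_reg_deriv_0:
  "\<exists>\<kappa>::real. \<forall>v>0. ((\<lambda>s. hurwitz_reg v s / (s - 1)) has_field_derivative of_real (ln (Gamma v) + \<kappa>)) (at 0)"
proof -
  \<comment> \<open>Derivative at 0 of the N-th Euler-Maclaurin approximation to zeta(s,v);
    \<open>main\<close> shows that it converges to the derivative of the continued function.\<close>
  define L where "L = (\<lambda>v N. - (\<Sum>n<N. ln (real n + v)) - ln (real N + v) / 2 + (real N + v) * ln (real N + v) - real N - v)"
  have main: "\<exists>D. L v \<longlonglongrightarrow> D \<and> ((\<lambda>s. hurwitz_reg v s / (s - 1)) has_field_derivative of_real D) (at 0)"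
    if v: "v > 0" for v :: real
  proof -
    obtain E where E: "\<And>s. Re s > -1 \<Longrightarrow> (\<lambda>n. trapezoid_term (real n + v) s) sums E s"
      "\<And>s. Re s > -1 \<Longrightarrow> ((\<lambda>n. deriv (trapezoid_term (real n + v)) s) sums deriv E s)"
      "E holomorphic_on {s. Re s > -1}" using trapezoid_series[OF v] by metis
    \<comment> \<open>Derivative at 0 of the leading terms v^(1-s)/(s-1) + v^(-s)/2, and at the same
      time \<open>L v 0\<close>, where the telescoping starts.\<close>
    define c where "c = v * ln v - v - ln v / 2"
    have part: "(\<Sum>n<N. deriv (trapezoid_term (real n + v)) 0) = of_real (L v N - c)" for N
    proof (induction N)
      case (Suc N)
      have d: "deriv (trapezoid_term (real N + v)) 0 = of_real (- (ln (real N + v) + ln (real (Suc N) + v)) / 2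
          + (real (Suc N) + v) * ln (real (Suc N) + v) - (real N + v) * ln (real N + v) - 1)"
        using v by (subst trapezoid_term_deriv_0) (auto simp: add_ac add_nonneg_pos)
      show ?case unfolding sum.lessThan_Suc Suc.IH d of_real_add[symmetric] of_real_eq_iff
        by (simp add: L_def field_simps)
    qed (auto simp: L_def c_def)
    have "(\<lambda>N. complex_of_real (L v N - c)) \<longlonglongrightarrow> deriv E 0"
      using E(2)[of 0] unfolding sums_def part by simp
    moreover from tendsto_Re[OF this] have "(\<lambda>N. L v N - c) \<longlonglongrightarrow> Re (deriv E 0)" by simp
    ultimately have lim: "(\<lambda>N. L v N - c) \<longlonglongrightarrow> Re (deriv E 0)" and D: "deriv E 0 = of_real (Re (deriv E 0))"
      using LIMSEQ_unique tendsto_of_real by (blast, metis)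
    have "((\<lambda>s. of_real v powr (1 - s) / (s - 1) + of_real v powr (- s) / 2 + E s) has_field_derivative
             of_real (Re (deriv E 0) + c)) (at 0)"
    proof -
      have "(E has_field_derivative deriv E 0) (at 0)"
        by (rule holomorphic_derivI[OF E(3)]) (auto intro: open_halfspace_Re_gt)
      moreover have A: "((\<lambda>s. of_real v powr (1 - s) / (s - 1) + of_real v powr (- s) / 2) has_field_derivative of_real c) (at (0::complex))"
        using v by (auto intro!: derivative_eq_intros has_field_derivative_powr_right[THEN DERIV_chain2]
           simp: Ln_of_real powr_of_real c_def algebra_simps)
      ultimately show ?thesis
        using D DERIV_add[OF A, of E "deriv E 0"] by (simp add: add.commute)
    qed
    moreover have "eventually (\<lambda>s. s \<in> {s. Re s > -1} - {1}) (nhds (0::complex))"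
      by (intro eventually_nhds_in_open open_Diff open_halfspace_Re_gt) auto
    hence ev: "eventually (\<lambda>s. hurwitz_reg v s / (s - 1) =
             of_real v powr (1 - s) / (s - 1) + of_real v powr (- s) / 2 + E s) (nhds 0)"
    proof eventually_elim
      case (elim s)
      thus ?case using E(1)[of s] by (auto simp: hurwitz_reg_def sums_iff add_divide_distrib)
    qed
    ultimately have "((\<lambda>s. hurwitz_reg v s / (s - 1)) has_field_derivative of_real (Re (deriv E 0) + c)) (at 0)"
      using DERIV_cong_ev[OF refl ev refl] by simp
    moreover have "L v \<longlonglongrightarrow> Re (deriv E 0) + c"
      using tendsto_add[OF lim tendsto_const[of c]] by simp
    ultimately show ?thesis by blast
  qed
  obtain \<kappa> where \<kappa>: "L 1 \<longlonglongrightarrow> \<kappa>" using main[of 1] by auto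
  have "((\<lambda>s. hurwitz_reg v s / (s - 1)) has_field_derivative of_real (ln (Gamma v) + \<kappa>)) (at 0)" if v: "v > 0" for v :: real
  proof -
    have ln_fact: "ln (fact N) = (\<Sum>k=1..N. ln (real k))" for N
      by (induction N) (auto simp: ln_mult)
    have series: "ln_Gamma_series v N = v * ln (real N) + ln (fact N) - (\<Sum>n<N. ln (real n + v)) - ln (real N + v)"
      if v: "v > 0" for N and v :: real
    proof -
      have "(\<Sum>k=1..N. ln (v / real k + 1)) = (\<Sum>k=1..N. ln (real k + v) - ln (real k))"
      proof (intro sum.cong refl)
        fix k assume "k \<in> {1..N}"
        hence "v / real k + 1 = (real k + v) / real k" "real k > 0" by (auto simp: field_simps)
        thus "ln (v / real k + 1) = ln (real k + v) - ln (real k)" using v by (simp add: ln_div)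
      qed
      also have "\<dots> = (\<Sum>k=1..N. ln (real k + v)) - ln (fact N)"
        using ln_fact by (simp add: sum_subtractf)
      also have "(\<Sum>k=1..N. ln (real k + v)) = (\<Sum>n\<le>N. ln (real n + v)) - ln v"
        by (simp add: sum.atMost_shift sum.atLeast1_atMost_eq)
      finally show ?thesis
        by (simp add: ln_Gamma_series_def lessThan_Suc_atMost[symmetric])
    qed
    have lim1: "(\<lambda>N. L v N - ln_Gamma_series v N - (L 1 N - ln_Gamma_series 1 N)) \<longlonglongrightarrow> 0"
    proof -
      \<comment> \<open>The sums of logarithms and ln N! have cancelled; only ln (N + v), ln (N + 1)
        and ln N remain.\<close>
      have "(\<lambda>N. (ln (real N + v) / 2 + (real N + v) * ln (real N + v) - v - v * ln (real N)) -
                 (ln (real N + 1) / 2 + (real N + 1) * ln (real N + 1) - 1 - ln (real N))) \<longlonglongrightarrow> 0"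
        using v by real_asymp
      also have "(\<lambda>N. (ln (real N + v) / 2 + (real N + v) * ln (real N + v) - v - v * ln (real N)) -
                 (ln (real N + 1) / 2 + (real N + 1) * ln (real N + 1) - 1 - ln (real N))) =
          (\<lambda>N. L v N - ln_Gamma_series v N - (L 1 N - ln_Gamma_series 1 N))"
        using v by (intro ext) (simp add: series L_def)
      finally show ?thesis .
    qed
    have "(\<lambda>N. (L v N - ln_Gamma_series v N - (L 1 N - ln_Gamma_series 1 N)) + ln_Gamma_series v N + (L 1 N - ln_Gamma_series 1 N))
       \<longlonglongrightarrow> 0 + ln_Gamma v + (\<kappa> - ln_Gamma 1)"
      using v \<kappa> by (intro tendsto_intros lim1 ln_Gamma_real_LIMSEQ) auto
    hence "L v \<longlonglongrightarrow> ln (Gamma v) + \<kappa>" using v by (simp add: ln_Gamma_real_pos)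
    thus ?thesis using main[OF v] LIMSEQ_unique by blast
  qed
  thus ?thesis by blast
qed

section \<open>The functional equation\<close>

text \<open>Represents \<open>(s - 1) * Li_s(z)\<close> for an \<open>m\<close>-th root of unity \<open>z\<close>, split into residue classes modulo \<open>m\<close>.\<close>

definition periodic_reg :: "nat \<Rightarrow> complex \<Rightarrow> complex \<Rightarrow> complex" where
  "periodic_reg m z s = of_nat m powr (-s) * (\<Sum>l=1..m. z ^ l * hurwitz_reg (real l / real m) s)"

lemma holomorphic_periodic_reg:
  assumes m: "m > 0"
  shows "periodic_reg m z holomorphic_on {s. Re s > -1}"
  unfolding periodic_reg_def [abs_def] using m
  by (intro holomorphic_intros holomorphic_hurwitz_reg) auto

lemma holomorphic_eq_on_halfplane:
  assumes f: "f holomorphic_on {s. Re s > -1}" and g: "g holomorphic_on {s. Re s > -1}"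
    and eq: "\<And>x. x > 1 \<Longrightarrow> f (complex_of_real x) = g (of_real x)" and s: "Re s > -1"
  shows "f s = g s"
proof -
  have "f s - g s = 0"
  proof (rule analytic_continuation[where f = "\<lambda>s. f s - g s" and S = "{s. Re s > -1}" and U = "complex_of_real ` {1<..}" and \<xi> = 2])
    show "connected {s. Re s > -1}" by (intro convex_connected convex_halfspace_Re_gt)
    have "(2::real) islimpt {1<..}" by (intro open_imp_islimpt) auto
    hence "complex_of_real 2 islimpt complex_of_real ` {1<..}"
      by (rule islimpt_complex_of_real)
    thus "2 islimpt complex_of_real ` {1<..}" by simp
  qed (use f g eq s in \<open>auto intro!: holomorphic_intros open_halfspace_Re_gt\<close>)
  thus ?thesis by simp
qed

text \<open>In this strip both s and 1 - s have real part above -1, so both sides of a functional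
  equation are holomorphic there; the seed interval is the range of the reflected Mellin
  integral.\<close>

lemma holomorphic_eq_on_strip:
  assumes f: "f holomorphic_on {s. -1 < Re s \<and> Re s < 2}" and g: "g holomorphic_on {s. -1 < Re s \<and> Re s < 2}"
    and eq: "\<And>x. -1 < x \<Longrightarrow> x < 0 \<Longrightarrow> f (complex_of_real x) = g (of_real x)" and s: "-1 < Re s" "Re s < 2"
  shows "f s = g s"
proof -
  have S: "{s. -1 < Re s \<and> Re s < 2} = {s. Re s > -1} \<inter> {s. Re s < 2}" by auto
  have "f s - g s = 0"
  proof (rule analytic_continuation[where f = "\<lambda>s. f s - g s" and S = "{s. -1 < Re s \<and> Re s < 2}" and U = "complex_of_real ` {-1<..<0}" and \<xi> = "-1/2"])
    show "connected {s. -1 < Re s \<and> Re s < 2}" unfolding S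
      by (intro convex_connected convex_Int convex_halfspace_Re_gt convex_halfspace_Re_lt)
    show "open {s. -1 < Re s \<and> Re s < 2}" unfolding S
      by (intro open_Int open_halfspace_Re_gt open_halfspace_Re_lt)
    have "(-1/2::real) islimpt {-1<..<0}" by (intro open_imp_islimpt) auto
    hence "complex_of_real (-1/2) islimpt complex_of_real ` {-1<..<0}"
      by (rule islimpt_complex_of_real)
    thus "-1/2 islimpt complex_of_real ` {-1<..<0}" by simp
  qed (use f g eq s in \<open>auto intro!: holomorphic_intros\<close>)
  thus ?thesis by simp
qed

text \<open>Grouping the indices k = n m + l by residue leaves z^l because z^m = 1, and k = m (n +
  l/m). The residues run from 1 to m, not from 0, so that every parameter l/m is positive.\<close>

lemma periodic_reg_of_real:
  fixes s :: real
  assumes m: "m > 0" and z: "z ^ m = 1" and s: "s > 1"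
    and S: "(\<lambda>n. z ^ Suc n * of_real (real (Suc n) powr (- s))) sums S"
  shows "periodic_reg m z (of_real s) = (of_real s - 1) * S"
proof -
  define F where "F = (\<lambda>n. z ^ Suc n * complex_of_real (real (Suc n) powr (- s)))"
  have "(\<lambda>n. sum F {n * m..<n * m + m}) sums S"
    using S m unfolding F_def by (rule sums_group)
  also have "(\<lambda>n. sum F {n * m..<n * m + m}) =
     (\<lambda>n. \<Sum>l=1..m. of_nat m powr (- of_real s) * (z ^ l * of_real (real n + real l / real m) powr (- of_real s)))"
  proof
    fix n
    have "sum F {n * m..<n * m + m} = (\<Sum>l=1..m. F (n * m + l - 1))"
      \<comment> \<open>\<open>F k\<close> is the term of index k + 1, so the block from n m to n m
        + m - 1 corresponds to l = 1, ..., m.\<close>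
      by (rule sum.reindex_bij_witness[of _ "\<lambda>l. n * m + l - 1" "\<lambda>k. k + 1 - n * m"]) (use m in auto)
    also have "\<dots> = (\<Sum>l=1..m. of_nat m powr (- of_real s) * (z ^ l * of_real (real n + real l / real m) powr (- of_real s)))"
    proof (intro sum.cong refl)
      fix l assume l: "l \<in> {1..m}"
      hence "z ^ Suc (n * m + l - 1) = z ^ (m * n) * z ^ l" by (simp add: mult.commute add.commute flip: power_add)
      hence zz: "z ^ Suc (n * m + l - 1) = z ^ l" using z by (simp add: power_mult)
      have "real (Suc (n * m + l - 1)) = real m * (real n + real l / real m)"
        using l m by (simp add: field_simps of_nat_diff)
      hence rr: "real (Suc (n * m + l - 1)) powr (- s) = real m powr (- s) * (real n + real l / real m) powr (- s)"
        by (simp add: powr_mult)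
      have nn: "of_nat m powr (- complex_of_real s) = of_real (real m powr (- s))"
        "complex_of_real (real n + real l / real m) powr (- complex_of_real s) = of_real ((real n + real l / real m) powr (- s))"
        using powr_of_real[of "real m" "- s"] powr_of_real[of "real n + real l / real m" "- s"] by simp_all
      show "F (n * m + l - 1) = of_nat m powr (- of_real s) * (z ^ l * of_real (real n + real l / real m) powr (- of_real s))"
        unfolding F_def zz rr nn by simp
    qed
    finally show "sum F {n * m..<n * m + m} = \<dots>" .
  qed
  finally have 1: "(\<lambda>n. \<Sum>l=1..m. of_nat m powr (- of_real s) * (z ^ l * of_real (real n + real l / real m) powr (- of_real s))) sums S" .
  have 2: "(\<lambda>n. \<Sum>l=1..m. of_nat m powr (- of_real s) * (z ^ l * of_real (real n + real l / real m) powr (- of_real s))) sums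
      (\<Sum>l=1..m. of_nat m powr (- of_real s) * (z ^ l * (hurwitz_reg (real l / real m) (of_real s) / (of_real s - 1))))"
    using m s by (intro sums_sum sums_mult hurwitz_sums) auto
  have s1: "complex_of_real s - 1 \<noteq> 0" using s by (simp add: complex_eq_iff)
  have "S = (\<Sum>l=1..m. of_nat m powr (- of_real s) * (z ^ l * (hurwitz_reg (real l / real m) (of_real s) / (of_real s - 1))))"
    using 1 2 by (rule sums_unique2)
  also have "\<dots> = periodic_reg m z (of_real s) / (of_real s - 1)"
    unfolding periodic_reg_def by (simp add: sum_distrib_left sum_divide_distrib)
  finally show ?thesis using s1 by simp
qed

lemma periodic_reg_1:
  assumes m: "m > 0" and s: "Re s > -1"
  shows "periodic_reg m 1 s = hurwitz_reg 1 s"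
proof (rule holomorphic_eq_on_halfplane[OF _ _ _ s])
  fix x :: real assume x: "x > 1"
  have "(\<lambda>n. complex_of_real (real n + 1) powr (- of_real x)) sums (hurwitz_reg 1 (of_real x) / (of_real x - 1))"
    using x by (intro hurwitz_sums) auto
  also have "(\<lambda>n. complex_of_real (real n + 1) powr (- of_real x)) = (\<lambda>n. 1 ^ Suc n * of_real (real (Suc n) powr (- x)))"
  proof
    fix n
    have "complex_of_real (real (Suc n)) powr of_real (- x) = of_real (real (Suc n) powr (- x))"
      by (rule powr_of_real) simp
    thus "complex_of_real (real n + 1) powr (- of_real x) = 1 ^ Suc n * of_real (real (Suc n) powr (- x))"
      by (simp add: add.commute)
  qed
  finally have "periodic_reg m 1 (of_real x) = (of_real x - 1) * (hurwitz_reg 1 (of_real x) / (of_real x - 1))"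
    using m x by (intro periodic_reg_of_real) auto
  thus "periodic_reg m 1 (of_real x) = hurwitz_reg 1 (of_real x)"
    using x by (subst (asm) nonzero_mult_div_cancel_left times_divide_eq_right) auto
qed (use m in \<open>auto intro: holomorphic_periodic_reg holomorphic_hurwitz_reg\<close>)

text \<open>For m = 2 this ties the parameter 1/2 to the parameter 1; for general m it evaluates the
  sum with equal weights that arises when r = m.\<close>

lemma hurwitz_reg_multiplication:
  assumes m: "m > 0" and s: "Re s > -1"
  shows "(\<Sum>l=1..m. hurwitz_reg (real l / real m) s) = of_nat m powr s * hurwitz_reg 1 s"
  using periodic_reg_1[OF m s] m by (simp add: periodic_reg_def powr_minus field_simps)

text \<open>Both sides are holomorphic for Re s > -1 and agree for s > 1 by the power series.
  Multiplying by the entire function \<open>rGamma\<close>, rather than dividing by Gamma, keeps the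
  right-hand side visibly holomorphic.\<close>

lemma periodic_reg_mellin:
  assumes m: "m > 0" and z: "z ^ m = 1" "z \<noteq> 1" and s: "Re s > -1"
  shows "periodic_reg m z s = (s - 1) * (polylog_mellin z s * rGamma (s + 1))"
proof (rule holomorphic_eq_on_halfplane[OF _ _ _ s])
  have "norm z ^ m = 1" using z(1) by (metis norm_one norm_power)
  hence nz: "norm z = 1" using m power_eq_iff_eq_base[of m "norm z" 1] by simp
  show "(\<lambda>s. (s - 1) * (polylog_mellin z s * rGamma (s + 1))) holomorphic_on {s. Re s > -1}"
    by (intro holomorphic_intros holomorphic_polylog_mellin nz z)
  fix x :: real assume x: "x > 1"
  have G: "Gamma (x + 1) \<noteq> 0" using x Gamma_real_pos[of "x + 1"] by linarith
  have "(\<lambda>n. of_real (inverse (Gamma (x + 1))) * (of_real (Gamma (x + 1)) * (z ^ Suc n * of_real (real (Suc n) powr (- x))))) sums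
         (of_real (inverse (Gamma (x + 1))) * polylog_mellin z (of_real x))"
    by (intro sums_mult polylog_mellin_sums nz z x)
  also have "(\<lambda>n. complex_of_real (inverse (Gamma (x + 1))) * (of_real (Gamma (x + 1)) * (z ^ Suc n * of_real (real (Suc n) powr (- x))))) =
     (\<lambda>n. z ^ Suc n * of_real (real (Suc n) powr (- x)))"
    using G by (intro ext) (simp add: field_simps del: of_nat_Suc)
  finally have "periodic_reg m z (of_real x) = (of_real x - 1) * (of_real (inverse (Gamma (x + 1))) * polylog_mellin z (of_real x))"
    using m z x by (intro periodic_reg_of_real) auto
  also have "complex_of_real (inverse (Gamma (x + 1))) = rGamma (of_real x + 1)"
    using rGamma_complex_of_real[of "x + 1"] unfolding rGamma_inverse_Gamma[of "x + 1"] by simp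
  finally show "periodic_reg m z (of_real x) = (of_real x - 1) * (polylog_mellin z (of_real x) * rGamma (of_real x + 1))"
    by simp
qed (use m in \<open>auto intro: holomorphic_periodic_reg\<close>)

text \<open>At 1 - s the regularising factor of \<open>hurwitz_reg\<close> is -s, so multiplication
  by s turns both series of exponent s - 1 into \<open>hurwitz_reg\<close>. Gamma(1+s) from the
  Mellin integral cancels against \<open>rGamma\<close>, which leaves Gamma(1-s).\<close>

lemma periodic_reg_reflection:
  fixes s :: real
  assumes r: "0 < r" "r < m" and s: "-1 < s" "s < 0"
  shows "periodic_reg m (exp (2 * of_real pi * \<i> * of_real (real r / real m))) (of_real s) * (of_real s) =
     (1 - of_real s) * of_real (Gamma (1 - s) * (2 * pi) powr (s - 1)) *
     (exp (- (\<i> * of_real (pi / 2 * (s - 1)))) * hurwitz_reg (real r / real m) (1 - of_real s) +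
      exp (\<i> * of_real (pi / 2 * (s - 1))) * hurwitz_reg (1 - real r / real m) (1 - of_real s))"
proof -
  define a where "a = real r / real m"
  have a: "0 < a" "a < 1" and m: "m > 0" using r by (auto simp: a_def)
  define z where "z = exp (2 * of_real pi * \<i> * of_real a)"
  have "z ^ m = exp (of_nat m * (2 * of_real pi * \<i> * of_real a))" unfolding z_def by (rule exp_of_nat_mult [symmetric])
  also have "of_nat m * (2 * of_real pi * \<i> * of_real a) = 2 * of_nat r * of_real pi * \<i>"
    using m by (simp add: a_def)
  also have "exp \<dots> = 1" by (subst exp_eq_1) (auto intro!: exI[of _ "int r"])
  finally have zm: "z ^ m = 1" .
  have z1: "z \<noteq> 1"
  proof
    assume "z = 1"
    then obtain n :: int where "2 * pi * a = of_int (2 * n) * pi" unfolding z_def exp_eq_1 by auto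
    hence "a = of_int n" by simp
    with a have "0 < n" "n < 1" by simp_all
    thus False by simp
  qed
  have series: "complex_of_real (\<Sum>n. (real n + v) powr (s - 1)) * of_real s = - hurwitz_reg v (1 - of_real s)"
    if v: "v > 0" for v
  proof -
    have "(\<lambda>n. complex_of_real (real n + v) powr (- (1 - of_real s))) sums (hurwitz_reg v (1 - of_real s) / ((1 - of_real s) - 1))"
      using s v by (intro hurwitz_sums) auto
    also have "(\<lambda>n. complex_of_real (real n + v) powr (- (1 - of_real s))) = (\<lambda>n. of_real ((real n + v) powr (s - 1)))"
      proof
      fix n
      have "complex_of_real (real n + v) powr of_real (s - 1) = of_real ((real n + v) powr (s - 1))"
        using v by (intro powr_of_real) simp
      thus "complex_of_real (real n + v) powr (- (1 - of_real s)) = of_real ((real n + v) powr (s - 1))"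
        by simp
    qed
    finally have "(\<lambda>n. complex_of_real ((real n + v) powr (s - 1))) sums (hurwitz_reg v (1 - of_real s) / (- of_real s))" by simp
    moreover have "(\<lambda>n. complex_of_real ((real n + v) powr (s - 1))) sums of_real (\<Sum>n. (real n + v) powr (s - 1))"
      using summable_shifted_powr[OF v, of "1 - s"] s by (intro sums_of_real summable_sums) auto
    ultimately have "of_real (\<Sum>n. (real n + v) powr (s - 1)) = hurwitz_reg v (1 - of_real s) / (- of_real s)"
      using sums_unique2 by blast
    thus ?thesis using s by simp
  qed
  have "rGamma (complex_of_real (s + 1)) = of_real (rGamma (s + 1))" by (rule rGamma_complex_of_real)
  hence rG: "rGamma (complex_of_real s + 1) = of_real (inverse (Gamma (1 + s)))"
    unfolding rGamma_inverse_Gamma[of "s + 1"] by (simp add: add.commute)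
  have G: "Gamma (1 + s) \<noteq> 0" using s Gamma_real_pos[of "1 + s"] by linarith
  define C where "C = (2 * pi) powr (s - 1)"
  define E1 E2 where "E1 = exp (- (\<i> * complex_of_real (pi / 2 * (s - 1))))" and "E2 = exp (\<i> * complex_of_real (pi / 2 * (s - 1)))"
  define S1 S2 where "S1 = complex_of_real (\<Sum>n. (real n + a) powr (s - 1))" and "S2 = complex_of_real (\<Sum>n. (real n + (1 - a)) powr (s - 1))"
  have "periodic_reg m z (of_real s) = (of_real s - 1) * (polylog_mellin z (of_real s) * rGamma (of_real s + 1))"
    using m zm z1 s by (intro periodic_reg_mellin) auto
  also have "polylog_mellin z (of_real s) = of_real (Gamma (1 + s) * Gamma (1 - s) * C) * (E1 * S1 + E2 * S2)"
    unfolding z_def C_def E1_def E2_def S1_def S2_def by (rule polylog_mellin_reflection[OF a s])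
  also have "of_real (Gamma (1 + s) * Gamma (1 - s) * C) * (E1 * S1 + E2 * S2) * rGamma (of_real s + 1) =
      of_real (Gamma (1 - s) * C) * (E1 * S1 + E2 * S2)"
    unfolding rG using G by simp
  finally have "periodic_reg m z (of_real s) = (of_real s - 1) * of_real (Gamma (1 - s) * C) * (E1 * S1 + E2 * S2)"
    by (simp only: mult.assoc)
  hence "periodic_reg m z (of_real s) * of_real s = (of_real s - 1) * of_real (Gamma (1 - s) * C) * (E1 * (S1 * of_real s) + E2 * (S2 * of_real s))"
    by (simp only: mult.assoc distrib_right)
  also have "S1 * of_real s = - hurwitz_reg a (1 - of_real s)" unfolding S1_def using a by (intro series) auto
  also have "S2 * of_real s = - hurwitz_reg (1 - a) (1 - of_real s)" unfolding S2_def using a by (intro series) auto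
  finally show ?thesis
    unfolding z_def E1_def E2_def C_def a_def by (simp add: algebra_simps)
qed

lemma Gamma_reflection_real_shift:
  fixes s :: real
  assumes s: "-1 < s" "s < 0"
  shows "Gamma (1 + s) * Gamma (1 - s) * sin (pi * s) = pi * s"
proof -
  have G: "Gamma (complex_of_real s) * Gamma (1 - of_real s) = of_real pi / sin (of_real pi * of_real s)"
    by (rule Gamma_reflection_complex)
  have "Gamma (complex_of_real s) * Gamma (of_real (1 - s)) = of_real (pi / sin (pi * s))"
    using G sin_of_real[of "pi * s", where 'a = complex] by simp
  hence "Gamma s * Gamma (1 - s) = pi / sin (pi * s)"
    unfolding Gamma_complex_of_real of_real_mult [symmetric] of_real_eq_iff .
  moreover have "sin (pi * s) \<noteq> 0"
    using s sin_gt_zero[of "pi * (- s)"] mult_strict_left_mono[of "- s" 1 pi] by (auto simp: mult_less_0_iff)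
  moreover have "Gamma (1 + s) = s * Gamma s"
  proof -
    have "s \<notin> \<int>"
    proof
      assume "s \<in> \<int>"
      then obtain n :: int where "s = of_int n" by (auto elim: Ints_cases)
      with s have "-1 < n" "n < 0" by simp_all
      thus False by simp
    qed
    thus ?thesis using Gamma_plus1[of s] nonpos_Ints_subset_Ints by (auto simp: add.commute)
  qed
  ultimately show ?thesis by (simp add: field_simps)
qed

text \<open>Represents s (s-1) zeta(1-s, r/m): the two extra factors are absorbed in Gamma(1+s) and
  in \<open>hurwitz_reg\<close>, which makes it holomorphic for Re s > -1. The term l = m is still
  present, as the splitting into residue classes produces it.\<close>

definition functional_rhs :: "nat \<Rightarrow> nat \<Rightarrow> complex \<Rightarrow> complex" where
  "functional_rhs m r s = 2 * Gamma (1 + s) * of_real (2 * pi * real m) powr (-s) *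
     (\<Sum>l=1..m. cos (of_real (pi / 2) * s - of_real (2 * pi * real r * real l / real m)) * hurwitz_reg (real l / real m) s)"

lemma holomorphic_functional_rhs:
  assumes m: "m > 0"
  shows "functional_rhs m r holomorphic_on {s. Re s > -1}"
proof -
  have "1 + s \<notin> \<int>\<^sub>\<le>\<^sub>0" if "Re s > -1" for s :: complex
    using that by (auto elim!: nonpos_Ints_cases simp: complex_eq_iff)
  thus ?thesis
    unfolding functional_rhs_def [abs_def] using m
    by (intro holomorphic_intros holomorphic_hurwitz_reg) auto
qed

lemma holomorphic_hurwitz_reg_reflected:
  assumes v: "v > 0"
  shows "(\<lambda>s. hurwitz_reg v (1 - s)) holomorphic_on {s. Re s < 2}"
proof -
  have "hurwitz_reg v \<circ> (\<lambda>s. 1 - s) holomorphic_on {s. Re s < 2}"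
    by (rule holomorphic_on_compose_gen[OF _ holomorphic_hurwitz_reg[OF v]]) (auto intro!: holomorphic_intros)
  thus ?thesis by (simp add: o_def)
qed

text \<open>Each exponential of the cosine separates into a phase in s and the l-th power of a root
  of unity. The inverse of the root for r is written as the root for m - r, so that
  \<open>periodic_reg_reflection\<close> covers both.\<close>

lemma functional_rhs_conv_periodic_reg:
  assumes r: "r \<le> m" and m: "m > 0"
  shows "functional_rhs m r s = Gamma (1 + s) * of_real (2 * pi) powr (-s) *
     (exp (- (\<i> * (of_real (pi / 2) * s))) * periodic_reg m (exp (2 * of_real pi * \<i> * of_real (real r / real m))) s +
      exp (\<i> * (of_real (pi / 2) * s)) * periodic_reg m (exp (2 * of_real pi * \<i> * of_real (real (m - r) / real m))) s)"
proof -
  define q where "q = \<i> * (of_real (pi / 2) * s)"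
  define z z' where "z = exp (2 * of_real pi * \<i> * of_real (real r / real m))"
    and "z' = exp (2 * of_real pi * \<i> * of_real (real (m - r) / real m))"
  have "2 * cos (of_real (pi / 2) * s - of_real (2 * pi * real r * real l / real m)) =
        exp (- q) * z ^ l + exp q * z' ^ l" for l
  proof -
    define x where "x = complex_of_real (2 * pi * real r * real l / real m)"
    have z: "z ^ l = exp (\<i> * x)"
      unfolding z_def x_def by (subst exp_of_nat_mult [symmetric]) (simp add: mult_ac)
    have "z' ^ l = exp (of_nat l * (2 * of_real pi * \<i> * of_real (real (m - r) / real m)))"
      unfolding z'_def by (rule exp_of_nat_mult [symmetric])
    also have "of_nat l * (2 * of_real pi * \<i> * of_real (real (m - r) / real m)) = (2 * of_nat l * of_real pi) * \<i> + - (\<i> * x)"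
      using r m by (simp add: x_def of_nat_diff field_simps)
    also have "exp \<dots> = exp ((2 * of_nat l * of_real pi) * \<i>) * exp (- (\<i> * x))" by (rule exp_add)
    also have "exp ((2 * of_nat l * complex_of_real pi) * \<i>) = 1" by (subst exp_eq_1) (auto intro!: exI[of _ "int l"])
    finally have z': "z' ^ l = exp (- (\<i> * x))" by simp
    have "2 * cos (of_real (pi / 2) * s - x) = exp (q - \<i> * x) + exp (- (q - \<i> * x))"
      unfolding cos_exp_eq q_def by (simp add: algebra_simps)
    also have "\<dots> = exp (- q) * exp (\<i> * x) + exp q * exp (- (\<i> * x))"
      by (simp flip: exp_add)
    finally show ?thesis unfolding z z' x_def .
  qed
  hence c: "2 * (cos (of_real (pi / 2) * s - of_real (2 * pi * real r * real l / real m)) * h) =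
     exp (- q) * (z ^ l * h) + exp q * (z' ^ l * h)" for l h
    by (simp only: mult.assoc [symmetric] distrib_right [symmetric])
  define S where "S = (\<Sum>l=1..m. cos (of_real (pi / 2) * s - of_real (2 * pi * real r * real l / real m)) * hurwitz_reg (real l / real m) s)"
  define A B where "A = (\<Sum>l=1..m. z ^ l * hurwitz_reg (real l / real m) s)"
    and "B = (\<Sum>l=1..m. z' ^ l * hurwitz_reg (real l / real m) s)"
  have "2 * S = exp (- q) * A + exp q * B"
    unfolding S_def A_def B_def by (simp only: sum_distrib_left c sum.distrib)
  moreover have "complex_of_real (2 * pi * real m) powr (-s) = of_real (2 * pi) powr (-s) * of_nat m powr (-s)"
    using powr_times_real[of "of_real (2 * pi)" "of_nat m" "-s"] by simp
  moreover have "2 * g * (p * p') * S = g * p * (e * (p' * A) + e' * (p' * B))" if "2 * S = e * A + e' * B"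
    for g p p' e e' :: complex
  proof -
    have "2 * g * (p * p') * S = g * p * (p' * (2 * S))" by simp
    thus ?thesis unfolding that by (simp add: distrib_left mult.left_commute)
  qed
  ultimately show ?thesis
    unfolding functional_rhs_def periodic_reg_def q_def[symmetric] z_def[symmetric] z'_def[symmetric]
      S_def[symmetric] A_def[symmetric] B_def[symmetric] by (simp only:)
qed

lemma hurwitz_functional_proper:
  assumes r: "0 < r" "r < m" and s: "-1 < Re s" "Re s < 2"
  shows "(1 - s) * hurwitz_reg (real r / real m) (1 - s) = functional_rhs m r s"
proof (rule holomorphic_eq_on_strip[OF _ _ _ s])
  have m: "m > 0" using r by auto
  show "(\<lambda>s. (1 - s) * hurwitz_reg (real r / real m) (1 - s)) holomorphic_on {s. - 1 < Re s \<and> Re s < 2}"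
    using r by (intro holomorphic_intros holomorphic_on_subset[OF holomorphic_hurwitz_reg_reflected]) auto
  show "functional_rhs m r holomorphic_on {s. - 1 < Re s \<and> Re s < 2}"
    by (rule holomorphic_on_subset[OF holomorphic_functional_rhs[OF m]]) auto
next
  fix s :: real assume s: "-1 < s" "s < 0"
  have m: "m > 0" using r by auto
  define A B where "A = hurwitz_reg (real r / real m) (1 - of_real s)" and "B = hurwitz_reg (1 - real r / real m) (1 - of_real s)"
  define K where "K = complex_of_real (Gamma (1 - s) * (2 * pi) powr (s - 1))"
  define q where "q = exp (\<i> * (of_real (pi / 2) * complex_of_real s))"
  define q' where "q' = exp (- (\<i> * (of_real (pi / 2) * complex_of_real s)))"
  define P where "P = (\<lambda>r. periodic_reg m (exp (2 * of_real pi * \<i> * of_real (real r / real m))) (of_real s))"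
  have qq: "q * q' = 1" by (simp add: q_def q'_def flip: exp_add)
  have ei: "exp (\<i> * complex_of_real (pi / 2)) = \<i>" "exp (- (\<i> * complex_of_real (pi / 2))) = - \<i>"
    unfolding exp_minus cis_conv_exp [symmetric] cis_pi_half by simp_all
  have E: "exp (- (\<i> * complex_of_real (pi / 2 * (s - 1)))) = \<i> * q'" "exp (\<i> * complex_of_real (pi / 2 * (s - 1))) = - \<i> * q"
  proof -
    have "- (\<i> * complex_of_real (pi / 2 * (s - 1))) = \<i> * of_real (pi / 2) + - (\<i> * (of_real (pi / 2) * complex_of_real s))"
      by (simp add: field_simps)
    hence "exp (- (\<i> * complex_of_real (pi / 2 * (s - 1)))) = exp (\<i> * of_real (pi / 2)) * q'"
      unfolding q'_def by (simp only: exp_add)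
    thus "exp (- (\<i> * complex_of_real (pi / 2 * (s - 1)))) = \<i> * q'" unfolding ei .
    have "\<i> * complex_of_real (pi / 2 * (s - 1)) = - (\<i> * of_real (pi / 2)) + \<i> * (of_real (pi / 2) * complex_of_real s)"
      by (simp add: field_simps)
    hence "exp (\<i> * complex_of_real (pi / 2 * (s - 1))) = exp (- (\<i> * of_real (pi / 2))) * q"
      unfolding q_def by (simp only: exp_add)
    thus "exp (\<i> * complex_of_real (pi / 2 * (s - 1))) = - \<i> * q" unfolding ei .
  qed
  have sin2: "\<i> * (q'\<^sup>2 - q\<^sup>2) = 2 * of_real (sin (pi * s))"
  proof -
    have "q\<^sup>2 = exp (\<i> * of_real (pi * s))" "q'\<^sup>2 = exp (- (\<i> * of_real (pi * s)))"
      unfolding q_def q'_def exp_double [symmetric] by simp_all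
    hence "complex_of_real (sin (pi * s)) = (q\<^sup>2 - q'\<^sup>2) / (2 * \<i>)"
      unfolding sin_of_real[symmetric] sin_exp_eq by simp
    hence "2 * complex_of_real (sin (pi * s)) = - (\<i> * (q\<^sup>2 - q'\<^sup>2))" by simp
    thus ?thesis by (simp add: right_diff_distrib)
  qed
  have P1: "P r * of_real s = (1 - of_real s) * K * (\<i> * q' * A + - \<i> * q * B)"
    using periodic_reg_reflection[OF r s] unfolding P_def A_def B_def K_def E .
  have "real (m - r) / real m = 1 - real r / real m" "1 - real (m - r) / real m = real r / real m"
    using r by (auto simp: of_nat_diff field_simps)
  hence P2: "P (m - r) * of_real s = (1 - of_real s) * K * (\<i> * q' * B + - \<i> * q * A)"
    using periodic_reg_reflection[of "m - r" m s] r s unfolding P_def A_def B_def K_def E by simp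
  \<comment> \<open>With the weights q' and q the contributions of B cancel, since q q' occurs with
    both signs, while A keeps the factor i (q'^2 - q^2) = 2 sin (pi s).\<close>
  have "(q' * P r + q * P (m - r)) * of_real s = q' * (P r * of_real s) + q * (P (m - r) * of_real s)"
    by (simp add: algebra_simps)
  also have "\<dots> = (1 - of_real s) * K * ((\<i> * (q'\<^sup>2 - q\<^sup>2)) * A)"
    unfolding P1 P2 using qq by (simp add: algebra_simps power2_eq_square)
  also have "\<dots> = (1 - of_real s) * A * of_real (Gamma (1 - s) * (2 * pi) powr (s - 1) * (2 * sin (pi * s)))"
    unfolding sin2 K_def by simp
  finally have eq: "(q' * P r + q * P (m - r)) * of_real s =
      (1 - of_real s) * A * of_real (Gamma (1 - s) * (2 * pi) powr (s - 1) * (2 * sin (pi * s)))" .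
  have GG: "Gamma (1 + complex_of_real s) = of_real (Gamma (1 + s))"
    using Gamma_complex_of_real[of "1 + s"] by simp
  have pp: "complex_of_real (2 * pi) powr (- of_real s) = of_real ((2 * pi) powr (- s))"
    using powr_of_real[of "2 * pi" "- s"] by simp
  have "functional_rhs m r (of_real s) * of_real s = of_real (Gamma (1 + s) * (2 * pi) powr (- s)) *
      ((q' * P r + q * P (m - r)) * of_real s)"
  proof -
    have "functional_rhs m r (of_real s) = Gamma (1 + of_real s) * of_real (2 * pi) powr (- of_real s) * (q' * P r + q * P (m - r))"
      unfolding P_def q_def q'_def using r by (intro functional_rhs_conv_periodic_reg) auto
    thus ?thesis unfolding GG pp by simp
  qed
  \<comment> \<open>Here Gamma(1+s) Gamma(1-s) sin(pi s) = pi s, the factor 2 and the powers of 2 pi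
    collapse to s, which cancels the s multiplied in on the left.\<close>
  also have "\<dots> = (1 - of_real s) * A * of_real ((Gamma (1 + s) * Gamma (1 - s) * sin (pi * s)) * 2 * ((2 * pi) powr (- s) * (2 * pi) powr (s - 1)))"
    unfolding eq by (simp add: mult_ac)
  also have "(2 * pi) powr (- s) * (2 * pi) powr (s - 1) = 1 / (2 * pi)"
    by (simp only: powr_add [symmetric]) (simp add: powr_minus_divide)
  also have "(Gamma (1 + s) * Gamma (1 - s) * sin (pi * s)) * 2 * (1 / (2 * pi)) = s"
    unfolding Gamma_reflection_real_shift[OF s] by simp
  finally show "(1 - of_real s) * hurwitz_reg (real r / real m) (1 - of_real s) = functional_rhs m r (of_real s)"
    using s by (simp add: A_def)
qed

text \<open>The root of unity 1 is out of reach of the Mellin kernel, so the case m = 2, r = 1 is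
  used: zeta(s,1/2) = (2^s - 1) zeta(s) makes both sides multiples of those claimed, with the same
  factor (2 - y)/y for y = 2^s, which is nonzero on the seed interval.\<close>

lemma riemann_functional:
  assumes s: "-1 < Re s" "Re s < 2"
  shows "(1 - s) * hurwitz_reg 1 (1 - s) =
     2 * Gamma (1 + s) * of_real (2 * pi) powr (-s) * cos (of_real (pi / 2) * s) * hurwitz_reg 1 s"
proof (rule holomorphic_eq_on_strip[OF _ _ _ s])
  show "(\<lambda>s. (1 - s) * hurwitz_reg 1 (1 - s)) holomorphic_on {s. - 1 < Re s \<and> Re s < 2}"
    by (intro holomorphic_intros holomorphic_on_subset[OF holomorphic_hurwitz_reg_reflected]) auto
  have "1 + s \<notin> \<int>\<^sub>\<le>\<^sub>0" if "Re s > -1" for s :: complex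
    using that by (auto elim!: nonpos_Ints_cases simp: complex_eq_iff)
  thus "(\<lambda>s. 2 * Gamma (1 + s) * of_real (2 * pi) powr (-s) * cos (of_real (pi / 2) * s) * hurwitz_reg 1 s)
          holomorphic_on {s. - 1 < Re s \<and> Re s < 2}"
    by (intro holomorphic_intros holomorphic_on_subset[OF holomorphic_hurwitz_reg]) auto
next
  fix x :: real assume x: "-1 < x" "x < 0"
  define s where "s = complex_of_real x"
  have s: "-1 < Re s" "Re s < 2" "Re (1 - s) > -1" using x by (auto simp: s_def)
  have half: "hurwitz_reg (1 / 2) w = (2 powr w - 1) * hurwitz_reg 1 w" if "Re w > -1" for w
    using hurwitz_reg_multiplication[of 2 w] that by (simp add: numeral_2_eq_2 algebra_simps)
  define y where "y = (2::complex) powr s"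
  have y: "y = of_real (2 powr x)" "y \<noteq> 0" unfolding y_def s_def using powr_of_real[of 2 x] by auto
  have "2 powr x < (2 :: real) powr 1" using x by (intro powr_less_mono) auto
  hence y2: "2 - y \<noteq> 0" unfolding y by (auto simp: complex_eq_iff)
  have "(1 - s) * hurwitz_reg (real 1 / real 2) (1 - s) = functional_rhs 2 1 s"
    using s by (intro hurwitz_functional_proper) auto
  also have "functional_rhs 2 1 s = 2 * Gamma (1 + s) * (of_real (2 * pi) powr (-s) * (1 / y)) * cos (of_real (pi / 2) * s) * ((2 - y) * hurwitz_reg 1 s)"
  proof -
    have p: "complex_of_real (2 * pi * real 2) powr (-s) = of_real (2 * pi) powr (-s) * (1 / y)"
      using powr_times_real[of "of_real (2 * pi)" 2 "-s"] by (simp add: y_def powr_minus_divide)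
    have r: "2 * pi * real 1 * real 1 / real 2 = pi" "2 * pi * real 1 * real 2 / real 2 = 2 * pi" "real 2 / real 2 = 1"
      by simp_all
    have c: "cos (of_real (pi / 2) * s - of_real pi) = - cos (of_real (pi / 2) * s)"
      "cos (of_real (pi / 2) * s - of_real (2 * pi)) = cos (of_real (pi / 2) * s)"
      unfolding cos_diff cos_of_real sin_of_real by simp_all
    have h: "hurwitz_reg (real 1 / real 2) s = (y - 1) * hurwitz_reg 1 s"
      using half[of s] s by (simp add: y_def)
    have sum2: "(\<Sum>l=1..2. f l) = f 1 + f (2::nat)" for f :: "nat \<Rightarrow> complex" by (simp add: numeral_2_eq_2)
    have "g * (- c * ((y - 1) * h) + c * h) = g * c * ((2 - y) * h)" for g c h
      by (simp add: algebra_simps)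
    thus ?thesis
      unfolding functional_rhs_def sum2 p r c h .
  qed
  also have "hurwitz_reg (real 1 / real 2) (1 - s) = (2 - y) / y * hurwitz_reg 1 (1 - s)"
    using half[of "1 - s"] s y(2) by (simp add: y_def powr_diff diff_divide_distrib)
  finally have "(2 - y) / y * ((1 - s) * hurwitz_reg 1 (1 - s)) =
     (2 - y) / y * (2 * Gamma (1 + s) * of_real (2 * pi) powr (-s) * cos (of_real (pi / 2) * s) * hurwitz_reg 1 s)"
    by (simp add: mult_ac)
  moreover have "(2 - y) / y \<noteq> 0" using y y2 by simp
  ultimately show "(1 - of_real x) * hurwitz_reg 1 (1 - of_real x) =
     2 * Gamma (1 + of_real x) * of_real (2 * pi) powr (- of_real x) * cos (of_real (pi / 2) * of_real x) * hurwitz_reg 1 (of_real x)"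
    unfolding s_def using mult_left_cancel by blast
qed

text \<open>For r = m all cosines coincide and the multiplication formula reduces the sum to
  zeta(s), where Riemann's equation applies. This case brings the parameter 1 under the same
  statement.\<close>

lemma hurwitz_functional:
  assumes r: "0 < r" "r \<le> m" and s: "-1 < Re s" "Re s < 2"
  shows "(1 - s) * hurwitz_reg (real r / real m) (1 - s) = functional_rhs m r s"
proof (cases "r < m")
  case True
  thus ?thesis using r s by (intro hurwitz_functional_proper) auto
next
  case False
  hence [simp]: "r = m" and m: "m > 0" using r by auto
  have c: "cos (of_real (pi / 2) * s - of_real (2 * pi * real m * real l / real m)) = cos (of_real (pi / 2) * s)" for l
  proof -
    have "2 * pi * real m * real l / real m = real l * (2 * pi)" using m by simp
    moreover have "cos (real l * (2 * pi)) = 1" "sin (real l * (2 * pi)) = 0"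
      by (metis cos_int_2pin mult.commute of_int_of_nat_eq, metis sin_int_2pin mult.commute of_int_of_nat_eq)
    ultimately show ?thesis unfolding cos_diff cos_of_real sin_of_real by simp
  qed
  have "functional_rhs m r s = 2 * Gamma (1 + s) * of_real (2 * pi * real m) powr (-s) * (cos (of_real (pi / 2) * s) *
           (\<Sum>l=1..m. hurwitz_reg (real l / real m) s))"
    unfolding functional_rhs_def \<open>r = m\<close> c sum_distrib_left [symmetric] ..
  also have "complex_of_real (2 * pi * real m) powr (-s) = of_real (2 * pi) powr (-s) / of_nat m powr s"
    using powr_times_real[of "of_real (2 * pi)" "of_nat m" "-s"] by (simp add: powr_minus_divide)
  finally show ?thesis
    using riemann_functional[OF s] hurwitz_reg_multiplication[OF m s(1)] m by simp
qed

section \<open>Continuation to the whole plane and Stieltjes constants\<close>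

text \<open>The difference is meromorphic and vanishes near one point, hence off a sparse set. At
  the exceptional points niceness decides: common poles carry the value 0, elsewhere both values are
  limits, and these agree.\<close>

lemma nicely_meromorphic_eqI:
  assumes f: "f nicely_meromorphic_on UNIV" and g: "g nicely_meromorphic_on UNIV"
    and ev: "eventually (\<lambda>z. f z = g z) (at z0)"
  shows "f = g"
proof -
  have "(\<lambda>z. f z - g z) meromorphic_on UNIV"
    using f g by (intro meromorphic_intros) (auto simp: nicely_meromorphic_on_def)
  hence "eventually (\<lambda>z. f z - g z = 0) (cosparse UNIV) \<or> eventually (\<lambda>z. f z - g z \<noteq> 0) (cosparse UNIV)"
    by (rule meromorphic_imp_constant_or_avoid) auto
  moreover have "\<not> eventually (\<lambda>z. f z - g z \<noteq> 0) (cosparse UNIV)"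
  proof
    assume "eventually (\<lambda>z. f z - g z \<noteq> 0) (cosparse UNIV)"
    hence "eventually (\<lambda>z. f z - g z \<noteq> 0) (at z0)"
      by (rule eventually_cosparse_imp_eventually_at) auto
    hence "eventually (\<lambda>z. False) (at z0)"
      using ev by eventually_elim auto
    thus False by simp
  qed
  ultimately have eq: "eventually (\<lambda>z. f z - g z = 0) (cosparse UNIV)" by blast
  show "f = g"
  proof
    fix z
    have "eventually (\<lambda>z. f z - g z = 0) (at z)"
      using eq by (rule eventually_cosparse_imp_eventually_at) auto
    hence ev: "eventually (\<lambda>z. f z = g z) (at z)" by eventually_elim auto
    hence pole: "is_pole f z \<longleftrightarrow> is_pole g z" by (intro is_pole_cong) auto
    have lim: "f \<midarrow>z\<rightarrow> c \<longleftrightarrow> g \<midarrow>z\<rightarrow> c" for c using ev by (intro tendsto_cong)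
    have "\<not> (is_pole f z \<and> f \<midarrow>z\<rightarrow> c)" for c
      unfolding is_pole_def using not_tendsto_and_filterlim_at_infinity[of "at z" f] by auto
    moreover have "(is_pole f z \<and> f z = 0) \<or> f \<midarrow>z\<rightarrow> f z" "(is_pole g z \<and> g z = 0) \<or> g \<midarrow>z\<rightarrow> g z"
      using f g by (auto simp: nicely_meromorphic_on_def)
    ultimately show "f z = g z"
      using pole lim LIM_unique by metis
  qed
qed

lemma is_hurwitz_continuation_unique:
  assumes "is_hurwitz_continuation v f" "is_hurwitz_continuation v g"
  shows "f = g"
proof (rule nicely_meromorphic_eqI)
  have "eventually (\<lambda>s. s \<in> {s. Re s > 1}) (nhds (2::complex))"
    by (intro eventually_nhds_in_open open_halfspace_Re_gt) auto
  hence "eventually (\<lambda>s. f s = g s) (nhds 2)"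
    by eventually_elim (use assms in \<open>auto simp: is_hurwitz_continuation_def intro: sums_unique2\<close>)
  thus "eventually (\<lambda>s. f s = g s) (at 2)" by (simp add: eventually_at_filter eventually_mono)
qed (use assms in \<open>auto simp: is_hurwitz_continuation_def\<close>)

text \<open>The formula by \<open>hurwitz_reg\<close> and the functional equation with 1 - s in
  place of s agree on the overlap -1 < Re s < 0, so they glue to a function analytic off 1. The
  value 0 at the pole is what nice meromorphy prescribes.\<close>

lemma is_hurwitz_continuation_rational:
  assumes r: "0 < r" "r \<le> m"
  defines "v \<equiv> real r / real m"
  shows "is_hurwitz_continuation v (\<lambda>s. if s = 1 then 0 else
           if Re s > -1 then hurwitz_reg v s / (s - 1) else functional_rhs m r (1 - s) / (s * (s - 1)))"
    (is "is_hurwitz_continuation v ?F")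
proof -
  have m: "m > 0" and v: "v > 0" using r by (auto simp: v_def)
  have "?F holomorphic_on {s. Re s > -1} - {1} \<longleftrightarrow> (\<lambda>s. hurwitz_reg v s / (s - 1)) holomorphic_on {s. Re s > -1} - {1}"
    by (intro holomorphic_cong) auto
  also have \<dots>
    by (intro holomorphic_intros holomorphic_on_subset[OF holomorphic_hurwitz_reg[OF v]]) auto
  finally have h1: "?F holomorphic_on {s. Re s > -1} - {1}" .
  have "?F holomorphic_on {s. Re s < 0} \<longleftrightarrow> (\<lambda>s. functional_rhs m r (1 - s) / (s * (s - 1))) holomorphic_on {s. Re s < 0}"
  proof (intro holomorphic_cong refl)
    fix s assume s: "s \<in> {s. Re s < 0}"
    show "?F s = functional_rhs m r (1 - s) / (s * (s - 1))"
    proof (cases "Re s > -1")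
      case True
      have "s * hurwitz_reg v s = functional_rhs m r (1 - s)"
        using hurwitz_functional[OF r, of "1 - s"] s True by (simp add: v_def)
      moreover have "s \<noteq> 0" "s \<noteq> 1" using s by auto
      ultimately show ?thesis using True by (simp add: field_simps)
    qed (use s in auto)
  qed
  also have \<dots>
  proof -
    have "functional_rhs m r \<circ> (\<lambda>s. 1 - s) holomorphic_on {s. Re s < 0}"
      by (rule holomorphic_on_compose_gen[OF _ holomorphic_functional_rhs[OF m]]) (auto intro!: holomorphic_intros)
    thus ?thesis by (intro holomorphic_intros) (auto simp: o_def)
  qed
  finally have h2: "?F holomorphic_on {s. Re s < 0}" .
  have op: "open ({s. Re s > -1} - {1})" "open {s. Re s < 0}"
    by (auto intro!: open_Diff open_halfspace_Re_gt open_halfspace_Re_lt)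
  have "?F analytic_on ({s. Re s > -1} - {1}) \<union> {s. Re s < 0}"
    using h1 h2 op by (simp only: analytic_on_Un analytic_on_open)
  also have "({s. Re s > -1} - {1}) \<union> {s. Re s < 0} = UNIV - {1}" by force
  finally have an: "?F analytic_on UNIV - {1}" .
  have "is_pole (\<lambda>s. hurwitz_reg v s / (s - 1)) 1"
  proof (rule is_pole_divide)
    have "isCont (hurwitz_reg v) 1"
      using holomorphic_on_imp_continuous_on[OF holomorphic_hurwitz_reg[OF v]]
      by (rule continuous_on_interior) (simp add: interior_open open_halfspace_Re_gt)
    thus "isCont (hurwitz_reg v) 1" .
    show "filterlim (\<lambda>s. s - 1) (at 0) (at (1::complex))"
      by (auto simp: filterlim_at eventually_at_filter intro!: tendsto_eq_intros)
    show "hurwitz_reg v 1 \<noteq> 0" using hurwitz_reg_1[OF v] by simp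
  qed
  moreover have "eventually (\<lambda>s. s \<in> {s. Re s > -1}) (nhds (1::complex))"
    by (intro eventually_nhds_in_open open_halfspace_Re_gt) auto
  hence ev: "eventually (\<lambda>s. ?F s = hurwitz_reg v s / (s - 1)) (at 1)"
    unfolding eventually_at_filter by eventually_elim auto
  ultimately have pole: "is_pole ?F 1" by (subst is_pole_cong[OF ev refl])
  have "?F nicely_meromorphic_on UNIV"
  proof (rule nicely_meromorphic_onI_open[where pts = "{1}"])
    fix z :: complex
    have "?F holomorphic_on UNIV - {1}" using an by (rule analytic_imp_holomorphic)
    hence "isolated_singularity_at ?F 1" by (intro isolated_singularity_at_holomorphic[where s = UNIV]) auto
    moreover have "isolated_singularity_at ?F z" if "z \<noteq> 1"
      using an that by (intro isolated_singularity_at_analytic) (auto intro: analytic_on_subset)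
    ultimately show "isolated_singularity_at ?F z" by (cases "z = 1") auto
  qed (use an pole in auto)
  moreover have "(\<lambda>n. complex_of_real (real n + v) powr (- s)) sums ?F s" if "Re s > 1" for s
    using hurwitz_sums[OF v that] that by auto
  ultimately show ?thesis by (simp only: is_hurwitz_continuation_def) blast
qed

lemma hurwitz_zeta_eq:
  assumes r: "0 < r" "r \<le> m" and s: "Re s > -1" "s \<noteq> 1"
  shows "hurwitz_zeta s (real r / real m) = hurwitz_reg (real r / real m) s / (s - 1)"
proof -
  note cont = is_hurwitz_continuation_rational[OF r]
  have "(THE f. is_hurwitz_continuation (real r / real m) f) = (\<lambda>s. if s = 1 then 0 else
           if Re s > -1 then hurwitz_reg (real r / real m) s / (s - 1) else functional_rhs m r (1 - s) / (s * (s - 1)))"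
    using cont is_hurwitz_continuation_unique[OF _ cont] by (rule the_equality)
  thus ?thesis using s by (simp add: hurwitz_zeta_def)
qed

lemma eventually_hurwitz_zeta_eq:
  assumes r: "0 < r" "r \<le> m"
  shows "eventually (\<lambda>s. hurwitz_zeta s (real r / real m) = hurwitz_reg (real r / real m) s / (s - 1)) (nhds 0)"
proof -
  have "eventually (\<lambda>s. s \<in> {s. Re s > -1} - {1}) (nhds (0::complex))"
    by (intro eventually_nhds_in_open open_Diff open_halfspace_Re_gt) auto
  thus ?thesis by eventually_elim (use hurwitz_zeta_eq[OF r] in auto)
qed

text \<open>For w = s - 1, hurwitz_reg v (1 + w) = w zeta(1 + w, v), so the Laurent coefficient of
  index n is the Taylor coefficient of index n + 1. Passing from w to -w contributes (-1)^(n+1),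
  which meets the (-1)^n of the definition and leaves a bare minus sign.\<close>

lemma gen_stieltjes_eq:
  assumes r: "0 < r" "r \<le> m"
    and R: "(\<lambda>s. hurwitz_reg (real r / real m) (1 - s)) has_fps_expansion R"
  shows "gen_stieltjes n (real r / real m) = - (fact n * fps_nth R (Suc n))"
proof -
  define v where "v = real r / real m"
  have "((\<lambda>s. hurwitz_reg v (1 - s)) \<circ> (\<lambda>w. - w)) has_fps_expansion fps_compose R (- fps_X)"
    using R unfolding v_def by (intro has_fps_expansion_compose has_fps_expansion_minus has_fps_expansion_fps_X) auto
  hence "(\<lambda>w. hurwitz_reg v (1 + w)) has_laurent_expansion fps_to_fls (fps_compose R (- fps_X))"
    by (intro has_laurent_expansion_fps) (simp add: o_def)
  hence "(\<lambda>w. hurwitz_reg v (1 + w) * inverse w) has_laurent_expansion fps_to_fls (fps_compose R (- fps_X)) * fls_X_inv"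
    by (intro has_laurent_expansion_mult has_laurent_expansion_fls_X_inv)
  moreover have "eventually (\<lambda>w. w \<in> {w. Re w > -2}) (nhds (0::complex))"
    by (intro eventually_nhds_in_open open_halfspace_Re_gt) auto
  hence ev: "eventually (\<lambda>w. hurwitz_zeta (1 + w) v = hurwitz_reg v (1 + w) * inverse w) (at 0)"
    unfolding eventually_at_filter v_def
    by eventually_elim (use hurwitz_zeta_eq[OF r] in \<open>auto simp: divide_inverse\<close>)
  ultimately have "(\<lambda>w. hurwitz_zeta (1 + w) v) has_laurent_expansion fps_to_fls (fps_compose R (- fps_X)) * fls_X_inv"
    by (subst has_laurent_expansion_cong[OF ev refl])
  hence "laurent_expansion (\<lambda>s. hurwitz_zeta s v) 1 = fps_to_fls (fps_compose R (- fps_X)) * fls_X_inv"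
    by (rule laurent_expansion_eqI)
  hence "fls_nth (laurent_expansion (\<lambda>s. hurwitz_zeta s v) 1) (int n) = fps_nth (fps_compose R (- fps_X)) (Suc n)"
    by (simp add: fls_X_inv_times_conv_shift nat_add_distrib)
  also have "\<dots> = (-1) ^ Suc n * fps_nth R (Suc n)"
    by (simp add: fps_compose_uminus')
  finally show ?thesis
    unfolding gen_stieltjes_def v_def by (simp add: power_mult_distrib [symmetric] flip: power_mult)
qed

section \<open>Expansions at the origin\<close>

text \<open>The constant is read off at v = 1/2: the derivative of (2^s - 1) zeta(s) at 0 is zeta(0)
  ln 2, that is minus half of ln 2, while ln Gamma(1/2) is half of ln pi.\<close>

lemma lerch_deriv_0:
  assumes v: "v > 0"
  shows "((\<lambda>s. hurwitz_reg v s / (s - 1)) has_field_derivative of_real (ln (Gamma v) - ln (2 * pi) / 2)) (at 0)"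
proof -
  define Z where "Z = (\<lambda>v s. hurwitz_reg v s / (s - 1))"
  obtain \<kappa> where \<kappa>: "\<And>v. v > 0 \<Longrightarrow> (Z v has_field_derivative of_real (ln (Gamma v) + \<kappa>)) (at 0)"
    using hurwitz_reg_deriv_0 unfolding Z_def by metis
  have D1: "((\<lambda>s. (2 powr s - 1) * Z 1 s) has_field_derivative of_real (- ln 2 / 2)) (at 0)"
  proof -
    have "((\<lambda>s. (2::complex) powr s - 1) has_field_derivative of_real (ln 2)) (at 0)"
      using DERIV_diff[OF has_field_derivative_powr_right[of 2 0] DERIV_const[of 1]] Ln_of_real[of 2] by simp
    from DERIV_mult[OF this \<kappa>[of 1]] show ?thesis by (simp add: Z_def hurwitz_reg_0)
  qed
  have "eventually (\<lambda>s. s \<in> {s. Re s > -1}) (nhds (0::complex))"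
    by (intro eventually_nhds_in_open open_halfspace_Re_gt) auto
  hence ev: "eventually (\<lambda>s. Z (1 / 2) s = (2 powr s - 1) * Z 1 s) (nhds 0)"
  proof eventually_elim
    case (elim s)
    hence "hurwitz_reg (1 / 2) s = (2 powr s - 1) * hurwitz_reg 1 s"
      using hurwitz_reg_multiplication[of 2 s] by (simp add: numeral_2_eq_2 algebra_simps)
    thus ?case by (simp add: Z_def)
  qed
  have "(Z (1 / 2) has_field_derivative of_real (- ln 2 / 2)) (at 0)"
    using D1 by (subst DERIV_cong_ev[OF refl ev refl])
  with \<kappa>[of "1/2"] have "complex_of_real (ln (Gamma (1 / 2)) + \<kappa>) = of_real (- ln 2 / 2)"
    using DERIV_unique by fastforce
  hence "ln (Gamma (1 / 2)) + \<kappa> = - ln 2 / 2" by (simp only: of_real_eq_iff)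
  hence "\<kappa> = - ln (2 * pi) / 2"
    by (simp add: Gamma_one_half_real ln_sqrt ln_mult)
  thus ?thesis using \<kappa>[OF v] by (simp add: Z_def)
qed

section \<open>Taylor coefficients of Gamma at 1\<close>

lemma Polygamma_1_1: "Polygamma 1 (1 :: complex) = of_real (pi\<^sup>2 / 6)"
proof -
  have "(\<lambda>n. complex_of_real (1 / (real n + 1)\<^sup>2)) sums of_real (pi\<^sup>2 / 6)"
    using inverse_squares_sums by (intro sums_of_real) (simp add: add.commute)
  moreover have "(\<lambda>n. complex_of_real (1 / (real n + 1)\<^sup>2)) sums Polygamma 1 1"
    using Polygamma_LIMSEQ[of "1::complex" 1] by (simp add: divide_inverse add.commute power2_eq_square)
  ultimately show ?thesis by (rule sums_unique2[symmetric])
qed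

lemma Gamma_fps_coeffs:
  fixes F :: "complex fps"
  assumes F: "(\<lambda>s. Gamma (1 + s)) has_fps_expansion F"
  shows "fps_nth F 0 = 1" "fps_nth F 1 = - euler_mascheroni"
    "fps_nth F 2 = (euler_mascheroni\<^sup>2 + of_real (pi\<^sup>2 / 6)) / 2"
proof -
  show "fps_nth F 0 = 1" using has_fps_expansion_imp_0_eq_fps_nth_0[OF F] by simp
  have D: "((\<lambda>s. Gamma (1 + s)) has_field_derivative Gamma (1 + s) * Digamma (1 + s)) (at s)"
    if "1 + s \<notin> \<int>\<^sub>\<le>\<^sub>0" for s :: complex
    using that by (auto intro!: derivative_eq_intros)
  have "fps_nth F 1 = deriv (\<lambda>s. Gamma (1 + s)) 0" using fps_nth_fps_expansion[OF F, of 1] by simp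
  also have "\<dots> = - euler_mascheroni" using DERIV_imp_deriv[OF D[of 0]] by simp
  finally show "fps_nth F 1 = - euler_mascheroni" .
  have "eventually (\<lambda>s. s \<in> {s. Re s > -1}) (nhds (0::complex))"
    by (intro eventually_nhds_in_open open_halfspace_Re_gt) auto
  hence "eventually (\<lambda>s. deriv (\<lambda>s. Gamma (1 + s)) s = Gamma (1 + s) * Digamma (1 + s)) (nhds (0::complex))"
  proof eventually_elim
    case (elim s)
    hence "1 + s \<notin> \<int>\<^sub>\<le>\<^sub>0" by (auto elim!: nonpos_Ints_cases simp: complex_eq_iff)
    thus ?case by (intro DERIV_imp_deriv D)
  qed
  hence "(deriv ^^ 2) (\<lambda>s. Gamma (1 + s)) 0 = deriv (\<lambda>s. Gamma (1 + s) * Digamma (1 + s)) (0::complex)"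
    by (simp add: numeral_2_eq_2 deriv_cong_ev)
  also have "\<dots> = euler_mascheroni\<^sup>2 + of_real (pi\<^sup>2 / 6)"
    by (rule DERIV_imp_deriv) (auto intro!: derivative_eq_intros simp: Polygamma_1_1[unfolded One_nat_def] power2_eq_square)
  finally show "fps_nth F 2 = (euler_mascheroni\<^sup>2 + of_real (pi\<^sup>2 / 6)) / 2"
    using fps_nth_fps_expansion[OF F, of 2] by (simp add: numeral_2_eq_2)
qed

section \<open>Finite sums over roots of unity\<close>

lemma sum_index_times_power:
  fixes w :: "'a :: comm_ring_1"
  shows "(w - 1) * (\<Sum>l<n. of_nat l * w ^ l) = of_nat n * w ^ n - w * (\<Sum>l<n. w ^ l)"
  by (induction n) (auto simp: algebra_simps)

text \<open>Real and imaginary parts of the sums of w^l and l w^l for w = exp(2 pi i r/m). Over 0 <=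
  l < m they are 0 and m/(w - 1), and 1/(w - 1) = -1/2 - (i/2) cot x with x = pi r/m, because w - 1
  = 2 i sin x exp(i x).\<close>

lemma trig_sums:
  fixes m r :: nat
  assumes r: "0 < r" "r < m"
  shows "(\<Sum>l=1..m - 1. cos (2 * pi * real r * real l / real m)) = -1"
    and "(\<Sum>l=1..m - 1. sin (2 * pi * real r * real l / real m)) = 0"
    and "(\<Sum>l=1..m - 1. real l / real m * cos (2 * pi * real r * real l / real m)) = - 1 / 2"
    and "(\<Sum>l=1..m - 1. real l / real m * sin (2 * pi * real r * real l / real m)) = - cot (pi * real r / real m) / 2"
proof -
  have m: "m > 0" using r by auto
  define x where "x = pi * real r / real m"
  define w where "w = cis (2 * x)"
  have x: "0 < x" "x < pi" using r by (auto simp: x_def field_simps)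
  hence sx: "sin x > 0" by (rule sin_gt_zero)
  have wl: "w ^ l = Complex (cos (2 * pi * real r * real l / real m)) (sin (2 * pi * real r * real l / real m))" for l
    unfolding w_def x_def Complex.DeMoivre by (simp add: cis.ctr mult_ac)
  have wm: "w ^ m = 1"
  proof -
    have "w ^ m = cis (2 * pi * real r)" unfolding w_def x_def Complex.DeMoivre using m by (simp add: mult_ac)
    also have "\<dots> = 1" by (rule cis_multiple_2pi) auto
    finally show ?thesis .
  qed
  have w1': "w - 1 = 2 * sin x * (\<i> * cis x)"
    by (simp add: w_def complex_eq_iff cos_double_sin sin_double power2_eq_square)
  hence w1: "w - 1 \<noteq> 0" using sx by simp
  have "(w - 1) * (\<Sum>l<m. w ^ l) = 0" using power_diff_1_eq[of w m] wm by simp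
  hence G: "(\<Sum>l<m. w ^ l) = 0" using w1 by simp
  have "(w - 1) * (\<Sum>l<m. of_nat l * w ^ l) = of_nat m" using sum_index_times_power[of w m] G wm by simp
  hence I: "(\<Sum>l<m. of_nat l * w ^ l) = of_nat m / (w - 1)" using w1 by (simp add: field_simps)
  have J: "1 / (w - 1) = Complex (- 1 / 2) (- cot x / 2)"
  proof -
    have "(w - 1) * Complex (- 1 / 2) (- cot x / 2) = 1"
      unfolding w1' using sx sin_cos_squared_add[of x]
      by (simp add: complex_eq_iff cot_def field_simps power2_eq_square)
    thus ?thesis using w1 by (simp add: field_simps)
  qed
  have split: "(\<Sum>l<m. f l) = f 0 + (\<Sum>l=1..m - 1. f l)" for f :: "nat \<Rightarrow> complex"
  proof -
    have "{..<m} = insert 0 {1..m - 1}" using m by auto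
    thus ?thesis by simp
  qed
  have G': "(\<Sum>l=1..m - 1. w ^ l) = -1" using G split[of "\<lambda>l. w ^ l"] by (simp add: add_eq_0_iff)
  have "(\<Sum>l=1..m - 1. of_nat l * w ^ l) = of_nat m / (w - 1)" using I split[of "\<lambda>l. of_nat l * w ^ l"] by simp
  hence "(\<Sum>l=1..m - 1. of_nat l * w ^ l) / of_nat m = 1 / (w - 1)" using m by simp
  hence I': "(\<Sum>l=1..m - 1. of_real (real l / real m) * w ^ l) = Complex (- 1 / 2) (- cot x / 2)"
    unfolding J by (simp add: sum_divide_distrib)
  show "(\<Sum>l=1..m - 1. cos (2 * pi * real r * real l / real m)) = -1"
    using arg_cong[OF G', of Re] by (simp add: wl)
  show "(\<Sum>l=1..m - 1. sin (2 * pi * real r * real l / real m)) = 0"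
    using arg_cong[OF G', of Im] by (simp add: wl)
  show "(\<Sum>l=1..m - 1. real l / real m * cos (2 * pi * real r * real l / real m)) = - 1 / 2"
    using arg_cong[OF I', of Re] by (simp only: Re_sum Re_complex_of_real wl complex.sel times_complex.sel Im_complex_of_real) simp
  show "(\<Sum>l=1..m - 1. real l / real m * sin (2 * pi * real r * real l / real m)) = - cot (pi * real r / real m) / 2"
    using arg_cong[OF I', of Im] by (simp only: Im_sum Re_complex_of_real wl complex.sel times_complex.sel Im_complex_of_real) (simp add: x_def)
qed

text \<open>Pairing l with m - l keeps the cosine and turns the product of Gamma values into pi /
  sin. A sine changes sign under this pairing, which is why ln Gamma survives in the sine sum of the
  theorem.\<close>

lemma sum_cos_ln_Gamma:
  fixes m r :: nat
  assumes r: "0 < r" "r < m"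
  shows "(\<Sum>l=1..m - 1. cos (2 * pi * real r * real l / real m) * ln (Gamma (real l / real m))) =
         - (ln pi + (\<Sum>l=1..m - 1. cos (2 * pi * real r * real l / real m) * ln (sin (pi * real l / real m)))) / 2"
proof -
  define c where "c = (\<lambda>l. cos (2 * pi * real r * real l / real m))"
  have m: "m > 0" using r by auto
  have "(\<Sum>l=1..m - 1. c l * ln (Gamma (real l / real m))) = (\<Sum>l=1..m - 1. c (m - l) * ln (Gamma (real (m - l) / real m)))"
    by (rule sum.reindex_bij_witness[of _ "\<lambda>l. m - l" "\<lambda>l. m - l"]) auto
  also have "\<dots> = (\<Sum>l=1..m - 1. c l * ln (Gamma (1 - real l / real m)))"
  proof (intro sum.cong refl)
    fix l assume l: "l \<in> {1..m - 1}"
    have ml: "real (m - l) = real m - real l" using l by (auto simp: of_nat_diff)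
    have "2 * pi * real r * real (m - l) / real m = - (2 * pi * real r * real l / real m) + 2 * pi * real r"
      using m by (simp add: ml field_simps)
    hence "c (m - l) = cos (- (2 * pi * real r * real l / real m) + 2 * pi * of_int (int r))"
      by (simp add: c_def)
    also have "\<dots> = c l"
      using cos_int_2pin[of "int r"] sin_int_2pin[of "int r"] unfolding cos_add by (simp add: c_def)
    finally have "c (m - l) = c l" .
    moreover have "real (m - l) / real m = 1 - real l / real m" using m by (simp add: ml field_simps)
    ultimately show "c (m - l) * ln (Gamma (real (m - l) / real m)) = c l * ln (Gamma (1 - real l / real m))" by simp
  qed
  finally have "2 * (\<Sum>l=1..m - 1. c l * ln (Gamma (real l / real m))) =
     (\<Sum>l=1..m - 1. c l * ln (Gamma (real l / real m)) + c l * ln (Gamma (1 - real l / real m)))"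
    by (simp add: sum.distrib)
  also have "\<dots> = (\<Sum>l=1..m - 1. c l * ln pi - c l * ln (sin (pi * real l / real m)))"
  proof (intro sum.cong refl)
    fix l assume l: "l \<in> {1..m - 1}"
    define x where "x = real l / real m"
    have x: "0 < x" "x < 1" using l m by (auto simp: x_def field_simps)
    have sx: "sin (pi * x) > 0" using x by (intro sin_gt_zero) auto
    have "Gamma (complex_of_real x) * Gamma (of_real (1 - x)) = of_real (pi / sin (pi * x))"
      using Gamma_reflection_complex[of "of_real x"] sin_of_real[of "pi * x", where 'a = complex] by simp
    hence "Gamma x * Gamma (1 - x) = pi / sin (pi * x)"
      unfolding Gamma_complex_of_real of_real_mult [symmetric] of_real_eq_iff .
    hence "ln (Gamma x * Gamma (1 - x)) = ln (pi / sin (pi * x))" by simp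
    hence "ln (Gamma x) + ln (Gamma (1 - x)) = ln pi - ln (sin (pi * x))"
      using x sx Gamma_real_pos[of x] Gamma_real_pos[of "1 - x"] by (simp add: ln_mult_pos ln_div)
    thus "c l * ln (Gamma (real l / real m)) + c l * ln (Gamma (1 - real l / real m)) = c l * ln pi - c l * ln (sin (pi * real l / real m))"
      unfolding x_def by (simp flip: distrib_left right_diff_distrib)
  qed
  also have "\<dots> = (\<Sum>l=1..m - 1. c l) * ln pi - (\<Sum>l=1..m - 1. c l * ln (sin (pi * real l / real m)))"
    by (simp add: sum_subtractf sum_distrib_right)
  also have "(\<Sum>l=1..m - 1. c l) = -1" unfolding c_def by (rule trig_sums(1)[OF r])
  finally show ?thesis unfolding c_def by simp
qed

section \<open>Taylor series at the origin of the functions in the functional equation\<close>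

lemma hurwitz_zeta_fps:
  assumes l: "0 < l" "l \<le> m"
  obtains W where "(\<lambda>s. hurwitz_reg (real l / real m) s / (s - 1)) has_fps_expansion W"
    "\<And>n. fps_nth W n = hurwitz_zeta_deriv0 n (real l / real m) / fact n"
    "fps_nth W 0 = of_real (1 / 2 - real l / real m)"
    "fps_nth W 1 = of_real (ln (Gamma (real l / real m)) - ln (2 * pi) / 2)"
proof -
  define v where "v = real l / real m"
  have v: "v > 0" using l by (auto simp: v_def)
  define Z where "Z = (\<lambda>s. hurwitz_reg v s / (s - 1))"
  have op: "open ({s. Re s > -1} - {1})" by (auto intro!: open_Diff open_halfspace_Re_gt)
  have "Z holomorphic_on {s. Re s > -1} - {1}"
    unfolding Z_def by (intro holomorphic_intros holomorphic_on_subset[OF holomorphic_hurwitz_reg[OF v]]) auto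
  hence "Z analytic_on {s. Re s > -1} - {1}" using op by (simp only: analytic_on_open)
  hence "Z analytic_on {0}" by (rule analytic_on_subset) auto
  then obtain W where W: "Z has_fps_expansion W" using analytic_at_imp_has_fps_expansion_0 by blast
  show ?thesis
  proof (rule that[of W])
    show "(\<lambda>s. hurwitz_reg (real l / real m) s / (s - 1)) has_fps_expansion W"
      using W by (simp add: Z_def v_def)
    have "(\<lambda>s. hurwitz_zeta s v) has_fps_expansion W"
      using W eventually_hurwitz_zeta_eq[OF l] unfolding Z_def v_def
      by (subst has_fps_expansion_cong[OF _ refl]) auto
    thus "fps_nth W n = hurwitz_zeta_deriv0 n (real l / real m) / fact n" for n
      using fps_nth_fps_expansion unfolding hurwitz_zeta_deriv0_def v_def by blast
    have "fps_nth W 0 = Z 0" using has_fps_expansion_imp_0_eq_fps_nth_0[OF W] by simp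
    thus "fps_nth W 0 = of_real (1 / 2 - real l / real m)"
      using hurwitz_reg_0[OF v] by (simp add: Z_def v_def)
    have "fps_nth W 1 = deriv Z 0" using fps_nth_fps_expansion[OF W, of 1] by simp
    also have "\<dots> = of_real (ln (Gamma v) - ln (2 * pi) / 2)"
      unfolding Z_def by (rule DERIV_imp_deriv[OF lerch_deriv_0[OF v]])
    finally show "fps_nth W 1 = of_real (ln (Gamma (real l / real m)) - ln (2 * pi) / 2)"
      by (simp add: v_def)
  qed
qed

lemma hurwitz_reg_reflected_fps:
  assumes v: "v > 0"
  obtains R where "(\<lambda>s. hurwitz_reg v (1 - s)) has_fps_expansion R" "fps_nth R 0 = 1"
proof -
  have "(\<lambda>s. hurwitz_reg v (1 - s)) analytic_on {s. Re s < 2}"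
    using holomorphic_hurwitz_reg_reflected[OF v] by (simp add: analytic_on_open open_halfspace_Re_lt)
  hence "(\<lambda>s. hurwitz_reg v (1 - s)) analytic_on {0}" by (rule analytic_on_subset) auto
  then obtain R where R: "(\<lambda>s. hurwitz_reg v (1 - s)) has_fps_expansion R"
    using analytic_at_imp_has_fps_expansion_0 by blast
  moreover have "fps_nth R 0 = 1"
    using has_fps_expansion_imp_0_eq_fps_nth_0[OF R] hurwitz_reg_1[OF v] by simp
  ultimately show ?thesis by (rule that)
qed

lemma Gamma_fps:
  obtains G where "(\<lambda>s. Gamma (1 + s)) has_fps_expansion (G :: complex fps)" "fps_nth G 0 = 1"
    "fps_nth G 1 = - euler_mascheroni" "fps_nth G 2 = (euler_mascheroni\<^sup>2 + of_real (pi\<^sup>2 / 6)) / 2"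
proof -
  have "(\<lambda>s::complex. Gamma (1 + s)) analytic_on {0}"
    by (intro analytic_intros) auto
  then obtain G where "(\<lambda>s. Gamma (1 + s)) has_fps_expansion (G :: complex fps)"
    using analytic_at_imp_has_fps_expansion_0 by blast
  with that Gamma_fps_coeffs[OF this] show ?thesis by blast
qed

lemma powr_minus_fps:
  assumes c: "c > 0"
  shows "(\<lambda>s. complex_of_real c powr (- s)) has_fps_expansion fps_exp (- of_real (ln c))"
proof -
  have "(\<lambda>s. complex_of_real c powr (- s)) = (\<lambda>s. exp (- of_real (ln c) * s))"
    using c by (auto simp: powr_def Ln_of_real fun_eq_iff mult.commute)
  thus ?thesis using has_fps_expansion_exp[of "- complex_of_real (ln c)"] by simp
qed

text \<open>Coefficient of s in Riemann's equation: with zeta(0) = -1/2 and zeta'(0) = -ln(2 pi)/2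
  the contributions of ln(2 pi) cancel and Gamma'(1) = -gamma is left. This identifies gamma_0 with
  Euler's constant.\<close>

lemma stieltjes_0_fps:
  assumes R: "(\<lambda>s. hurwitz_reg 1 (1 - s)) has_fps_expansion R"
  shows "fps_nth R 1 = - euler_mascheroni"
proof -
  obtain W where "(\<lambda>s. hurwitz_reg (real 1 / real 1) s / (s - 1)) has_fps_expansion W"
    "fps_nth W 0 = of_real (1 / 2 - real 1 / real 1)"
    "fps_nth W 1 = of_real (ln (Gamma (real 1 / real 1)) - ln (2 * pi) / 2)"
    by (rule hurwitz_zeta_fps[of 1 1]) (simp, simp, blast)
  hence W: "(\<lambda>s. hurwitz_reg 1 s / (s - 1)) has_fps_expansion W"
    "fps_nth W 0 = - 1 / 2" "fps_nth W 1 = - of_real (ln (2 * pi)) / 2"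
    by simp_all
  obtain G where G: "(\<lambda>s. Gamma (1 + s)) has_fps_expansion (G :: complex fps)" "fps_nth G 0 = 1"
    "fps_nth G 1 = - euler_mascheroni" by (rule Gamma_fps)
  define F where "F = fps_const (-2) * (G * fps_exp (- complex_of_real (ln (2 * pi))) * fps_cos (of_real (pi / 2)) * W)"
  have F: "(\<lambda>s. -2 * (Gamma (1 + s) * of_real (2 * pi) powr (- s) * cos (of_real (pi / 2) * s) * (hurwitz_reg 1 s / (s - 1)))) has_fps_expansion F"
    unfolding F_def using powr_minus_fps[of "2 * pi"]
    by (intro has_fps_expansion_cmult_left has_fps_expansion_mult G W has_fps_expansion_cos) auto
  have "eventually (\<lambda>s. s \<in> ({s. Re s > -1} \<inter> {s. Re s < 2}) - {1}) (nhds (0::complex))"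
    by (intro eventually_nhds_in_open open_Diff open_Int open_halfspace_Re_gt open_halfspace_Re_lt) auto
  hence ev: "eventually (\<lambda>s. hurwitz_reg 1 (1 - s) =
      -2 * (Gamma (1 + s) * of_real (2 * pi) powr (- s) * cos (of_real (pi / 2) * s) * (hurwitz_reg 1 s / (s - 1)))) (nhds 0)"
  proof eventually_elim
    case (elim s)
    have "x = -2 * (g * (h / (s - 1)))" if "(1 - s) * x = 2 * g * h" "s \<noteq> 1" for x g h :: complex
      using that by (simp add: divide_simps) (simp add: algebra_simps)
    thus ?case using riemann_functional[of s] elim by (simp add: mult.assoc)
  qed
  have "(\<lambda>s. hurwitz_reg 1 (1 - s)) has_fps_expansion F"
    using F by (subst has_fps_expansion_cong[OF ev refl])
  hence "R = F" using R by (rule fps_expansion_unique_complex[rotated])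
  thus ?thesis
    by (simp add: F_def fps_mult_nth G[unfolded One_nat_def] W[unfolded One_nat_def] fps_cos_def field_simps)
qed

text \<open>By Riemann's equation the term l = m is m^(-s) times the value for parameter 1; the
  addition theorem for the cosine splits the other terms. The minus sign comes from dividing by 1 -
  s while the sums are divided by s - 1.\<close>

lemma hurwitz_reg_reflected_eq:
  assumes r: "0 < r" "r < m" and s: "-1 < Re s" "Re s < 1"
  shows "hurwitz_reg (real r / real m) (1 - s) =
    of_real (real m) powr (-s) * hurwitz_reg 1 (1 - s) - 2 * (Gamma (1 + s) * of_real (2 * pi * real m) powr (-s) *
     (cos (of_real (pi / 2) * s) * (\<Sum>l=1..m - 1. of_real (cos (2 * pi * real r * real l / real m)) * (hurwitz_reg (real l / real m) s / (s - 1))) +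
      sin (of_real (pi / 2) * s) * (\<Sum>l=1..m - 1. of_real (sin (2 * pi * real r * real l / real m)) * (hurwitz_reg (real l / real m) s / (s - 1)))))"
proof -
  have m: "m > 0" and s1: "s \<noteq> 1" using r s by auto
  define p p2 where "p = complex_of_real (real m) powr (-s)" and "p2 = complex_of_real (2 * pi) powr (-s)"
  have pp: "complex_of_real (2 * pi * real m) powr (-s) = p2 * p"
    using powr_times_real[of "of_real (2 * pi)" "of_nat m" "-s"] by (simp add: p_def p2_def)
  define ct st where "ct = (\<lambda>l. complex_of_real (cos (2 * pi * real r * real l / real m)))"
    and "st = (\<lambda>l. complex_of_real (sin (2 * pi * real r * real l / real m)))"
  define cc ss where "cc = cos (of_real (pi / 2) * s)" and "ss = sin (of_real (pi / 2) * s)"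
  define h where "h = (\<lambda>l. hurwitz_reg (real l / real m) s)"
  have split: "(\<Sum>l=1..m. f l) = (\<Sum>l=1..m - 1. f l) + f m" for f :: "nat \<Rightarrow> complex"
    using m by (cases m) auto
  have "2 * pi * real r * real m / real m = 2 * pi * of_int (int r)" using m by simp
  hence ctm: "ct m = 1" "st m = 0"
    unfolding ct_def st_def by (simp_all only: cos_int_2pin sin_int_2pin) simp_all
  have "(\<Sum>l=1..m. cos (of_real (pi / 2) * s - of_real (2 * pi * real r * real l / real m)) * h l) =
        (\<Sum>l=1..m. cc * (ct l * h l) + ss * (st l * h l))"
    unfolding cos_diff cos_of_real sin_of_real cc_def ss_def ct_def st_def
    by (intro sum.cong refl) (simp add: algebra_simps)
  also have "\<dots> = cc * (\<Sum>l=1..m - 1. ct l * h l) + ss * (\<Sum>l=1..m - 1. st l * h l) + cc * h m"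
    unfolding sum.distrib sum_distrib_left [symmetric] split ctm by (simp add: distrib_left)
  finally have "functional_rhs m r s = 2 * Gamma (1 + s) * (p2 * p) *
     (cc * (\<Sum>l=1..m - 1. ct l * h l) + ss * (\<Sum>l=1..m - 1. st l * h l) + cc * h m)"
    unfolding functional_rhs_def pp h_def by simp
  hence 1: "(1 - s) * hurwitz_reg (real r / real m) (1 - s) = 2 * Gamma (1 + s) * (p2 * p) *
     (cc * (\<Sum>l=1..m - 1. ct l * h l) + ss * (\<Sum>l=1..m - 1. st l * h l) + cc * h m)"
    using hurwitz_functional[of r m s] r s by simp
  have 2: "(1 - s) * hurwitz_reg 1 (1 - s) = 2 * Gamma (1 + s) * p2 * cc * h m"
    using riemann_functional[of s] s m by (simp add: p2_def cc_def h_def)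
  have gen: "x = p * y - 2 * (g * (p2 * p) * (cc * (A / (s - 1)) + ss * (B / (s - 1))))"
    if "(1 - s) * x = 2 * g * (p2 * p) * (cc * A + ss * B + cc * k)" "(1 - s) * y = 2 * g * p2 * cc * k" for x y g A B k
  proof -
    have "(1 - s) * x = p * ((1 - s) * y) + 2 * g * (p2 * p) * (cc * A + ss * B)"
      unfolding that by (simp add: algebra_simps)
    thus ?thesis using s1 by (simp add: divide_simps) (simp add: algebra_simps)
  qed
  have "(\<Sum>l=1..m - 1. ct l * (h l / (s - 1))) = (\<Sum>l=1..m - 1. ct l * h l) / (s - 1)"
    "(\<Sum>l=1..m - 1. st l * (h l / (s - 1))) = (\<Sum>l=1..m - 1. st l * h l) / (s - 1)"
    by (simp_all add: sum_divide_distrib)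
  with gen[OF 1 2] show ?thesis
    unfolding pp p_def[symmetric] cc_def[symmetric] ss_def[symmetric] ct_def h_def st_def by simp
qed

section \<open>Comparison of the third Taylor coefficients\<close>

theorem mainTheorem4:
  fixes m r :: nat
  assumes "m \<ge> 2" and "r \<in> {1..m - 1}"
  shows "gen_stieltjes 2 (real r / real m) =
      stieltjes 2
    + 2 / 3 * (\<Sum>l = 1..m - 1. complex_of_real (cos (2 * pi * real r * real l / real m))
                 * hurwitz_zeta_deriv0 3 (real l / real m))
    - 2 * complex_of_real (euler_mascheroni + ln (2 * pi * real m))
        * (\<Sum>l = 1..m - 1. complex_of_real (cos (2 * pi * real r * real l / real m))
             * hurwitz_zeta_deriv0 2 (real l / real m))
    + complex_of_real pi
        * (\<Sum>l = 1..m - 1. complex_of_real (sin (2 * pi * real r * real l / real m))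
             * hurwitz_zeta_deriv0 2 (real l / real m))
    - complex_of_real (2 * pi * (euler_mascheroni + ln (2 * pi * real m))
        * (\<Sum>l = 1..m - 1. sin (2 * pi * real r * real l / real m)
             * ln (Gamma (real l / real m))))
    + complex_of_real ((pi\<^sup>2 / 12 - (euler_mascheroni + ln (2 * pi * real m))\<^sup>2)
        * (\<Sum>l = 1..m - 1. cos (2 * pi * real r * real l / real m)
             * ln (sin (pi * real l / real m))))
    + complex_of_real (euler_mascheroni\<^sup>2 * ln 2)
    - 2 * stieltjes 1 * complex_of_real (ln (real m))
    + complex_of_real ((pi\<^sup>2 / 12 + (euler_mascheroni + ln (2 * pi * real m))\<^sup>2)
        * (pi / 2) * cot (pi * real r / real m))
    + complex_of_real (euler_mascheroni
        * ((ln (real m))\<^sup>2 + 2 * (ln 2)\<^sup>2 + 2 * ln 2 * ln (pi * real m)))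
    - complex_of_real (pi\<^sup>2 / 12 * ln 2)
    + complex_of_real (((ln 2)\<^sup>2 + (ln (real m))\<^sup>2 + (ln pi)\<^sup>2 + 2 * ln pi * ln (real m)
        + 2 * ln 2 * ln (pi * real m)) * ln 2)
    + complex_of_real (1 / 3 * (ln (real m)) ^ 3)"
proof -
  have r: "0 < r" "r < m" "r \<le> m" and m: "m > 0" using assms by auto
  define a b where "a = (\<lambda>l. cos (2 * pi * real r * real l / real m))" and "b = (\<lambda>l. sin (2 * pi * real r * real l / real m))"
  define Z where "Z = (\<lambda>l s. hurwitz_reg (real l / real m) s / (s - 1))"
  have "\<exists>W. Z l has_fps_expansion W \<and> (\<forall>n. fps_nth W n = hurwitz_zeta_deriv0 n (real l / real m) / fact n) \<and>
      fps_nth W 0 = of_real (1 / 2 - real l / real m) \<and>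
      fps_nth W 1 = of_real (ln (Gamma (real l / real m)) - ln (2 * pi) / 2)" if "l \<in> {1..m - 1}" for l
  proof -
    have "0 < l" "l \<le> m" using that by auto
    thus ?thesis unfolding Z_def by (rule hurwitz_zeta_fps) blast
  qed
  then obtain W where W: "\<And>l. l \<in> {1..m - 1} \<Longrightarrow> Z l has_fps_expansion W l"
    "\<And>l n. l \<in> {1..m - 1} \<Longrightarrow> fps_nth (W l) n = hurwitz_zeta_deriv0 n (real l / real m) / fact n"
    "\<And>l. l \<in> {1..m - 1} \<Longrightarrow> fps_nth (W l) 0 = of_real (1 / 2 - real l / real m)"
    "\<And>l. l \<in> {1..m - 1} \<Longrightarrow> fps_nth (W l) 1 = of_real (ln (Gamma (real l / real m)) - ln (2 * pi) / 2)"
    by metis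
  \<comment> \<open>Taylor series of the cosine and sine sums; they enter up to orders 3 and 2, as
    sin (pi s/2) contributes a further factor s.\<close>
  define FC FS where "FC = (\<Sum>l=1..m - 1. fps_const (of_real (a l)) * W l)" and "FS = (\<Sum>l=1..m - 1. fps_const (of_real (b l)) * W l)"
  define C2 C3 S2 where "C2 = (\<Sum>l=1..m - 1. of_real (a l) * hurwitz_zeta_deriv0 2 (real l / real m))"
    and "C3 = (\<Sum>l=1..m - 1. of_real (a l) * hurwitz_zeta_deriv0 3 (real l / real m))"
    and "S2 = (\<Sum>l=1..m - 1. of_real (b l) * hurwitz_zeta_deriv0 2 (real l / real m))"
  define X Y where "X = (\<Sum>l=1..m - 1. a l * ln (sin (pi * real l / real m)))"
    and "Y = (\<Sum>l=1..m - 1. b l * ln (Gamma (real l / real m)))"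
  define T where "T = cot (pi * real r / real m)"
  have trig: "(\<Sum>l=1..m - 1. a l) = -1" "(\<Sum>l=1..m - 1. b l) = 0"
    "(\<Sum>l=1..m - 1. real l / real m * a l) = - 1 / 2" "(\<Sum>l=1..m - 1. real l / real m * b l) = - T / 2"
    unfolding a_def b_def T_def by (rule trig_sums[OF r(1,2)])+
  have FC: "fps_nth FC 0 = 0" "fps_nth FC 1 = of_real ((ln 2 - X) / 2)" "fps_nth FC 2 = C2 / 2" "fps_nth FC 3 = C3 / 6"
  proof -
    have "fps_nth FC 0 = (\<Sum>l=1..m - 1. of_real (a l * (1 / 2 - real l / real m)))"
      unfolding FC_def by (simp add: fps_sum_nth W(3))
    also have "\<dots> = of_real ((\<Sum>l=1..m - 1. a l) / 2 - (\<Sum>l=1..m - 1. real l / real m * a l))"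
      unfolding of_real_sum [symmetric] by (simp add: right_diff_distrib sum_subtractf sum_divide_distrib mult.commute)
    finally show "fps_nth FC 0 = 0" unfolding trig by simp
    have "fps_nth FC 1 = (\<Sum>l=1..m - 1. of_real (a l * (ln (Gamma (real l / real m)) - ln (2 * pi) / 2)))"
      unfolding FC_def by (simp add: fps_sum_nth W(4)[unfolded One_nat_def])
    also have "\<dots> = of_real ((\<Sum>l=1..m - 1. a l * ln (Gamma (real l / real m))) - (\<Sum>l=1..m - 1. a l) * ln (2 * pi) / 2)"
      unfolding of_real_sum [symmetric] by (simp add: right_diff_distrib sum_subtractf sum_divide_distrib sum_distrib_right)
    also have "(\<Sum>l=1..m - 1. a l * ln (Gamma (real l / real m))) = - (ln pi + X) / 2"
      unfolding a_def X_def using sum_cos_ln_Gamma[OF r(1,2)] by simp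
    \<comment> \<open>Origin of the ln 2 in the theorem: ln pi from the reflection formula meets ln
      (2 pi) from Lerch's formula, the latter weighted by the cosine sum -1.\<close>
    also have "- (ln pi + X) / 2 - (\<Sum>l=1..m - 1. a l) * ln (2 * pi) / 2 = (ln 2 - X) / 2"
      unfolding trig by (simp add: ln_mult field_simps)
    finally show "fps_nth FC 1 = of_real ((ln 2 - X) / 2)" .
    show "fps_nth FC 2 = C2 / 2"
      unfolding FC_def C2_def by (simp add: fps_sum_nth W(2) sum_divide_distrib)
    show "fps_nth FC 3 = C3 / 6"
      unfolding FC_def C3_def by (simp add: fps_sum_nth W(2) sum_divide_distrib fact_numeral)
  qed
  have FS: "fps_nth FS 0 = of_real (T / 2)" "fps_nth FS 1 = of_real Y" "fps_nth FS 2 = S2 / 2"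
  proof -
    have "fps_nth FS 0 = (\<Sum>l=1..m - 1. of_real (b l * (1 / 2 - real l / real m)))"
      unfolding FS_def by (simp add: fps_sum_nth W(3))
    also have "\<dots> = of_real ((\<Sum>l=1..m - 1. b l) / 2 - (\<Sum>l=1..m - 1. real l / real m * b l))"
      unfolding of_real_sum [symmetric] by (simp add: right_diff_distrib sum_subtractf sum_divide_distrib mult.commute)
    finally show "fps_nth FS 0 = of_real (T / 2)" unfolding trig by simp
    have "fps_nth FS 1 = (\<Sum>l=1..m - 1. of_real (b l * (ln (Gamma (real l / real m)) - ln (2 * pi) / 2)))"
      unfolding FS_def by (simp add: fps_sum_nth W(4)[unfolded One_nat_def])
    also have "\<dots> = of_real ((\<Sum>l=1..m - 1. b l * ln (Gamma (real l / real m))) - (\<Sum>l=1..m - 1. b l) * ln (2 * pi) / 2)"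
      unfolding of_real_sum [symmetric] by (simp add: right_diff_distrib sum_subtractf sum_divide_distrib sum_distrib_right)
    finally show "fps_nth FS 1 = of_real Y" unfolding trig Y_def by simp
    show "fps_nth FS 2 = S2 / 2"
      unfolding FS_def S2_def by (simp add: fps_sum_nth W(2) sum_divide_distrib)
  qed
  obtain R where R: "(\<lambda>s. hurwitz_reg (real r / real m) (1 - s)) has_fps_expansion R"
    using hurwitz_reg_reflected_fps[of "real r / real m"] r by auto
  obtain R1 where R1: "(\<lambda>s. hurwitz_reg 1 (1 - s)) has_fps_expansion R1" "fps_nth R1 0 = 1"
    by (rule hurwitz_reg_reflected_fps[of 1]) auto
  \<comment> \<open>The parameter 1 is read as the fraction 1/1, which brings gamma_n(1) under the
    results on r/m.\<close>
  have R1': "(\<lambda>s. hurwitz_reg (real 1 / real 1) (1 - s)) has_fps_expansion R1" using R1 by simp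
  have g: "fps_nth R1 2 = - stieltjes 1" "fps_nth R1 3 = - stieltjes 2 / 2"
    using gen_stieltjes_eq[OF _ _ R1', of 1] gen_stieltjes_eq[OF _ _ R1', of 2]
    by (simp_all add: numeral_2_eq_2 numeral_3_eq_3)
  have gr: "gen_stieltjes 2 (real r / real m) = - 2 * fps_nth R 3"
    using gen_stieltjes_eq[OF r(1,3) R, of 2] by (simp add: numeral_2_eq_2 numeral_3_eq_3)
  obtain G where G: "(\<lambda>s. Gamma (1 + s)) has_fps_expansion (G :: complex fps)" "fps_nth G 0 = 1"
    "fps_nth G 1 = - euler_mascheroni" "fps_nth G 2 = (euler_mascheroni\<^sup>2 + of_real (pi\<^sup>2 / 6)) / 2" by (rule Gamma_fps)
  define F where "F = fps_exp (- of_real (ln (real m))) * R1 - fps_const 2 * (G * fps_exp (- of_real (ln (2 * pi * real m))) *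
      (fps_cos (of_real (pi / 2)) * FC + fps_sin (of_real (pi / 2)) * FS))"
  have F: "(\<lambda>s. of_real (real m) powr (-s) * hurwitz_reg 1 (1 - s) - 2 * (Gamma (1 + s) * of_real (2 * pi * real m) powr (-s) *
     (cos (of_real (pi / 2) * s) * (\<Sum>l=1..m - 1. of_real (a l) * Z l s) +
      sin (of_real (pi / 2) * s) * (\<Sum>l=1..m - 1. of_real (b l) * Z l s)))) has_fps_expansion F"
    unfolding F_def FC_def FS_def using m
    by (intro has_fps_expansion_diff has_fps_expansion_add has_fps_expansion_cmult_left has_fps_expansion_mult
      has_fps_expansion_sum powr_minus_fps R1 G W has_fps_expansion_sin has_fps_expansion_cos) auto
  have "eventually (\<lambda>s. s \<in> {s. Re s > -1} \<inter> {s. Re s < 1}) (nhds (0::complex))"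
    by (intro eventually_nhds_in_open open_Int open_halfspace_Re_gt open_halfspace_Re_lt) auto
  hence ev: "eventually (\<lambda>s. hurwitz_reg (real r / real m) (1 - s) =
     of_real (real m) powr (-s) * hurwitz_reg 1 (1 - s) - 2 * (Gamma (1 + s) * of_real (2 * pi * real m) powr (-s) *
     (cos (of_real (pi / 2) * s) * (\<Sum>l=1..m - 1. of_real (a l) * Z l s) +
      sin (of_real (pi / 2) * s) * (\<Sum>l=1..m - 1. of_real (b l) * Z l s)))) (nhds 0)"
    by eventually_elim (use hurwitz_reg_reflected_eq[OF r(1,2)] in \<open>auto simp: a_def b_def Z_def\<close>)
  have "(\<lambda>s. hurwitz_reg (real r / real m) (1 - s)) has_fps_expansion F"
    using F by (subst has_fps_expansion_cong[OF ev refl])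
  with R have RF: "R = F" by (rule fps_expansion_unique_complex)
  \<comment> \<open>With Euler's constant, pi and the logarithms of m, 2 and pi as independent
    unknowns, the claim becomes a polynomial identity.\<close>
  define E where "E = (euler_mascheroni :: complex)"
  define L where "L = complex_of_real (ln (real m))"
  define L2 Lp where "L2 = complex_of_real (ln 2)" and "Lp = complex_of_real (ln pi)"
  define P where "P = complex_of_real pi"
  have ln1: "complex_of_real (ln (2 * pi * real m)) = L2 + Lp + L" "complex_of_real (ln (pi * real m)) = Lp + L"
    using m by (simp_all add: ln_mult L_def L2_def Lp_def)
  have R13: "fps_nth R1 1 = - E" using stieltjes_0_fps[OF R1(1)] by (simp add: E_def)
  note simps = fps_mult_nth numeral_2_eq_2 numeral_3_eq_3
  have e: "fps_nth (fps_exp (- c)) 1 = - c" "fps_nth (fps_exp (- c)) 2 = c\<^sup>2 / 2" "fps_nth (fps_exp (- c)) 3 = - (c ^ 3) / 6" for c :: complex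
    by (simp_all add: fact_numeral)
  have cs: "fps_nth (fps_cos (P / 2)) 0 = 1" "fps_nth (fps_cos (P / 2)) 1 = 0" "fps_nth (fps_cos (P / 2)) 2 = - P\<^sup>2 / 8" "fps_nth (fps_cos (P / 2)) 3 = 0"
    "fps_nth (fps_sin (P / 2)) 0 = 0" "fps_nth (fps_sin (P / 2)) 1 = P / 2" "fps_nth (fps_sin (P / 2)) 2 = 0" "fps_nth (fps_sin (P / 2)) 3 = - (P ^ 3) / 48"
    by (simp_all add: fps_cos_def fps_sin_def fact_numeral power_divide)
  have mult3: "fps_nth (f * g) 3 = fps_nth f 0 * fps_nth g 3 + fps_nth f 1 * fps_nth g 2 + fps_nth f 2 * fps_nth g 1 + fps_nth f 3 * fps_nth g 0"
    and mult2: "fps_nth (f * g) 2 = fps_nth f 0 * fps_nth g 2 + fps_nth f 1 * fps_nth g 1 + fps_nth f 2 * fps_nth g 0"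
    and mult1: "fps_nth (f * g) 1 = fps_nth f 0 * fps_nth g 1 + fps_nth f 1 * fps_nth g 0"
    for f g :: "complex fps" by (simp_all add: simps)
  have final: "gen_stieltjes 2 (real r / real m) =
     stieltjes 2 + 2 / 3 * C3 - 2 * (E + (L2 + Lp + L)) * C2 + P * S2 - 2 * P * (E + (L2 + Lp + L)) * of_real Y
     + (P\<^sup>2 / 12 - (E + (L2 + Lp + L))\<^sup>2) * of_real X + E\<^sup>2 * L2 - 2 * stieltjes 1 * L
     + (P\<^sup>2 / 12 + (E + (L2 + Lp + L))\<^sup>2) * (P / 2) * of_real T
     + E * (L\<^sup>2 + 2 * L2\<^sup>2 + 2 * L2 * (Lp + L)) - P\<^sup>2 / 12 * L2
     + (L2\<^sup>2 + L\<^sup>2 + Lp\<^sup>2 + 2 * Lp * L + 2 * L2 * (Lp + L)) * L2 + 1 / 3 * L ^ 3"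
  proof -
    have "fps_nth R 3 = fps_nth R1 0 * (- (L ^ 3) / 6) + fps_nth R1 1 * (L\<^sup>2 / 2) - fps_nth R1 2 * L + fps_nth R1 3
       - 2 * fps_nth (G * fps_exp (- (L2 + Lp + L)) * (fps_cos (P / 2) * FC + fps_sin (P / 2) * FS)) 3"
      unfolding RF F_def ln1 L_def[symmetric] by (simp add: mult3 e P_def fact_numeral mult.commute)
    also have "fps_nth (G * fps_exp (- (L2 + Lp + L)) * (fps_cos (P / 2) * FC + fps_sin (P / 2) * FS)) 3 =
        (C3 / 6 - P\<^sup>2 / 8 * ((L2 - of_real X) / 2) + P / 2 * (S2 / 2) - P ^ 3 / 48 * (of_real T / 2))
        - (E + (L2 + Lp + L)) * (C2 / 2 + P / 2 * of_real Y)
        + ((E\<^sup>2 + P\<^sup>2 / 6) / 2 + E * (L2 + Lp + L) + (L2 + Lp + L)\<^sup>2 / 2) * ((L2 - of_real X) / 2 + P / 2 * (of_real T / 2))"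
    proof -
      \<comment> \<open>K has no constant term, so the product needs H only up to its second
        coefficient, which is (E + ln(2 pi m))^2 / 2 + pi^2/12.\<close>
      define H K where "H = G * fps_exp (- (L2 + Lp + L))" and "K = fps_cos (P / 2) * FC + fps_sin (P / 2) * FS"
      have HH: "fps_nth H 0 = 1" "fps_nth H 1 = - (E + (L2 + Lp + L))"
        "fps_nth H 2 = (E\<^sup>2 + P\<^sup>2 / 6) / 2 + E * (L2 + Lp + L) + (L2 + Lp + L)\<^sup>2 / 2"
        unfolding H_def mult1 mult2 e G E_def P_def by (simp_all add: G(2) algebra_simps)
      have KK: "fps_nth K 0 = 0" "fps_nth K 1 = (L2 - of_real X) / 2 + P / 2 * (of_real T / 2)"
        "fps_nth K 2 = C2 / 2 + P / 2 * of_real Y"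
        "fps_nth K 3 = C3 / 6 - P\<^sup>2 / 8 * ((L2 - of_real X) / 2) + P / 2 * (S2 / 2) - P ^ 3 / 48 * (of_real T / 2)"
        unfolding K_def fps_add_nth mult1 mult2 mult3 cs FC FS by (simp_all add: cs FC FS L2_def)
      show ?thesis unfolding H_def[symmetric] K_def[symmetric] mult3 HH KK by (simp add: field_simps)
    qed
    finally have r3: "fps_nth R 3 = - (L ^ 3) / 6 - E * (L\<^sup>2 / 2) + stieltjes 1 * L - stieltjes 2 / 2
       - 2 * ((C3 / 6 - P\<^sup>2 / 8 * ((L2 - of_real X) / 2) + P / 2 * (S2 / 2) - P ^ 3 / 48 * (of_real T / 2))
        - (E + (L2 + Lp + L)) * (C2 / 2 + P / 2 * of_real Y)
        + ((E\<^sup>2 + P\<^sup>2 / 6) / 2 + E * (L2 + Lp + L) + (L2 + Lp + L)\<^sup>2 / 2) * ((L2 - of_real X) / 2 + P / 2 * (of_real T / 2)))"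
      unfolding R1(2) R13 g by simp
    \<comment> \<open>The product enters with factor (-2)(-2) = 4. Both fractions pi^2/12 of the
      theorem combine Gamma with the trigonometric series: pi^2/12 - pi^2/8 = -pi^2/24 multiplies
      (ln 2 - X)/2, and pi^3/48 - pi^3/96 = pi^3/96 multiplies T. The part (E + ln(2 pi m))^2 ln 2,
      expanded, gives the terms with ln 2 alone; E ln^2 m and (ln^3 m)/3 come from m^(-s).\<close>
    show ?thesis unfolding gr r3
      by (simp add: field_simps power2_eq_square power3_eq_cube)
  qed
  have ab: "cos (2 * pi * real r * real l / real m) = a l" "sin (2 * pi * real r * real l / real m) = b l" for l
    by (simp_all add: a_def b_def)
  show ?thesis
    unfolding ab C2_def [symmetric] C3_def [symmetric] S2_def [symmetric] X_def [symmetric] Y_def [symmetric] T_def [symmetric]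
      of_real_mult of_real_add of_real_diff of_real_power of_real_divide of_real_numeral of_real_1 of_real_euler_mascheroni
      ln1 L_def [symmetric] L2_def [symmetric] Lp_def [symmetric] P_def [symmetric] E_def [symmetric]
    by (rule final)
qed

end
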